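(* Let $(\omega_1,\omega_2,\omega_3)$ be an $\boldsymbol\varepsilon$-hypersymplectic structure on a Lie algebroid $(A,\rho,[\cdot,\cdot])$ such that $\varepsilon_1\varepsilon_2\varepsilon_3=1$, with inverse Poisson bivectors $\pi_i$, transition tensors $N_i$ and induced tensor $g$. For all $i\in\{1,2,3\}$ (indices in $\mathbb{Z}_3$), the pair $(\pi_i,N_i)$ is a Poisson–Nijenhuis ($PN$) structure on $A$ and $i_{N_i^*}\pi_i=2\varepsilon_{i+1}\,g^{-1}$.
   Context: Let $\mathrm d$ denote the differential of the Lie algebroid. For a $2$-form $\omega\in\Gamma(\bigwedge^2A^* )$, $\langle\omega^\flat(X),Y\rangle=\omega(X,Y)$; for a bivector $\pi\in\Gamma(\bigwedge^2A)$, $\langle\beta,\pi^\sharp(\alpha)\rangle=\pi(\alpha,\beta)$. A symplectic form is a closed non-degenerate $2$-form; its inverse Poisson bivector $\pi$ satisfies $\omega^\flat\circ\pi^\sharp=\mathrm{Id}_{A^*}$, $\pi^\sharp\circ\omega^\flat=\mathrm{Id}_A$. All indices are in $\mathbb{Z}_3=\{1,2,3\}$. Given symplectic forms $\omega_1,\omega_2,\omega_3$ with inverses $\pi_1,\pi_2,\pi_3$, the transition tensors are $N_i:=\pi_{i-1}^\sharp\circ\omega_{i+1}^\flat$. The triple is an $\boldsymbol\varepsilon$-hypersymplectic structure, $\boldsymbol\varepsilon=(\varepsilon_1,\varepsilon_2,\varepsilon_3)$ with $\varepsilon_i=\pm1$, if $N_i^2=\varepsilon_i\mathrm{Id}_A$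 for $i=1,2,3$. The induced tensor $g\in\Gamma(\bigotimes^2A^* )$ is $g(X,Y)=\langle g^\flat X,Y\rangle$ with $g^\flat:=\varepsilon_3\varepsilon_2\,\omega_3^\flat\circ\pi_1^\sharp\circ\omega_2^\flat$, and $g^{-1}(\alpha,\beta):=\langle(g^\flat)^{-1}(\alpha),\beta\rangle$; when $\varepsilon_1\varepsilon_2\varepsilon_3=1$, $g$ is a $2$-form and $g^{-1}$ a bivector. For a bivector $\pi$ and a bundle morphism $\varphi:A^*\to A^*$, $i_\varphi\pi(\alpha,\beta)=\pi(\varphi\alpha,\beta)-\pi(\varphi\beta,\alpha)$. For a bundle endomorphism $N$ of $A$ with transpose $N^*$: $[X,Y]_N=[NX,Y]+[X,NY]-N[X,Y]$ and $\mathcal TN(X,Y)=[NX,NY]-N[X,Y]_N$. For a bivector $\pi$, $[\alpha,\beta]_\pi=\mathcal L_{\pi^\sharp\alpha}\beta-\mathcal L_{\pi^\sharp\beta}\alpha-\mathrm d(\pi(\alpha,\beta))$ on $\Gamma(A^* )$, where $\mathcal L$ is the Lie derivative of the Lie algebroid. The Magri–Morosi concomitant is $C_{\pi,N}(\alpha,\beta)=([\alpha,\beta]_N)_\pi-([\alpha,\beta]_\pi)_{N^*}$, where $([\cdot,\cdot]_N)_\pi$ is the bracket on $\Gamma(A^* )$ obtained by the formula for $[\cdot,\cdot]_\pi$ applied to the deformed structure $(\rho\circ N,[\cdot,\cdot]_N)$ on $A$, and $([\alpha,\beta]_\pi)_{N^*}=[N^*\alpha,\beta]_\pi+[\alpha,N^*\beta]_\pi-N^*[\alpha,\beta]_\pi$.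 $(\pi,N)$ is a $PN$ structure if $[\pi,\pi]=0$ (Schouten–Nijenhuis bracket), $\mathcal TN=0$, $N\circ\pi^\sharp=\pi^\sharp\circ N^*$ and $C_{\pi,N}=0$. *)

theory Defs
  imports "HOL-Analysis.Analysis"
begin

section \<open>Smooth functions between normed spaces and on manifolds\<close>

text \<open>\<open>Ck_on k f S\<close> is meant for open \<open>S\<close> and a finite-dimensional domain.\<close>

primrec Ck_on ::
  "nat \<Rightarrow> ('a::real_normed_vector \<Rightarrow> 'b::real_normed_vector) \<Rightarrow> 'a set \<Rightarrow> bool" where
  "Ck_on 0 f S \<longleftrightarrow> continuous_on S f"
| "Ck_on (Suc k) f S \<longleftrightarrow> (\<forall>x\<in>S. f differentiable (at x)) \<and>
     (\<forall>v. Ck_on k (\<lambda>x. frechet_derivative f (at x) v) S)"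

definition smooth_on ::
  "'a set \<Rightarrow> ('a::real_normed_vector \<Rightarrow> 'b::real_normed_vector) \<Rightarrow> bool" where
  "smooth_on S f \<longleftrightarrow> (\<forall>k. Ck_on k f S)"

text \<open>
  Model spaces are finite-dimensional normed spaces rather than members of the class
  \<^class>\<open>euclidean_space\<close>, because the latter have positive dimension: the base may be a
  point (Lie algebras) and the rank may be zero.
\<close>

definition finite_dim :: "'a::real_vector itself \<Rightarrow> bool" where
  "finite_dim _ \<longleftrightarrow> (\<exists>B::'a set. finite B \<and> span B = UNIV)"

definition linear_on :: "'a::real_vector set \<Rightarrow> ('a \<Rightarrow> 'b::real_vector) \<Rightarrow> bool" where
  "linear_on S f \<longleftrightarrow> (\<forall>u\<in>S. \<forall>v\<in>S. \<forall>a b. f (a *\<^sub>R u + b *\<^sub>R v) = a *\<^sub>R f u + b *\<^sub>R f v)"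

text \<open>
  A manifold is a Hausdorff, second countable topological space (the type \<open>'m\<close>) with an atlas
  of pairs \<open>(U, \<kappa>)\<close> of a chart domain and a chart into the model space \<open>'e\<close>; the atlas need
  not be maximal.
\<close>

definition smooth_map_on ::
  "('m set \<times> ('m \<Rightarrow> 'e::real_normed_vector)) set \<Rightarrow> 'm set \<Rightarrow>
     ('m \<Rightarrow> 'b::real_normed_vector) \<Rightarrow> bool" where
  "smooth_map_on atlas W f \<longleftrightarrow>
     (\<forall>(U, \<kappa>)\<in>atlas. smooth_on (\<kappa> ` (U \<inter> W)) (f \<circ> inv_into U \<kappa>))"

definition smooth_atlas ::
  "('m::{t2_space, second_countable_topology} set \<times> ('m \<Rightarrow> 'e::real_normed_vector)) set
     \<Rightarrow> bool" where
  "smooth_atlas atlas \<longleftrightarrow>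
     finite_dim TYPE('e) \<and>
     (\<forall>x. \<exists>(U, \<kappa>)\<in>atlas. x \<in> U) \<and>
     (\<forall>(U, \<kappa>)\<in>atlas. open U \<and> open (\<kappa> ` U) \<and> homeomorphism U (\<kappa> ` U) \<kappa> (inv_into U \<kappa>)) \<and>
     (\<forall>(U, \<kappa>)\<in>atlas. smooth_map_on atlas U \<kappa>)"

abbreviation smooth_fun ::
  "('m set \<times> ('m \<Rightarrow> 'e::real_normed_vector)) set \<Rightarrow> ('m \<Rightarrow> real) \<Rightarrow> bool" where
  "smooth_fun atlas f \<equiv> smooth_map_on atlas UNIV f"

text \<open>Tangent vectors at \<open>x\<close> are derivations at \<open>x\<close> of the algebra of smooth functions.\<close>

definition derivation_at ::
  "('m set \<times> ('m \<Rightarrow> 'e::real_normed_vector)) set \<Rightarrow> 'm \<Rightarrow> (('m \<Rightarrow> real) \<Rightarrow> real) \<Rightarrow> bool" where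
  "derivation_at atlas x D \<longleftrightarrow>
     (\<forall>f h. smooth_fun atlas f \<longrightarrow> smooth_fun atlas h \<longrightarrow>
        (\<forall>a b. D (\<lambda>y. a * f y + b * h y) = a * D f + b * D h) \<and>
        D (\<lambda>y. f y * h y) = f x * D h + h x * D f)"

section \<open>Lie algebroids\<close>

text \<open>
  The fibres of the vector bundle over \<open>'m\<close> are subspaces of a common (possibly
  infinite-dimensional) real vector space \<open>'v\<close>.  A local trivialisation is a pair \<open>(U, \<phi>)\<close> with
  \<open>\<phi> x\<close> an isomorphism from the fibre at \<open>x \<in> U\<close> onto \<open>'f\<close>.  The anchor sends a fibre element
  at \<open>x\<close> to a tangent vector at \<open>x\<close>; \<open>bracket\<close> is a bracket on global sections.
\<close>

record ('m, 'e, 'v, 'f) algebroid =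
  atlas :: "('m set \<times> ('m \<Rightarrow> 'e)) set"
  fibre :: "'m \<Rightarrow> 'v set"
  trivs :: "('m set \<times> ('m \<Rightarrow> 'v \<Rightarrow> 'f)) set"
  anchor :: "'m \<Rightarrow> 'v \<Rightarrow> ('m \<Rightarrow> real) \<Rightarrow> real"
  bracket :: "('m \<Rightarrow> 'v) \<Rightarrow> ('m \<Rightarrow> 'v) \<Rightarrow> 'm \<Rightarrow> 'v"

abbreviation local_vec :: "('m, 'e, 'v, 'f) algebroid \<Rightarrow> ('m \<Rightarrow> 'v \<Rightarrow> 'f) \<Rightarrow> 'f \<Rightarrow> 'm \<Rightarrow> 'v" where
  "local_vec A \<phi> w x \<equiv> inv_into (fibre A x) (\<phi> x) w"

definition vector_bundle ::
  "('m::{t2_space, second_countable_topology}, 'e::real_normed_vector, 'v::real_vector,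
     'f::real_normed_vector) algebroid \<Rightarrow> bool" where
  "vector_bundle A \<longleftrightarrow>
     smooth_atlas (atlas A) \<and> finite_dim TYPE('f) \<and>
     (\<forall>x. subspace (fibre A x)) \<and>
     (\<forall>x. \<exists>(U, \<phi>)\<in>trivs A. x \<in> U) \<and>
     (\<forall>(U, \<phi>)\<in>trivs A. open U \<and>
        (\<forall>x\<in>U. linear_on (fibre A x) (\<phi> x) \<and> bij_betw (\<phi> x) (fibre A x) UNIV)) \<and>
     (\<forall>(U, \<phi>)\<in>trivs A. \<forall>(V, \<psi>)\<in>trivs A. \<forall>w.
        smooth_map_on (atlas A) (U \<inter> V) (\<lambda>x. \<psi> x (local_vec A \<phi> w x)))"

definition sections ::
  "('m, 'e::real_normed_vector, 'v, 'f::real_normed_vector) algebroid \<Rightarrow> ('m \<Rightarrow> 'v) set" where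
  "sections A = {X. (\<forall>x. X x \<in> fibre A x) \<and>
     (\<forall>(U, \<phi>)\<in>trivs A. smooth_map_on (atlas A) U (\<lambda>x. \<phi> x (X x)))}"

definition lie_algebroid ::
  "('m::{t2_space, second_countable_topology}, 'e::real_normed_vector, 'v::real_vector,
     'f::real_normed_vector) algebroid \<Rightarrow> bool" where
  "lie_algebroid A \<longleftrightarrow>
     vector_bundle A \<and>
     (\<forall>x. \<forall>v\<in>fibre A x. derivation_at (atlas A) x (anchor A x v)) \<and>
     (\<forall>x f. smooth_fun (atlas A) f \<longrightarrow> linear_on (fibre A x) (\<lambda>v. anchor A x v f)) \<and>
     (\<forall>X\<in>sections A. \<forall>f. smooth_fun (atlas A) f \<longrightarrow>
        smooth_fun (atlas A) (\<lambda>x. anchor A x (X x) f)) \<and>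
     (\<forall>X\<in>sections A. \<forall>Y\<in>sections A. bracket A X Y \<in> sections A) \<and>
     (\<forall>X\<in>sections A. \<forall>Y\<in>sections A. \<forall>Z\<in>sections A. \<forall>a b x.
        bracket A (\<lambda>y. a *\<^sub>R X y + b *\<^sub>R Y y) Z x
          = a *\<^sub>R bracket A X Z x + b *\<^sub>R bracket A Y Z x) \<and>
     (\<forall>X\<in>sections A. \<forall>Y\<in>sections A. \<forall>x. bracket A X Y x = - bracket A Y X x) \<and>
     (\<forall>X\<in>sections A. \<forall>Y\<in>sections A. \<forall>Z\<in>sections A. \<forall>x.
        bracket A X (bracket A Y Z) x + bracket A Y (bracket A Z X) x
          + bracket A Z (bracket A X Y) x = 0) \<and>
     (\<forall>X\<in>sections A. \<forall>Y\<in>sections A. \<forall>f. smooth_fun (atlas A) f \<longrightarrow>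
        (\<forall>x. bracket A X (\<lambda>y. f y *\<^sub>R Y y) x
               = f x *\<^sub>R bracket A X Y x + anchor A x (X x) f *\<^sub>R Y x))"

section \<open>Tensors on a Lie algebroid\<close>

text \<open>
  Covectors at \<open>x\<close> are functions on all of \<open>'v\<close> that vanish outside the fibre, so that equality
  of covectors is equality of functions.  Tensors are only meaningful on arguments from the
  fibres and their duals.
\<close>

definition dual_fibre :: "('m, 'e, 'v::real_vector, 'f) algebroid \<Rightarrow> 'm \<Rightarrow> ('v \<Rightarrow> real) set" where
  "dual_fibre A x = {\<alpha>. linear_on (fibre A x) \<alpha> \<and> (\<forall>v. v \<notin> fibre A x \<longrightarrow> \<alpha> v = 0)}"

definition restr :: "('m, 'e, 'v, 'f) algebroid \<Rightarrow> 'm \<Rightarrow> ('v \<Rightarrow> real) \<Rightarrow> 'v \<Rightarrow> real" where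
  "restr A x \<xi> v = (if v \<in> fibre A x then \<xi> v else 0)"

definition cosections ::
  "('m, 'e::real_normed_vector, 'v::real_vector, 'f::real_normed_vector) algebroid
     \<Rightarrow> ('m \<Rightarrow> 'v \<Rightarrow> real) set" where
  "cosections A = {\<alpha>. (\<forall>x. \<alpha> x \<in> dual_fibre A x) \<and>
     (\<forall>(U, \<phi>)\<in>trivs A. \<forall>w. smooth_map_on (atlas A) U (\<lambda>x. \<alpha> x (local_vec A \<phi> w x)))}"

definition two_form ::
  "('m, 'e::real_normed_vector, 'v::real_vector, 'f::real_normed_vector) algebroid
     \<Rightarrow> ('m \<Rightarrow> 'v \<Rightarrow> 'v \<Rightarrow> real) \<Rightarrow> bool" where
  "two_form A \<omega> \<longleftrightarrow>
     (\<forall>x. \<forall>u\<in>fibre A x. linear_on (fibre A x) (\<omega> x u)) \<and>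
     (\<forall>x. \<forall>u\<in>fibre A x. \<forall>v\<in>fibre A x. \<omega> x u v = - \<omega> x v u) \<and>
     (\<forall>(U, \<phi>)\<in>trivs A. \<forall>w w'.
        smooth_map_on (atlas A) U (\<lambda>x. \<omega> x (local_vec A \<phi> w x) (local_vec A \<phi> w' x)))"

definition bivector ::
  "('m, 'e::real_normed_vector, 'v::real_vector, 'f::real_normed_vector) algebroid
     \<Rightarrow> ('m \<Rightarrow> ('v \<Rightarrow> real) \<Rightarrow> ('v \<Rightarrow> real) \<Rightarrow> real) \<Rightarrow> bool" where
  "bivector A \<pi> \<longleftrightarrow>
     (\<forall>x. \<forall>\<alpha>\<in>dual_fibre A x. \<forall>\<beta>\<in>dual_fibre A x. \<forall>\<gamma>\<in>dual_fibre A x. \<forall>a b.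
        \<pi> x (\<lambda>v. a * \<alpha> v + b * \<beta> v) \<gamma> = a * \<pi> x \<alpha> \<gamma> + b * \<pi> x \<beta> \<gamma>) \<and>
     (\<forall>x. \<forall>\<alpha>\<in>dual_fibre A x. \<forall>\<beta>\<in>dual_fibre A x. \<pi> x \<alpha> \<beta> = - \<pi> x \<beta> \<alpha>) \<and>
     (\<forall>(U, \<phi>)\<in>trivs A. \<forall>\<xi> \<eta>. linear \<xi> \<longrightarrow> linear \<eta> \<longrightarrow>
        smooth_map_on (atlas A) U
          (\<lambda>x. \<pi> x (restr A x (\<lambda>v. \<xi> (\<phi> x v))) (restr A x (\<lambda>v. \<eta> (\<phi> x v)))))"

definition endomorphism ::
  "('m, 'e::real_normed_vector, 'v::real_vector, 'f::real_normed_vector) algebroid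
     \<Rightarrow> ('m \<Rightarrow> 'v \<Rightarrow> 'v) \<Rightarrow> bool" where
  "endomorphism A N \<longleftrightarrow>
     (\<forall>x. N x ` fibre A x \<subseteq> fibre A x \<and> linear_on (fibre A x) (N x)) \<and>
     (\<forall>(U, \<phi>)\<in>trivs A. \<forall>w. smooth_map_on (atlas A) U (\<lambda>x. \<phi> x (N x (local_vec A \<phi> w x))))"

definition flat ::
  "('m, 'e, 'v, 'f) algebroid \<Rightarrow> ('m \<Rightarrow> 'v \<Rightarrow> 'v \<Rightarrow> real) \<Rightarrow> 'm \<Rightarrow> 'v \<Rightarrow> 'v \<Rightarrow> real" where
  "flat A \<omega> x u = restr A x (\<omega> x u)"

definition sharp ::
  "('m, 'e, 'v::real_vector, 'f) algebroid \<Rightarrow> ('m \<Rightarrow> ('v \<Rightarrow> real) \<Rightarrow> ('v \<Rightarrow> real) \<Rightarrow> real)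
     \<Rightarrow> 'm \<Rightarrow> ('v \<Rightarrow> real) \<Rightarrow> 'v" where
  "sharp A \<pi> x \<alpha> = (THE v. v \<in> fibre A x \<and> (\<forall>\<beta>\<in>dual_fibre A x. \<beta> v = \<pi> x \<alpha> \<beta>))"

definition transpose_endo ::
  "('m, 'e, 'v, 'f) algebroid \<Rightarrow> ('m \<Rightarrow> 'v \<Rightarrow> 'v) \<Rightarrow> 'm \<Rightarrow> ('v \<Rightarrow> real) \<Rightarrow> 'v \<Rightarrow> real" where
  "transpose_endo A N x \<alpha> = restr A x (\<lambda>v. \<alpha> (N x v))"

definition insert_endo ::
  "('m \<Rightarrow> ('v \<Rightarrow> real) \<Rightarrow> 'v \<Rightarrow> real) \<Rightarrow> ('m \<Rightarrow> ('v \<Rightarrow> real) \<Rightarrow> ('v \<Rightarrow> real) \<Rightarrow> real)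
     \<Rightarrow> 'm \<Rightarrow> ('v \<Rightarrow> real) \<Rightarrow> ('v \<Rightarrow> real) \<Rightarrow> real" where
  "insert_endo \<phi> \<pi> x \<alpha> \<beta> = \<pi> x (\<phi> x \<alpha>) \<beta> - \<pi> x (\<phi> x \<beta>) \<alpha>"

section \<open>Differential calculus\<close>

definition d_fun :: "('m, 'e, 'v, 'f) algebroid \<Rightarrow> ('m \<Rightarrow> real) \<Rightarrow> 'm \<Rightarrow> 'v \<Rightarrow> real" where
  "d_fun A f x = restr A x (\<lambda>v. anchor A x v f)"

definition d_two_form ::
  "('m, 'e, 'v, 'f) algebroid \<Rightarrow> ('m \<Rightarrow> 'v \<Rightarrow> 'v \<Rightarrow> real)
     \<Rightarrow> ('m \<Rightarrow> 'v) \<Rightarrow> ('m \<Rightarrow> 'v) \<Rightarrow> ('m \<Rightarrow> 'v) \<Rightarrow> 'm \<Rightarrow> real" where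
  "d_two_form A \<omega> X Y Z x =
     anchor A x (X x) (\<lambda>y. \<omega> y (Y y) (Z y))
     - anchor A x (Y x) (\<lambda>y. \<omega> y (X y) (Z y))
     + anchor A x (Z x) (\<lambda>y. \<omega> y (X y) (Y y))
     - \<omega> x (bracket A X Y x) (Z x)
     + \<omega> x (bracket A X Z x) (Y x)
     - \<omega> x (bracket A Y Z x) (X x)"

definition lie_deriv ::
  "('m, 'e::real_normed_vector, 'v::real_vector, 'f::real_normed_vector) algebroid
     \<Rightarrow> ('m \<Rightarrow> 'v) \<Rightarrow> ('m \<Rightarrow> 'v \<Rightarrow> real) \<Rightarrow> 'm \<Rightarrow> 'v \<Rightarrow> real" where
  "lie_deriv A X \<beta> = (THE \<gamma>. \<gamma> \<in> cosections A \<and>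
     (\<forall>Y\<in>sections A. \<forall>x.
        \<gamma> x (Y x) = anchor A x (X x) (\<lambda>y. \<beta> y (Y y)) - \<beta> x (bracket A X Y x)))"

definition bivector_bracket ::
  "('m, 'e::real_normed_vector, 'v::real_vector, 'f::real_normed_vector) algebroid
     \<Rightarrow> ('m \<Rightarrow> ('v \<Rightarrow> real) \<Rightarrow> ('v \<Rightarrow> real) \<Rightarrow> real)
     \<Rightarrow> ('m \<Rightarrow> 'v \<Rightarrow> real) \<Rightarrow> ('m \<Rightarrow> 'v \<Rightarrow> real) \<Rightarrow> 'm \<Rightarrow> 'v \<Rightarrow> real" where
  "bivector_bracket A \<pi> \<alpha> \<beta> x v =
     lie_deriv A (\<lambda>y. sharp A \<pi> y (\<alpha> y)) \<beta> x v
     - lie_deriv A (\<lambda>y. sharp A \<pi> y (\<beta> y)) \<alpha> x v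
     - d_fun A (\<lambda>y. \<pi> y (\<alpha> y) (\<beta> y)) x v"

definition wedge2 :: "'v \<Rightarrow> 'v \<Rightarrow> ('v \<Rightarrow> real) \<Rightarrow> ('v \<Rightarrow> real) \<Rightarrow> real" where
  "wedge2 u v \<alpha> \<beta> = \<alpha> u * \<beta> v - \<alpha> v * \<beta> u"

definition wedge3 ::
  "'v \<Rightarrow> 'v \<Rightarrow> 'v \<Rightarrow> ('v \<Rightarrow> real) \<Rightarrow> ('v \<Rightarrow> real) \<Rightarrow> ('v \<Rightarrow> real) \<Rightarrow> real" where
  "wedge3 u v w \<alpha> \<beta> \<gamma> =
     \<alpha> u * wedge2 v w \<beta> \<gamma> - \<alpha> v * wedge2 u w \<beta> \<gamma> + \<alpha> w * wedge2 u v \<beta> \<gamma>"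

text \<open>
  The Schouten--Nijenhuis bracket of two bivectors, evaluated at \<open>x\<close> on three covectors.  It is
  the local, bi-additive extension of
    \<open>[X\<^sub>1 \<and> X\<^sub>2, Y\<^sub>1 \<and> Y\<^sub>2] = \<Sum>\<^sub>i\<^sub>j (-1)\<^bsup>i+j\<^esup> [X\<^sub>i, Y\<^sub>j] \<and> X\<^sub>i\<^sub>' \<and> Y\<^sub>j\<^sub>'\<close>
  where \<open>i'\<close>, \<open>j'\<close> are the complementary indices: near \<open>x\<close> both bivectors are finite sums of
  decomposable ones, and the value does not depend on the decompositions.
\<close>

definition schouten ::
  "('m::topological_space, 'e::real_normed_vector, 'v::real_vector, 'f::real_normed_vector) algebroid
     \<Rightarrow> ('m \<Rightarrow> ('v \<Rightarrow> real) \<Rightarrow> ('v \<Rightarrow> real) \<Rightarrow> real)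
     \<Rightarrow> ('m \<Rightarrow> ('v \<Rightarrow> real) \<Rightarrow> ('v \<Rightarrow> real) \<Rightarrow> real)
     \<Rightarrow> 'm \<Rightarrow> ('v \<Rightarrow> real) \<Rightarrow> ('v \<Rightarrow> real) \<Rightarrow> ('v \<Rightarrow> real) \<Rightarrow> real" where
  "schouten A P Q x \<alpha> \<beta> \<gamma> = (THE t. \<exists>U m n X\<^sub>1 X\<^sub>2 Y\<^sub>1 Y\<^sub>2.
     open U \<and> x \<in> U \<and>
     (\<forall>i<m::nat. X\<^sub>1 i \<in> sections A \<and> X\<^sub>2 i \<in> sections A) \<and>
     (\<forall>j<n::nat. Y\<^sub>1 j \<in> sections A \<and> Y\<^sub>2 j \<in> sections A) \<and>
     (\<forall>y\<in>U. \<forall>\<mu>\<in>dual_fibre A y. \<forall>\<nu>\<in>dual_fibre A y.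
        P y \<mu> \<nu> = (\<Sum>i<m. wedge2 (X\<^sub>1 i y) (X\<^sub>2 i y) \<mu> \<nu>) \<and>
        Q y \<mu> \<nu> = (\<Sum>j<n. wedge2 (Y\<^sub>1 j y) (Y\<^sub>2 j y) \<mu> \<nu>)) \<and>
     t = (\<Sum>i<m. \<Sum>j<n.
            wedge3 (bracket A (X\<^sub>1 i) (Y\<^sub>1 j) x) (X\<^sub>2 i x) (Y\<^sub>2 j x) \<alpha> \<beta> \<gamma>
          - wedge3 (bracket A (X\<^sub>1 i) (Y\<^sub>2 j) x) (X\<^sub>2 i x) (Y\<^sub>1 j x) \<alpha> \<beta> \<gamma>
          - wedge3 (bracket A (X\<^sub>2 i) (Y\<^sub>1 j) x) (X\<^sub>1 i x) (Y\<^sub>2 j x) \<alpha> \<beta> \<gamma>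
          + wedge3 (bracket A (X\<^sub>2 i) (Y\<^sub>2 j) x) (X\<^sub>1 i x) (Y\<^sub>1 j x) \<alpha> \<beta> \<gamma>))"

section \<open>Poisson--Nijenhuis structures\<close>

definition deformed_bracket ::
  "('m, 'e, 'v::real_vector, 'f) algebroid \<Rightarrow> ('m \<Rightarrow> 'v \<Rightarrow> 'v)
     \<Rightarrow> ('m \<Rightarrow> 'v) \<Rightarrow> ('m \<Rightarrow> 'v) \<Rightarrow> 'm \<Rightarrow> 'v" where
  "deformed_bracket A N X Y x =
     bracket A (\<lambda>y. N y (X y)) Y x + bracket A X (\<lambda>y. N y (Y y)) x - N x (bracket A X Y x)"

definition deformed ::
  "('m, 'e, 'v::real_vector, 'f) algebroid \<Rightarrow> ('m \<Rightarrow> 'v \<Rightarrow> 'v) \<Rightarrow> ('m, 'e, 'v, 'f) algebroid" where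
  "deformed A N = A\<lparr>anchor := \<lambda>x v. anchor A x (N x v), bracket := deformed_bracket A N\<rparr>"

definition torsion ::
  "('m, 'e, 'v::real_vector, 'f) algebroid \<Rightarrow> ('m \<Rightarrow> 'v \<Rightarrow> 'v)
     \<Rightarrow> ('m \<Rightarrow> 'v) \<Rightarrow> ('m \<Rightarrow> 'v) \<Rightarrow> 'm \<Rightarrow> 'v" where
  "torsion A N X Y x =
     bracket A (\<lambda>y. N y (X y)) (\<lambda>y. N y (Y y)) x - N x (deformed_bracket A N X Y x)"

definition concomitant ::
  "('m, 'e::real_normed_vector, 'v::real_vector, 'f::real_normed_vector) algebroid
     \<Rightarrow> ('m \<Rightarrow> ('v \<Rightarrow> real) \<Rightarrow> ('v \<Rightarrow> real) \<Rightarrow> real) \<Rightarrow> ('m \<Rightarrow> 'v \<Rightarrow> 'v)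
     \<Rightarrow> ('m \<Rightarrow> 'v \<Rightarrow> real) \<Rightarrow> ('m \<Rightarrow> 'v \<Rightarrow> real) \<Rightarrow> 'm \<Rightarrow> 'v \<Rightarrow> real" where
  "concomitant A \<pi> N \<alpha> \<beta> x v =
     bivector_bracket (deformed A N) \<pi> \<alpha> \<beta> x v
     - (bivector_bracket A \<pi> (\<lambda>y. transpose_endo A N y (\<alpha> y)) \<beta> x v
        + bivector_bracket A \<pi> \<alpha> (\<lambda>y. transpose_endo A N y (\<beta> y)) x v
        - transpose_endo A N x (bivector_bracket A \<pi> \<alpha> \<beta> x) v)"

definition PN_structure ::
  "('m::topological_space, 'e::real_normed_vector, 'v::real_vector, 'f::real_normed_vector) algebroid
     \<Rightarrow> ('m \<Rightarrow> ('v \<Rightarrow> real) \<Rightarrow> ('v \<Rightarrow> real) \<Rightarrow> real) \<Rightarrow> ('m \<Rightarrow> 'v \<Rightarrow> 'v) \<Rightarrow> bool" where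
  "PN_structure A \<pi> N \<longleftrightarrow>
     bivector A \<pi> \<and> endomorphism A N \<and>
     (\<forall>x. \<forall>\<alpha>\<in>dual_fibre A x. \<forall>\<beta>\<in>dual_fibre A x. \<forall>\<gamma>\<in>dual_fibre A x.
        schouten A \<pi> \<pi> x \<alpha> \<beta> \<gamma> = 0) \<and>
     (\<forall>X\<in>sections A. \<forall>Y\<in>sections A. \<forall>x. torsion A N X Y x = 0) \<and>
     (\<forall>x. \<forall>\<alpha>\<in>dual_fibre A x. N x (sharp A \<pi> x \<alpha>) = sharp A \<pi> x (transpose_endo A N x \<alpha>)) \<and>
     (\<forall>\<alpha>\<in>cosections A. \<forall>\<beta>\<in>cosections A. \<forall>x. \<forall>v\<in>fibre A x. concomitant A \<pi> N \<alpha> \<beta> x v = 0)"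

section \<open>Hypersymplectic structures\<close>

definition symplectic ::
  "('m, 'e::real_normed_vector, 'v::real_vector, 'f::real_normed_vector) algebroid
     \<Rightarrow> ('m \<Rightarrow> 'v \<Rightarrow> 'v \<Rightarrow> real) \<Rightarrow> bool" where
  "symplectic A \<omega> \<longleftrightarrow>
     two_form A \<omega> \<and>
     (\<forall>X\<in>sections A. \<forall>Y\<in>sections A. \<forall>Z\<in>sections A. \<forall>x. d_two_form A \<omega> X Y Z x = 0) \<and>
     (\<forall>x. bij_betw (flat A \<omega> x) (fibre A x) (dual_fibre A x))"

definition inverse_bivector ::
  "('m, 'e::real_normed_vector, 'v::real_vector, 'f::real_normed_vector) algebroid
     \<Rightarrow> ('m \<Rightarrow> 'v \<Rightarrow> 'v \<Rightarrow> real) \<Rightarrow> ('m \<Rightarrow> ('v \<Rightarrow> real) \<Rightarrow> ('v \<Rightarrow> real) \<Rightarrow> real) \<Rightarrow> bool" where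
  "inverse_bivector A \<omega> \<pi> \<longleftrightarrow>
     bivector A \<pi> \<and>
     (\<forall>x. \<forall>\<alpha>\<in>dual_fibre A x. flat A \<omega> x (sharp A \<pi> x \<alpha>) = \<alpha>) \<and>
     (\<forall>x. \<forall>v\<in>fibre A x. sharp A \<pi> x (flat A \<omega> x v) = v)"

text \<open>
  The index type \<open>3\<close> is the ring of integers modulo 3, so \<open>i + 1\<close> and \<open>i - 1\<close> are cyclic and
  the index \<open>3\<close> is the element \<open>0\<close>.
\<close>

definition transition ::
  "('m, 'e, 'v::real_vector, 'f) algebroid \<Rightarrow> (3 \<Rightarrow> 'm \<Rightarrow> 'v \<Rightarrow> 'v \<Rightarrow> real)
     \<Rightarrow> (3 \<Rightarrow> 'm \<Rightarrow> ('v \<Rightarrow> real) \<Rightarrow> ('v \<Rightarrow> real) \<Rightarrow> real) \<Rightarrow> 3 \<Rightarrow> 'm \<Rightarrow> 'v \<Rightarrow> 'v" where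
  "transition A \<omega> \<pi> i x v = sharp A (\<pi> (i - 1)) x (flat A (\<omega> (i + 1)) x v)"

definition hypersymplectic ::
  "('m, 'e::real_normed_vector, 'v::real_vector, 'f::real_normed_vector) algebroid
     \<Rightarrow> (3 \<Rightarrow> real) \<Rightarrow> (3 \<Rightarrow> 'm \<Rightarrow> 'v \<Rightarrow> 'v \<Rightarrow> real)
     \<Rightarrow> (3 \<Rightarrow> 'm \<Rightarrow> ('v \<Rightarrow> real) \<Rightarrow> ('v \<Rightarrow> real) \<Rightarrow> real) \<Rightarrow> bool" where
  "hypersymplectic A \<epsilon> \<omega> \<pi> \<longleftrightarrow>
     (\<forall>i. \<epsilon> i = 1 \<or> \<epsilon> i = -1) \<and>
     (\<forall>i. symplectic A (\<omega> i) \<and> inverse_bivector A (\<omega> i) (\<pi> i)) \<and>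
     (\<forall>i x. \<forall>v\<in>fibre A x.
        transition A \<omega> \<pi> i x (transition A \<omega> \<pi> i x v) = \<epsilon> i *\<^sub>R v)"

text \<open>\<open>flat A (induced_tensor A \<epsilon> \<omega> \<pi>)\<close> is \<open>g\<^sup>\<flat> = \<epsilon>\<^sub>3 \<epsilon>\<^sub>2 \<omega>\<^sub>3\<^sup>\<flat> \<circ> \<pi>\<^sub>1\<^sup>\<sharp> \<circ> \<omega>\<^sub>2\<^sup>\<flat>\<close>.\<close>

definition induced_tensor ::
  "('m, 'e, 'v::real_vector, 'f) algebroid \<Rightarrow> (3 \<Rightarrow> real) \<Rightarrow> (3 \<Rightarrow> 'm \<Rightarrow> 'v \<Rightarrow> 'v \<Rightarrow> real)
     \<Rightarrow> (3 \<Rightarrow> 'm \<Rightarrow> ('v \<Rightarrow> real) \<Rightarrow> ('v \<Rightarrow> real) \<Rightarrow> real) \<Rightarrow> 'm \<Rightarrow> 'v \<Rightarrow> 'v \<Rightarrow> real" where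
  "induced_tensor A \<epsilon> \<omega> \<pi> x u v =
     \<epsilon> 3 * \<epsilon> 2 * flat A (\<omega> 3) x (sharp A (\<pi> 1) x (flat A (\<omega> 2) x u)) v"

definition inverse_tensor ::
  "('m, 'e, 'v, 'f) algebroid \<Rightarrow> ('m \<Rightarrow> 'v \<Rightarrow> 'v \<Rightarrow> real)
     \<Rightarrow> 'm \<Rightarrow> ('v \<Rightarrow> real) \<Rightarrow> ('v \<Rightarrow> real) \<Rightarrow> real" where
  "inverse_tensor A g x \<alpha> \<beta> = \<beta> (inv_into (fibre A x) (flat A g x) \<alpha>)"

end

theory Submission
  imports Defs "HOL-Computational_Algebra.Polynomial"
begin

text \<open>
  Bump functions turn local trivialisations into local frames by global sections, so every tensor
  can be tested on global sections, where all brackets and Lie derivatives have explicit formulas.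

  If \<open>\<omega>\<close> and \<open>\<omega>(N\<cdot>,\<cdot>)\<close> are closed and \<open>N\<^sup>2 = \<plusminus>Id\<close>, then \<open>N\<close> is torsion-free, because
  \<open>\<omega>(\<T>N(X,Y),Z)\<close> is a combination of values of the differentials of \<open>\<omega>\<close>, \<open>\<omega>(N\<cdot>,\<cdot>)\<close> and
  \<open>\<omega>(N\<^sup>2\<cdot>,\<cdot>)\<close>.  This applies to \<open>\<omega>\<^sub>i\<^sub>-\<^sub>1\<close> and \<open>N\<^sub>i\<close>.  When \<open>\<epsilon>\<^sub>1\<epsilon>\<^sub>2\<epsilon>\<^sub>3 = 1\<close> the \<open>N\<^sub>i\<close> commute and
  \<open>\<sigma>\<^sub>i = \<omega>\<^sub>i(N\<^sub>i\<cdot>,\<cdot>)\<close> is a \<open>2\<close>-form equal to \<open>g\<close> up to sign, with \<open>\<sigma>\<^sub>i(N\<^sub>j\<cdot>,\<cdot>)\<close> proportional to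
  some \<open>\<omega>\<^sub>k\<close> for every \<open>j\<close>.  The same combination then reads
  \<open>d\<sigma>\<^sub>i(N\<^sub>jX,N\<^sub>jY,Z) = -\<epsilon>\<^sub>j d\<sigma>\<^sub>i(X,Y,Z)\<close>, and since the product of the three \<open>N\<^sub>j\<close> is the identity,
  \<open>d\<sigma>\<^sub>i = 0\<close>.

  With covectors written as \<open>\<omega>\<^sub>i\<^sup>\<flat>a\<close>, the Schouten bracket \<open>[\<pi>\<^sub>i,\<pi>\<^sub>i]\<close> becomes \<open>2 d\<omega>\<^sub>i(a,b,c)\<close>, and the
  concomitant of \<open>(\<pi>\<^sub>i,N\<^sub>i)\<close> becomes the differential of \<open>\<omega>\<^sub>i\<close> for the structure deformed by \<open>N\<^sub>i\<close>,
  a combination of values of \<open>d\<omega>\<^sub>i\<close> and \<open>d\<sigma>\<^sub>i\<close>.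
\<close>

section \<open>Coordinates in finite-dimensional normed spaces\<close>

text \<open>The condition \<open>\<epsilon> 1 * \<epsilon> 2 * \<epsilon> 3 = 1\<close> decides that
  the transition tensors commute; with product -1 they would anticommute. Commuting is what makes
  \<open>sigma i\<close> skew. Nothing in the hypotheses speaks of its differential, since
  \<open>N i\<close> links \<open>\<omega> (i - 1)\<close> with \<open>\<omega> (i + 1)\<close> and
  not with \<open>\<omega> i\<close>. Parity supplies it: the identity is a product of an odd number
  of the \<open>N j\<close>, and each of them contributes a minus sign besides its \<epsilon>.

  Brackets accept global sections only, and \<open>sharp\<close>, \<open>lie_deriv\<close> and
  \<open>schouten\<close> are definite descriptions, so each requires existence and uniqueness. For
  \<open>schouten\<close>, uniqueness means that the sum must vanish for every pair of local
  decompositions of the bivector and not just for a convenient one. Its derivative terms depend on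
  the decompositions and become intrinsic only after alternation.

  The norm of a model space may fail to be smooth, so bump functions are built on a quadratic form
  in linear coordinates.\<close>

lemma independent_coord_bound:
  fixes B :: "'a::real_normed_vector set"
  assumes fin: "finite B" and ind: "independent B"
  obtains c where "c > 0" "\<And>t b. b \<in> B \<Longrightarrow> c * \<bar>t b\<bar> \<le> norm (\<Sum>b\<in>B. t b *\<^sub>R b)"
proof (cases "B = {}")
  case True
  then show ?thesis using that[of 1] by auto
next
  case False
  define T :: "('a \<Rightarrow> real) \<Rightarrow> 'a" where "T t = (\<Sum>b\<in>B. t b *\<^sub>R b)" for t
  \<comment> \<open>\<open>S\<close> is the unit sphere of the sup norm on the coordinates in
    \<open>B\<close>, realised inside functions on the whole type so that Tychonoff's theorem gives
    compactness. \<open>T\<close> ignores coordinates outside \<open>B\<close> and by independence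
    has no zero on \<open>S\<close>, so its norm has a positive minimum there.\<close>
  define S where "S = (PiE UNIV (\<lambda>_. {-1..1})) \<inter> (\<Union>b\<in>B. {t::'a \<Rightarrow> real. \<bar>t b\<bar> = 1})"
  have contT: "continuous_on UNIV T"
    unfolding T_def by (intro continuous_intros continuous_on_product_coordinates)
  have "compact (PiE UNIV (\<lambda>_::'a. {-1..1::real}))"
    using compactin_PiE[of "\<lambda>_::'a. euclideanreal" UNIV "\<lambda>_. {-1..1}"]
    by (simp add: euclidean_product_topology)
  moreover have "closed (\<Union>b\<in>B. {t::'a \<Rightarrow> real. \<bar>t b\<bar> = 1})"
    by (intro closed_UN fin ballI closed_Collect_eq continuous_intros
        continuous_on_product_coordinates)
  ultimately have "compact S" unfolding S_def by (rule compact_Int_closed)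
  moreover obtain b0 where "b0 \<in> B" using False by auto
  then have "(\<lambda>_. 1) \<in> S" unfolding S_def by auto
  then have "S \<noteq> {}" by auto
  ultimately obtain s where s: "s \<in> S" and smin: "\<And>t. t \<in> S \<Longrightarrow> norm (T s) \<le> norm (T t)"
    using continuous_attains_inf[of S "\<lambda>t. norm (T t)"]
      continuous_on_norm[OF continuous_on_subset[OF contT, of S]] by auto
  have "T s \<noteq> 0"
  proof
    assume "T s = 0"
    then have "\<forall>b\<in>B. s b = 0" 
      using independentD[OF ind fin order_refl] unfolding T_def by blast
    then show False using s unfolding S_def by force
  qed
  moreover have "norm (T s) * \<bar>t b\<bar> \<le> norm (T t)" if b: "b \<in> B" for t b
  proof -
    \<comment> \<open>\<open>m\<close> is the sup norm of \<open>t\<close> on \<open>B\<close>;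
      dividing by it moves \<open>t\<close> into \<open>S\<close>.\<close>
    define m where "m = Max ((\<lambda>b. \<bar>t b\<bar>) ` B)"
    have le: "\<bar>t b'\<bar> \<le> m" if "b' \<in> B" for b' unfolding m_def using fin that by simp
    show ?thesis
    proof (cases "m = 0")
      case True then show ?thesis using le[OF b] by simp
    next
      case False
      then have m: "m > 0" using le[OF b] by linarith
      define u where "u b' = (if b' \<in> B then t b' / m else 0)" for b'
      have "m \<in> (\<lambda>b. \<bar>t b\<bar>) ` B" unfolding m_def using fin b by (intro Max_in) auto
      then obtain b1 where "b1 \<in> B" "\<bar>t b1\<bar> = m" by auto
      then have "\<exists>b\<in>B. \<bar>u b\<bar> = 1" using m by (auto simp: u_def intro!: bexI[of _ b1])
      moreover have "\<bar>u b'\<bar> \<le> 1" for b' using le[of b'] m by (auto simp: u_def)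
      then have "-1 \<le> u b' \<and> u b' \<le> 1" for b' by (simp add: abs_le_iff minus_le_iff)
      ultimately have "u \<in> S" unfolding S_def by auto
      then have "norm (T s) \<le> norm (T u)" by (rule smin)
      also have "T t = m *\<^sub>R T u"
        unfolding T_def scaleR_sum_right using m by (auto simp: u_def intro!: sum.cong)
      then have "norm (T u) = norm (T t) / m" using m by simp
      finally have "norm (T s) * m \<le> norm (T t)" using m by (simp add: field_simps)
      then show ?thesis using le[OF b] by (meson mult_left_mono norm_ge_zero order_trans)
    qed
  qed
  ultimately show ?thesis using that[of "norm (T s)"] unfolding T_def by auto
qed

text \<open>These coordinates stand in for an orthonormal basis. The norm is arbitrary, so
  boundedness of the coordinate functionals has to come from \<open>independent_coord_bound\<close>;
  it is what makes them smooth.\<close>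

lemma finite_dim_coordinates:
  assumes "finite_dim TYPE('a::real_normed_vector)"
  obtains n and e :: "nat \<Rightarrow> 'a::real_normed_vector" and \<xi> :: "nat \<Rightarrow> 'a \<Rightarrow> real"
  where "\<And>j. bounded_linear (\<xi> j)" "\<And>v. v = (\<Sum>j<n. \<xi> j v *\<^sub>R e j)"
proof -
  obtain B0 :: "'a set" where "finite B0" "span B0 = UNIV" using assms unfolding finite_dim_def by auto
  then obtain B :: "'a set" where B: "finite B" "independent B" "span B = UNIV"
    by (metis maximal_independent_subset finite_subset span_mono span_span top.extremum_uniqueI)
  obtain c where c: "c > 0" "\<And>t b. b \<in> B \<Longrightarrow> c * \<bar>t b\<bar> \<le> norm (\<Sum>b\<in>B. t b *\<^sub>R b)"
    using independent_coord_bound[OF B(1,2)] by blast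
  have rep: "(\<Sum>b\<in>B. representation B v b *\<^sub>R b) = v" for v
    using real_vector.sum_representation_eq[OF B(2) _ B(1) order_refl, of v] B(3) by auto
  have bl: "bounded_linear (\<lambda>v. representation B v b)" for b
  proof (cases "b \<in> B")
    case True
    show ?thesis
    proof (rule bounded_linear_intro[where K = "1 / c"])
      show "norm (representation B v b) \<le> norm v * (1 / c)" for v
        using c(2)[OF True, of "representation B v"] c(1) by (simp add: rep field_simps)
    qed (use B in \<open>simp_all add: real_vector.representation_add real_vector.representation_scale\<close>)
  next
    \<comment> \<open>Not vacuous: from \<open>card B\<close> on, the enumeration \<open>e\<close>
      may leave \<open>B\<close>, while boundedness is claimed for every index.\<close>
    case False
    then have "(\<lambda>v. representation B v b) = (\<lambda>v. 0)"
      using real_vector.representation_ne_zero by blast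
    then show ?thesis by simp
  qed
  obtain e where e: "bij_betw e {0..<card B} B" using ex_bij_betw_nat_finite[OF B(1)] by auto
  have "v = (\<Sum>j<card B. representation B v (e j) *\<^sub>R e j)" for v
    using sum.reindex_bij_betw[OF e, of "\<lambda>b. representation B v b *\<^sub>R b"] rep[of v]
    by (simp add: lessThan_atLeast0)
  then show ?thesis using bl by (intro that[where e = e])
qed

section \<open>Calculus of smooth functions\<close>

lemma Ck_on_cong:
  "open S \<Longrightarrow> (\<And>x. x \<in> S \<Longrightarrow> f x = g x) \<Longrightarrow> Ck_on k f S \<longleftrightarrow> Ck_on k g S"
proof (induction k arbitrary: f g)
  case 0
  then show ?case by (simp cong: continuous_on_cong)
next
  case (Suc k)
  have tr: "(f has_derivative D) (at x) \<longleftrightarrow> (g has_derivative D) (at x)" if "x \<in> S" for x D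
    using Suc.prems that has_derivative_transform_within_open[of f D x UNIV S g]
      has_derivative_transform_within_open[of g D x UNIV S f] by auto
  then have "f differentiable at x \<longleftrightarrow> g differentiable at x"
    "frechet_derivative f (at x) = frechet_derivative g (at x)" if "x \<in> S" for x
    using that by (simp_all add: differentiable_def frechet_derivative_def)
  then show ?case
    using Suc.IH[OF \<open>open S\<close>, of "\<lambda>x. frechet_derivative f (at x) _"
        "\<lambda>x. frechet_derivative g (at x) _"] by simp
qed

text \<open>The recursion in \<open>Ck_on\<close> runs through \<open>frechet_derivative\<close>;
  uniqueness of derivatives lets an explicit formula \<open>f'\<close> take its place.\<close>

lemma Ck_on_Suc_derivI:
  assumes "open S" "\<And>x. x \<in> S \<Longrightarrow> (f has_derivative f' x) (at x)" "\<And>v. Ck_on k (\<lambda>x. f' x v) S"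
  shows "Ck_on (Suc k) f S"
proof -
  have "frechet_derivative f (at x) = f' x" if "x \<in> S" for x
    using frechet_derivative_at[OF assms(2)[OF that]] by simp
  then have "Ck_on k (\<lambda>x. frechet_derivative f (at x) v) S" for v
    using Ck_on_cong[OF assms(1), of "\<lambda>x. frechet_derivative f (at x) v" "\<lambda>x. f' x v"] assms(3) by simp
  then show ?thesis using assms(2) by (auto simp: differentiable_def)
qed

lemma Ck_on_has_derivative:
  "Ck_on (Suc k) f S \<Longrightarrow> x \<in> S \<Longrightarrow> (f has_derivative frechet_derivative f (at x)) (at x)"
  by (simp add: frechet_derivative_works)

lemma Ck_on_SucD: "Ck_on (Suc k) f S \<Longrightarrow> Ck_on k f S"
proof (induction k arbitrary: f)
  case 0
  then show ?case
    by (simp add: continuous_at_imp_continuous_on differentiable_imp_continuous_within)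
next
  case (Suc k)
  then have "\<forall>x\<in>S. f differentiable at x"
    and "Ck_on (Suc k) (\<lambda>x. frechet_derivative f (at x) v) S" for v
    unfolding Ck_on.simps(2)[of "Suc k"] by blast+
  then show ?case using Suc.IH unfolding Ck_on.simps(2)[of k] by blast
qed

lemma Ck_on_const: "Ck_on k (\<lambda>x. c) S"
  by (induction k arbitrary: c) (auto simp: frechet_derivative_const)

lemma Ck_on_bounded_linear:
  assumes "bounded_linear L" "open S"
  shows "Ck_on k f S \<Longrightarrow> Ck_on k (\<lambda>x. L (f x)) S"
proof (induction k arbitrary: f)
  case 0
  then show ?case using assms by (simp add: bounded_linear.continuous_on)
next
  case (Suc k)
  show ?case
  proof (rule Ck_on_Suc_derivI[OF assms(2)])
    show "((\<lambda>x. L (f x)) has_derivative (\<lambda>v. L (frechet_derivative f (at x) v))) (at x)"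
      if "x \<in> S" for x
      using bounded_linear.has_derivative[OF assms(1)] Ck_on_has_derivative[OF Suc.prems that] .
    show "Ck_on k (\<lambda>x. L (frechet_derivative f (at x) v)) S" for v
      using Suc by simp
  qed
qed

lemma Ck_on_add:
  assumes "open S"
  shows "Ck_on k f S \<Longrightarrow> Ck_on k g S \<Longrightarrow> Ck_on k (\<lambda>x. f x + g x) S"
proof (induction k arbitrary: f g)
  case 0
  then show ?case by (simp add: continuous_on_add)
next
  case (Suc k)
  show ?case
  proof (rule Ck_on_Suc_derivI[OF assms])
    show "((\<lambda>x. f x + g x) has_derivative
        (\<lambda>v. frechet_derivative f (at x) v + frechet_derivative g (at x) v)) (at x)"
      if "x \<in> S" for x
      using Suc.prems that by (intro has_derivative_add Ck_on_has_derivative)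
    show "Ck_on k (\<lambda>x. frechet_derivative f (at x) v + frechet_derivative g (at x) v) S" for v
      using Suc by simp
  qed
qed

lemma Ck_on_scaleR:
  fixes f :: "_ \<Rightarrow> real"
  assumes "open S"
  shows "Ck_on k f S \<Longrightarrow> Ck_on k g S \<Longrightarrow> Ck_on k (\<lambda>x. f x *\<^sub>R g x) S"
proof (induction k arbitrary: f g)
  case 0
  then show ?case by (simp add: continuous_on_scaleR)
next
  case (Suc k)
  show ?case
  proof (rule Ck_on_Suc_derivI[OF assms])
    show "((\<lambda>x. f x *\<^sub>R g x) has_derivative
        (\<lambda>v. f x *\<^sub>R frechet_derivative g (at x) v + frechet_derivative f (at x) v *\<^sub>R g x)) (at x)"
      if "x \<in> S" for x
      using Suc.prems that by (intro has_derivative_scaleR Ck_on_has_derivative)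
    show "Ck_on k (\<lambda>x. f x *\<^sub>R frechet_derivative g (at x) v
        + frechet_derivative f (at x) v *\<^sub>R g x) S" for v
      using Suc.prems Ck_on_SucD[OF Suc.prems(1)] Ck_on_SucD[OF Suc.prems(2)]
      by (intro Ck_on_add[OF assms] Suc.IH) auto
  qed
qed

text \<open>The induction on \<open>k\<close> passes from \<open>b i\<close> to its derivative
  \<open>b (Suc i)\<close>, so the statement carries the whole sequence of iterated derivatives at
  once.\<close>

lemma Ck_on_compose_real:
  fixes f :: "_ \<Rightarrow> real" and b :: "nat \<Rightarrow> real \<Rightarrow> real"
  assumes S: "open S" and b: "\<And>i t. (b i has_real_derivative b (Suc i) t) (at t)"
  shows "Ck_on k f S \<Longrightarrow> Ck_on k (\<lambda>x. b i (f x)) S"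
proof (induction k arbitrary: i)
  case 0
  have "continuous_on UNIV (b i)"
    using DERIV_isCont[OF b] by (simp add: continuous_at_imp_continuous_on)
  then show ?case using 0 by (auto intro: continuous_on_compose2)
next
  case (Suc k)
  show ?case
  proof (rule Ck_on_Suc_derivI[OF S])
    show "((\<lambda>x. b i (f x)) has_derivative
        (\<lambda>v. frechet_derivative f (at x) v *\<^sub>R b (Suc i) (f x))) (at x)" if "x \<in> S" for x
      using has_derivative_compose[OF Ck_on_has_derivative[OF Suc.prems that]
          b[unfolded has_field_derivative_def]] by (simp add: mult.commute)
    show "Ck_on k (\<lambda>x. frechet_derivative f (at x) v *\<^sub>R b (Suc i) (f x)) S" for v
      using Suc.prems Suc.IH[OF Ck_on_SucD[OF Suc.prems]] by (intro Ck_on_scaleR[OF S]) auto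
  qed
qed

lemma Ck_on_subset: "Ck_on k f S \<Longrightarrow> T \<subseteq> S \<Longrightarrow> Ck_on k f T"
  by (induction k arbitrary: f) (auto intro: continuous_on_subset)

lemma Ck_on_local:
  assumes "\<And>x. x \<in> S \<Longrightarrow> \<exists>T. open T \<and> x \<in> T \<and> Ck_on k f (S \<inter> T)"
  shows "Ck_on k f S"
  using assms
proof (induction k arbitrary: f)
  case 0
  have "continuous (at x within S) f" if x: "x \<in> S" for x
  proof -
    obtain T where T: "open T" "x \<in> T" "continuous_on (S \<inter> T) f" using 0 x by auto
    then have "continuous (at x within S \<inter> T) f"
      using x by (simp add: continuous_on_eq_continuous_within)
    then show ?thesis
      using T at_within_nhd[of x T "S \<inter> T" S] by (simp add: continuous_within)
  qed
  then show ?case by (simp add: continuous_on_eq_continuous_within)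
next
  case (Suc k)
  have 1: "f differentiable at x" if "x \<in> S" for x using Suc.prems[OF that] that by auto
  have "Ck_on k (\<lambda>x. frechet_derivative f (at x) v) S" for v
  proof (rule Suc.IH)
    fix x assume "x \<in> S"
    then show "\<exists>T. open T \<and> x \<in> T \<and> Ck_on k (\<lambda>x. frechet_derivative f (at x) v) (S \<inter> T)"
      using Suc.prems[of x] unfolding Ck_on.simps(2) by blast
  qed
  then show ?case using 1 by simp
qed

section \<open>A smooth function vanishing on a half-line\<close>

text \<open>\<open>p = 1\<close> gives the classical function exp(-1/t) extended by 0. Carrying a
  polynomial in 1/t makes the family closed under differentiation.\<close>

definition flat_exp :: "real poly \<Rightarrow> real \<Rightarrow> real" where
  "flat_exp p t = (if t > 0 then poly p (1 / t) * exp (- (1 / t)) else 0)"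

lemma poly_times_exp_minus_tendsto_0: "((\<lambda>s. poly p s * exp (- s)) \<longlongrightarrow> (0::real)) at_top"
proof -
  have "((\<lambda>s. \<Sum>i\<le>degree p. coeff p i * (s ^ i / exp s)) \<longlongrightarrow> (\<Sum>i\<le>degree p. coeff p i * 0)) at_top"
    by (intro tendsto_intros tendsto_power_div_exp_0)
  then show ?thesis
    by (simp add: poly_altdef sum_distrib_right exp_minus divide_inverse mult.assoc)
qed

lemma flat_exp_tendsto_0: "(flat_exp p \<longlongrightarrow> 0) (at 0)"
proof (rule filterlim_split_at)
  have "\<forall>\<^sub>F t in at_left 0. 0 = flat_exp p t"
    by (auto simp: flat_exp_def eventually_at_filter)
  then show "(flat_exp p \<longlongrightarrow> 0) (at_left 0)"
    by (rule Lim_transform_eventually[OF tendsto_const])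
  have "((\<lambda>t. poly p (inverse t) * exp (- inverse t)) \<longlongrightarrow> 0) (at_right 0)"
    by (rule filterlim_compose[OF poly_times_exp_minus_tendsto_0 filterlim_inverse_at_top_right])
  moreover have "\<forall>\<^sub>F t in at_right 0. poly p (inverse t) * exp (- inverse t) = flat_exp p t"
    by (auto simp: flat_exp_def eventually_at_filter inverse_eq_divide)
  ultimately show "(flat_exp p \<longlongrightarrow> 0) (at_right 0)"
    by (rule Lim_transform_eventually)
qed

text \<open>With s = 1/t, the derivative in t of p(s) exp(-s) is s^2 (p(s) - p'(s)) exp(-s); the
  polynomial \<open>[:0, 0, 1:]\<close> is the factor s^2 from the chain rule.\<close>

definition flat_exp_deriv :: "real poly \<Rightarrow> real poly" where
  "flat_exp_deriv p = [:0, 0, 1:] * (p - pderiv p)"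

lemma DERIV_flat_exp: "(flat_exp p has_real_derivative flat_exp (flat_exp_deriv p) t) (at t)"
proof -
  consider "t > 0" | "t < 0" | "t = 0" by linarith
  then show ?thesis
  proof cases
    case 1
    have "((\<lambda>t. poly p (1 / t) * exp (- (1 / t))) has_real_derivative
        poly (flat_exp_deriv p) (1 / t) * exp (- (1 / t))) (at t)"
      using 1 by (auto intro!: derivative_eq_intros DERIV_chain2[OF poly_DERIV]
          simp: flat_exp_deriv_def field_simps power2_eq_square)
    then show ?thesis
      by (rule has_field_derivative_transform_within_open[where S = "{0<..}", THEN DERIV_cong])
        (use 1 in \<open>auto simp: flat_exp_def\<close>)
  next
    case 2
    have "((\<lambda>t. 0) has_real_derivative 0) (at t)" by simp
    then show ?thesis
      by (rule has_field_derivative_transform_within_open[where S = "{..<0}", THEN DERIV_cong])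
        (use 2 in \<open>auto simp: flat_exp_def\<close>)
  next
    case 3
    \<comment> \<open>At 0 the difference quotient stays in the family: dividing by h multiplies the
      polynomial by 1/h, and every member tends to 0.\<close>
    have "(\<lambda>h. (flat_exp p (0 + h) - flat_exp p 0) / h) = flat_exp ([:0, 1:] * p)"
      by (auto simp: flat_exp_def fun_eq_iff)
    then show ?thesis
      using 3 flat_exp_tendsto_0[of "[:0, 1:] * p"] by (simp add: DERIV_def flat_exp_def)
  qed
qed

lemma flat_exp_1_mono: "s \<le> t \<Longrightarrow> flat_exp 1 s \<le> flat_exp 1 t"
  by (auto simp: flat_exp_def frac_le)

section \<open>Smooth maps on a manifold\<close>

locale smooth_manifold =
  fixes \<A> :: "('m::{t2_space, second_countable_topology} set \<times> ('m \<Rightarrow> 'e::real_normed_vector)) set"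
  assumes smooth_atlas: "smooth_atlas \<A>"
begin

lemma chart_homeomorphism:
  "(U, \<kappa>) \<in> \<A> \<Longrightarrow> homeomorphism U (\<kappa> ` U) \<kappa> (inv_into U \<kappa>)"
  and chart_domain_open: "(U, \<kappa>) \<in> \<A> \<Longrightarrow> open U"
  and chart_image_open: "(U, \<kappa>) \<in> \<A> \<Longrightarrow> open (\<kappa> ` U)"
  and smooth_map_on_chart: "(U, \<kappa>) \<in> \<A> \<Longrightarrow> smooth_map_on \<A> U \<kappa>"
  and ex_chart: "\<exists>(U, \<kappa>)\<in>\<A>. x \<in> U"
  and finite_dim_model: "finite_dim TYPE('e)"
  using smooth_atlas unfolding smooth_atlas_def by fast+

lemma inv_into_chart: "(U, \<kappa>) \<in> \<A> \<Longrightarrow> z \<in> U \<Longrightarrow> inv_into U \<kappa> (\<kappa> z) = z"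
  using chart_homeomorphism homeomorphism_apply1 by metis

lemma open_chart_image:
  assumes "(U, \<kappa>) \<in> \<A>" "open W"
  shows "open (\<kappa> ` (U \<inter> W))"
proof -
  have "openin (top_of_set (\<kappa> ` U)) (\<kappa> ` (U \<inter> W))"
    using homeomorphism_imp_open_map[OF chart_homeomorphism[OF assms(1)], of "U \<inter> W"] assms(2)
    by (auto simp: openin_open)
  then show ?thesis using chart_image_open[OF assms(1)] openin_open_trans by blast
qed

lemma smooth_map_on_iff_Ck_on:
  "smooth_map_on \<A> W f \<longleftrightarrow>
     (\<forall>U \<kappa> k. (U, \<kappa>) \<in> \<A> \<longrightarrow> Ck_on k (\<lambda>y. f (inv_into U \<kappa> y)) (\<kappa> ` (U \<inter> W)))"
  by (auto simp: smooth_map_on_def smooth_on_def o_def)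

lemma smooth_map_on_cong:
  assumes "open W" "\<And>x. x \<in> W \<Longrightarrow> f x = g x"
  shows "smooth_map_on \<A> W f \<longleftrightarrow> smooth_map_on \<A> W g"
proof -
  have "Ck_on k (\<lambda>y. f (inv_into U \<kappa> y)) (\<kappa> ` (U \<inter> W))
      \<longleftrightarrow> Ck_on k (\<lambda>y. g (inv_into U \<kappa> y)) (\<kappa> ` (U \<inter> W))" if "(U, \<kappa>) \<in> \<A>" for U \<kappa> k
    using assms that by (intro Ck_on_cong open_chart_image) (auto simp: inv_into_chart)
  then show ?thesis by (auto simp: smooth_map_on_iff_Ck_on)
qed

lemma smooth_map_on_subset: "smooth_map_on \<A> W f \<Longrightarrow> W' \<subseteq> W \<Longrightarrow> smooth_map_on \<A> W' f"
  unfolding smooth_map_on_iff_Ck_on by (meson Ck_on_subset Int_mono image_mono order_refl)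

text \<open>The representative \<open>g\<close> may change with the point; this is what gluing a
  cut-off function to zero requires.\<close>

lemma smooth_map_onI_local:
  assumes W: "open W"
    and loc: "\<And>x. x \<in> W \<Longrightarrow>
      \<exists>V g. open V \<and> x \<in> V \<and> (\<forall>y\<in>W \<inter> V. f y = g y) \<and> smooth_map_on \<A> (W \<inter> V) g"
  shows "smooth_map_on \<A> W f"
  unfolding smooth_map_on_iff_Ck_on
proof (intro allI impI Ck_on_local)
  fix U \<kappa> k y
  assume U: "(U, \<kappa>) \<in> \<A>" and "y \<in> \<kappa> ` (U \<inter> W)"
  then obtain z where z: "z \<in> U" "z \<in> W" "y = \<kappa> z" by auto
  obtain V g where V: "open V" "z \<in> V" "\<And>y. y \<in> W \<inter> V \<Longrightarrow> f y = g y" "smooth_map_on \<A> (W \<inter> V) g"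
    using loc[OF z(2)] by auto
  then have "smooth_map_on \<A> (W \<inter> V) f"
    using smooth_map_on_cong[of "W \<inter> V" f g] W by auto
  then have "Ck_on k (\<lambda>y. f (inv_into U \<kappa> y)) (\<kappa> ` (U \<inter> (W \<inter> V)))"
    using U by (auto simp: smooth_map_on_iff_Ck_on)
  \<comment> \<open>Injectivity of the chart turns an intersection of images into the image of the
    intersection.\<close>
  moreover have "\<kappa> ` (U \<inter> W) \<inter> \<kappa> ` (U \<inter> V) \<subseteq> \<kappa> ` (U \<inter> (W \<inter> V))"
  proof
    fix y assume "y \<in> \<kappa> ` (U \<inter> W) \<inter> \<kappa> ` (U \<inter> V)"
    then obtain a b where "a \<in> U \<inter> W" "b \<in> U \<inter> V" "y = \<kappa> a" "y = \<kappa> b" by auto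
    moreover from this have "a = b" using inv_into_chart[OF U, of a] inv_into_chart[OF U, of b] by simp
    ultimately show "y \<in> \<kappa> ` (U \<inter> (W \<inter> V))" by auto
  qed
  ultimately have "Ck_on k (\<lambda>y. f (inv_into U \<kappa> y)) (\<kappa> ` (U \<inter> W) \<inter> \<kappa> ` (U \<inter> V))"
    using Ck_on_subset by blast
  then show "\<exists>T. open T \<and> y \<in> T \<and> Ck_on k (\<lambda>y. f (inv_into U \<kappa> y)) (\<kappa> ` (U \<inter> W) \<inter> T)"
    using open_chart_image[OF U V(1)] z V(2) by blast
qed

lemma smooth_map_on_const: "smooth_map_on \<A> W (\<lambda>x. c)"
  by (simp add: smooth_map_on_iff_Ck_on Ck_on_const)

lemma smooth_map_on_bounded_linear:
  "bounded_linear L \<Longrightarrow> open W \<Longrightarrow> smooth_map_on \<A> W f \<Longrightarrow> smooth_map_on \<A> W (\<lambda>x. L (f x))"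
  unfolding smooth_map_on_iff_Ck_on
  by (intro allI impI, rule Ck_on_bounded_linear) (auto intro: open_chart_image)

lemma smooth_map_on_add:
  "open W \<Longrightarrow> smooth_map_on \<A> W f \<Longrightarrow> smooth_map_on \<A> W g
    \<Longrightarrow> smooth_map_on \<A> W (\<lambda>x. f x + g x)"
  unfolding smooth_map_on_iff_Ck_on by (auto intro!: Ck_on_add open_chart_image)

lemma smooth_map_on_scaleR:
  fixes f :: "'m \<Rightarrow> real"
  shows "open W \<Longrightarrow> smooth_map_on \<A> W f \<Longrightarrow> smooth_map_on \<A> W g
    \<Longrightarrow> smooth_map_on \<A> W (\<lambda>x. f x *\<^sub>R g x)"
  unfolding smooth_map_on_iff_Ck_on by (auto intro!: Ck_on_scaleR open_chart_image)

lemma smooth_map_on_mult: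
  fixes f g :: "'m \<Rightarrow> real"
  shows "open W \<Longrightarrow> smooth_map_on \<A> W f \<Longrightarrow> smooth_map_on \<A> W g
    \<Longrightarrow> smooth_map_on \<A> W (\<lambda>x. f x * g x)"
  using smooth_map_on_scaleR[of W f g] by simp

lemma smooth_map_on_diff:
  assumes "open W" "smooth_map_on \<A> W f" "smooth_map_on \<A> W g"
  shows "smooth_map_on \<A> W (\<lambda>x. f x - g x)"
  using smooth_map_on_add[OF assms(1,2)
      smooth_map_on_bounded_linear[OF bounded_linear_minus[OF bounded_linear_ident] assms(1,3)]]
  by simp

lemma smooth_map_on_sum:
  "open W \<Longrightarrow> (\<And>i. i \<in> I \<Longrightarrow> smooth_map_on \<A> W (f i))
    \<Longrightarrow> smooth_map_on \<A> W (\<lambda>x. \<Sum>i\<in>I. f i x)"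
  by (induction I rule: infinite_finite_induct) (auto intro: smooth_map_on_const smooth_map_on_add)

lemma smooth_map_on_flat_exp:
  assumes "open W" "smooth_map_on \<A> W f"
  shows "smooth_map_on \<A> W (\<lambda>x. flat_exp p (f x))"
proof -
  have "Ck_on k (\<lambda>x. flat_exp ((flat_exp_deriv ^^ 0) p) (f (inv_into U \<kappa> x))) (\<kappa> ` (U \<inter> W))"
    if "(U, \<kappa>) \<in> \<A>" for U \<kappa> k
    using assms(2) that
    by (intro Ck_on_compose_real[where b = "\<lambda>i. flat_exp ((flat_exp_deriv ^^ i) p)"]
        open_chart_image[OF that assms(1)])
      (auto simp: smooth_map_on_iff_Ck_on DERIV_flat_exp)
  then show ?thesis by (auto simp: smooth_map_on_iff_Ck_on)
qed

lemmas smooth_map_on_intros = smooth_map_on_const smooth_map_on_add smooth_map_on_diff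
  smooth_map_on_scaleR smooth_map_on_mult smooth_map_on_sum

section \<open>Bump functions and extension by zero\<close>

lemma compact_sublevel_in_model:
  fixes p :: 'e
  assumes "open O'" "p \<in> O'"
  obtains Q :: "'e \<Rightarrow> real" and r where "r > 0" "continuous_on UNIV Q" "Q p = 0"
    "compact {y. Q y \<le> r}" "{y. Q y \<le> r} \<subseteq> O'"
    "\<forall>W f. open W \<longrightarrow> smooth_map_on \<A> W f \<longrightarrow> smooth_map_on \<A> W (\<lambda>z. Q (f z))"
proof -
  obtain n e \<xi> where \<xi>: "\<And>j. bounded_linear (\<xi> j)"
    and e: "\<And>v::'e. v = (\<Sum>j<n::nat. \<xi> j v *\<^sub>R e j)"
    by (rule finite_dim_coordinates[OF finite_dim_model]) (rule that)
  \<comment> \<open>A sum of squares of linear coordinates is smooth, which the norm need not be;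
    its small sublevel sets replace closed balls.\<close>
  define Q where "Q y = (\<Sum>j<n. \<xi> j (y - p) * \<xi> j (y - p))" for y
  obtain \<delta> where \<delta>: "\<delta> > 0" "ball p \<delta> \<subseteq> O'" using assms openE by blast
  \<comment> \<open>The summand 1 keeps \<open>C\<close> positive even for \<open>n = 0\<close>.
    With \<open>R = \<delta> / (2 * C)\<close> the triangle inequality bounds the norm by
    \<open>R * C = \<delta> / 2\<close>.\<close>
  define C where "C = (\<Sum>j<n. norm (e j)) + 1"
  have C: "C > 0" unfolding C_def by (simp add: add_nonneg_pos sum_nonneg)
  define R where "R = \<delta> / (2 * C)"
  have R: "R > 0" using C \<delta> by (simp add: R_def)
  have coord: "\<bar>\<xi> j (y - p)\<bar> \<le> R" if "Q y \<le> R\<^sup>2" "j < n" for y j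
  proof -
    have "\<xi> j (y - p) * \<xi> j (y - p) \<le> Q y"
      unfolding Q_def using that by (intro member_le_sum) auto
    then show ?thesis using that R abs_le_square_iff[of "\<xi> j (y - p)" R]
      by (simp add: power2_eq_square)
  qed
  have "y \<in> ball p \<delta>" if "Q y \<le> R\<^sup>2" for y
  proof -
    have "norm (y - p) = norm (\<Sum>j<n. \<xi> j (y - p) *\<^sub>R e j)" using e by metis
    also have "\<dots> \<le> (\<Sum>j<n. norm (\<xi> j (y - p) *\<^sub>R e j))" by (rule norm_sum)
    also have "\<dots> \<le> (\<Sum>j<n. R * norm (e j))"
      using coord[OF that] by (intro sum_mono) (auto simp: mult_right_mono)
    also have "\<dots> \<le> R * C" unfolding C_def using R by (simp add: sum_distrib_left distrib_left)
    also have "\<dots> < \<delta>" using C \<delta> by (simp add: R_def)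
    finally show ?thesis by (simp add: dist_norm norm_minus_commute)
  qed
  then have sub: "{y. Q y \<le> R\<^sup>2} \<subseteq> O'" using \<delta> by auto
  have contQ: "continuous_on UNIV Q"
    unfolding Q_def
    by (intro continuous_intros bounded_linear.continuous_on[OF \<xi>])
  \<comment> \<open>Compactness comes from a cube of coefficients: the sublevel set is closed and
    lies in the continuous image \<open>Box\<close> of that cube.\<close>
  define T where "T t = p + (\<Sum>j<n. t j *\<^sub>R e j)" for t :: "nat \<Rightarrow> real"
  define Box where "Box = T ` (PiE UNIV (\<lambda>_. {-R..R}))"
  have "compact (PiE UNIV (\<lambda>_::nat. {-R..R}))"
    using compactin_PiE[of "\<lambda>_::nat. euclideanreal" UNIV "\<lambda>_. {-R..R}"]
    by (simp add: euclidean_product_topology)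
  moreover have "continuous_on UNIV T"
    unfolding T_def by (intro continuous_intros continuous_on_product_coordinates)
  ultimately have "compact Box"
    unfolding Box_def by (meson compact_continuous_image continuous_on_subset subset_UNIV)
  moreover have "{y. Q y \<le> R\<^sup>2} \<subseteq> Box"
  proof
    fix y assume y: "y \<in> {y. Q y \<le> R\<^sup>2}"
    have "y = T (\<lambda>j. if j < n then \<xi> j (y - p) else 0)"
      using arg_cong[OF e[of "y - p"], of "(+) p"] by (simp add: T_def)
    moreover have "(\<lambda>j. if j < n then \<xi> j (y - p) else 0) \<in> PiE UNIV (\<lambda>_. {-R..R})"
      using coord y R by (auto simp: abs_le_iff) (metis abs_le_iff minus_le_iff mem_Collect_eq)
    ultimately show "y \<in> Box" unfolding Box_def by blast
  qed
  moreover have "closed {y. Q y \<le> R\<^sup>2}"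
    using contQ by (intro closed_Collect_le continuous_on_const)
  ultimately have "compact {y. Q y \<le> R\<^sup>2}"
    by (metis compact_Int_closed inf.absorb2)
  moreover have "smooth_map_on \<A> W (\<lambda>z. Q (f z))" if "open W" "smooth_map_on \<A> W f" for W f
    unfolding Q_def using that
    by (intro smooth_map_on_intros smooth_map_on_bounded_linear[OF \<xi>])
  moreover have "Q p = 0" using linear_0[OF bounded_linear.linear[OF \<xi>]] by (simp add: Q_def)
  ultimately show ?thesis using that[of "R\<^sup>2" Q] R sub contQ by auto
qed

text \<open>\<open>K\<close> is built inside one chart, yet it is closed in the whole manifold
  because compact sets in a Hausdorff space are closed. Hence zero on the open complement of
  \<open>K\<close> glues smoothly to the function given in the chart.\<close>

lemma ex_bump:
  assumes "open W" "x \<in> W"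
  obtains h V K where "smooth_fun \<A> h" "open V" "closed K" "x \<in> V" "V \<subseteq> K" "K \<subseteq> W"
    "\<And>z. z \<in> V \<Longrightarrow> h z = 1" "\<And>z. z \<notin> K \<Longrightarrow> h z = 0"
proof -
  obtain U \<kappa> where U: "(U, \<kappa>) \<in> \<A>" "x \<in> U" using ex_chart[of x] by auto
  have oUW: "open (U \<inter> W)" using chart_domain_open U assms by blast
  have \<kappa>x: "\<kappa> x \<in> \<kappa> ` (U \<inter> W)" using U(2) assms(2) by blast
  obtain r :: real and Q where r: "r > 0" and contQ: "continuous_on UNIV Q" and Qx: "Q (\<kappa> x) = 0"
    and cpt: "compact {y. Q y \<le> r}" and sub: "{y. Q y \<le> r} \<subseteq> \<kappa> ` (U \<inter> W)"
    and smQ: "\<forall>W f. open W \<longrightarrow> smooth_map_on \<A> W f \<longrightarrow> smooth_map_on \<A> W (\<lambda>z. Q (f z))"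
    by (rule compact_sublevel_in_model[OF open_chart_image[OF U(1) assms(1)] \<kappa>x]) (rule that)
  define K where "K = inv_into U \<kappa> ` {y. Q y \<le> r}"
  have "continuous_on {y. Q y \<le> r} (inv_into U \<kappa>)"
    using chart_homeomorphism[OF U(1)] sub
    by (meson continuous_on_subset homeomorphism_cont2 image_mono inf_le1 order_trans)
  then have "closed K" unfolding K_def using cpt compact_continuous_image compact_imp_closed by blast
  have K_iff: "z \<in> K \<longleftrightarrow> z \<in> U \<inter> W \<and> Q (\<kappa> z) \<le> r" for z
    using sub inv_into_chart[OF U(1)] unfolding K_def by (force simp: image_iff)
  define V where "V = {z \<in> U \<inter> W. Q (\<kappa> z) < r / 2}"
  have contQ\<kappa>: "continuous_on (U \<inter> W) (\<lambda>z. Q (\<kappa> z))"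
    using homeomorphism_cont1[OF chart_homeomorphism[OF U(1)]]
    by (intro continuous_on_compose2[OF contQ]) (auto intro: continuous_on_subset)
  have "open ((\<lambda>z. Q (\<kappa> z)) -` {..<r / 2} \<inter> (U \<inter> W))"
    using continuous_on_open_vimage[OF oUW] contQ\<kappa> open_lessThan by blast
  moreover have "V = (\<lambda>z. Q (\<kappa> z)) -` {..<r / 2} \<inter> (U \<inter> W)" unfolding V_def by auto
  ultimately have "open V" by simp
  define b where "b = flat_exp 1 (r / 2)"
  have b: "b > 0" using r by (simp add: b_def flat_exp_def)
  \<comment> \<open>Two nested flat functions. For s below r/2 the inner one is 0 and the outer
    argument is 1, where the factor \<open>exp 1\<close> normalises the value to 1. For s above r
    the inner one is at least \<open>b\<close>, so the outer argument is at most 0 and the value is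
    0.\<close>
  define \<theta> where "\<theta> s = exp 1 * flat_exp 1 (1 - inverse b * flat_exp 1 (s - r / 2))" for s
  have \<theta>1: "\<theta> s = 1" if "s < r / 2" for s
    using that by (simp add: \<theta>_def flat_exp_def flip: exp_add)
  have \<theta>0: "\<theta> s = 0" if "s > r" for s
  proof -
    have "b \<le> flat_exp 1 (s - r / 2)" unfolding b_def using that by (intro flat_exp_1_mono) auto
    then have "1 \<le> inverse b * flat_exp 1 (s - r / 2)" using b by (simp add: field_simps)
    then show ?thesis by (simp add: \<theta>_def flat_exp_def)
  qed
  define h where "h z = (if z \<in> U \<inter> W then \<theta> (Q (\<kappa> z)) else 0)" for z
  have h0: "h z = 0" if "z \<notin> K" for z using that \<theta>0 by (auto simp: h_def K_iff)
  have "smooth_map_on \<A> (U \<inter> W) \<kappa>"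
    using smooth_map_on_chart[OF U(1)] smooth_map_on_subset by blast
  then have sm: "smooth_map_on \<A> (U \<inter> W) (\<lambda>z. \<theta> (Q (\<kappa> z)))"
    unfolding \<theta>_def by (intro smooth_map_on_intros smooth_map_on_flat_exp smQ[rule_format] oUW)
  have "smooth_fun \<A> h"
  proof (rule smooth_map_onI_local)
    fix z
    show "\<exists>V g. open V \<and> z \<in> V \<and> (\<forall>y\<in>UNIV \<inter> V. h y = g y) \<and> smooth_map_on \<A> (UNIV \<inter> V) g"
    proof (cases "z \<in> U \<inter> W")
      case True
      then show ?thesis using oUW sm by (intro exI[of _ "U \<inter> W"] exI[of _ "\<lambda>z. \<theta> (Q (\<kappa> z))"]) (auto simp: h_def)
    next
      case False
      then show ?thesis using \<open>closed K\<close> h0 K_iff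
        by (intro exI[of _ "- K"] exI[of _ "\<lambda>z. 0"]) (auto simp: open_Compl smooth_map_on_const)
    qed
  qed simp
  moreover have "h z = 1" if "z \<in> V" for z using that \<theta>1 by (auto simp: h_def V_def)
  moreover have "x \<in> V" using U(2) assms(2) Qx r by (simp add: V_def)
  moreover have "V \<subseteq> K" using r by (auto simp: V_def K_iff)
  moreover have "K \<subseteq> W" by (auto simp: K_iff)
  ultimately show ?thesis using that[of h V K] \<open>open V\<close> \<open>closed K\<close> h0 by blast
qed

text \<open>\<open>W\<close> and the complement of \<open>K\<close> cover \<open>S\<close>, and
  where they overlap both formulas give 0.\<close>

lemma smooth_map_on_extend_by_zero:
  fixes h :: "'m \<Rightarrow> real"
  assumes "open W" "closed K" "K \<subseteq> W" "\<And>z. z \<notin> K \<Longrightarrow> h z = 0" "smooth_fun \<A> h"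
    and "open S" "smooth_map_on \<A> (W \<inter> S) f"
  shows "smooth_map_on \<A> S (\<lambda>z. if z \<in> W then h z *\<^sub>R f z else 0)"
proof (rule smooth_map_onI_local[OF assms(6)])
  fix z assume "z \<in> S"
  show "\<exists>V g. open V \<and> z \<in> V \<and> (\<forall>y\<in>S \<inter> V. (if y \<in> W then h y *\<^sub>R f y else 0) = g y)
      \<and> smooth_map_on \<A> (S \<inter> V) g"
  proof (cases "z \<in> W")
    case True
    have "smooth_map_on \<A> (S \<inter> W) (\<lambda>z. h z *\<^sub>R f z)"
      using assms smooth_map_on_subset[OF assms(5)]
      by (intro smooth_map_on_scaleR) (auto simp: Int_commute)
    then show ?thesis using True assms(1) by (intro exI[of _ W] exI[of _ "\<lambda>z. h z *\<^sub>R f z"]) auto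
  next
    case False
    then show ?thesis using assms(2,3,4)
      by (intro exI[of _ "- K"] exI[of _ "\<lambda>z. 0"]) (auto simp: open_Compl smooth_map_on_const)
  qed
qed

end

section \<open>Frames and sections\<close>

lemma linear_onD:
  "linear_on S f \<Longrightarrow> u \<in> S \<Longrightarrow> v \<in> S \<Longrightarrow> f (a *\<^sub>R u + b *\<^sub>R v) = a *\<^sub>R f u + b *\<^sub>R f v"
  by (auto simp: linear_on_def)

lemma linear_on_add: "linear_on S f \<Longrightarrow> u \<in> S \<Longrightarrow> v \<in> S \<Longrightarrow> f (u + v) = f u + f v"
  using linear_onD[of S f u v 1 1] by simp

lemma linear_on_diff: "linear_on S f \<Longrightarrow> u \<in> S \<Longrightarrow> v \<in> S \<Longrightarrow> f (u - v) = f u - f v"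
  using linear_onD[of S f u v 1 "-1"] by simp

lemma linear_on_scaleR: "linear_on S f \<Longrightarrow> u \<in> S \<Longrightarrow> f (a *\<^sub>R u) = a *\<^sub>R f u"
  using linear_onD[of S f u u a 0] by simp

lemma linear_on_minus: "linear_on S f \<Longrightarrow> u \<in> S \<Longrightarrow> f (- u) = - f u"
  using linear_on_scaleR[of S f u "-1"] by simp

lemma linear_on_sum:
  assumes "subspace S" "linear_on S f" "\<And>i. i \<in> I \<Longrightarrow> u i \<in> S"
  shows "f (\<Sum>i\<in>I. a i *\<^sub>R u i) = (\<Sum>i\<in>I. a i *\<^sub>R f (u i))"
proof -
  have "f 0 = 0" using linear_on_scaleR[OF assms(2) subspace_0[OF assms(1)], of 0] by simp
  then show ?thesis using assms(3)
  proof (induction I rule: infinite_finite_induct)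
    case (insert i I)
    have "f (a i *\<^sub>R u i + (\<Sum>i\<in>I. a i *\<^sub>R u i)) = f (a i *\<^sub>R u i) + f (\<Sum>i\<in>I. a i *\<^sub>R u i)"
      using insert.prems by (intro linear_on_add[OF assms(2)] subspace_scale subspace_sum assms(1)) auto
    then show ?case
      using insert linear_on_scaleR[OF assms(2)] by simp
  qed auto
qed

lemma linear_on_sum_vectors:
  "subspace S \<Longrightarrow> linear_on S f \<Longrightarrow> (\<And>i. i \<in> I \<Longrightarrow> u i \<in> S) \<Longrightarrow> f (\<Sum>i\<in>I. u i) = (\<Sum>i\<in>I. f (u i))"
  using linear_on_sum[of S f I u "\<lambda>_. 1"] by simp

locale Lie_algebroid =
  fixes A :: "('m::{t2_space, second_countable_topology}, 'e::real_normed_vector,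
                'v::real_vector, 'f::real_normed_vector) algebroid"
  assumes lie_algebroid: "lie_algebroid A"
begin

lemma vector_bundle: "vector_bundle A"
  using lie_algebroid by (simp add: lie_algebroid_def)

sublocale smooth_manifold "atlas A"
  by unfold_locales (use vector_bundle in \<open>simp add: vector_bundle_def\<close>)

abbreviation smooth :: "('m \<Rightarrow> real) \<Rightarrow> bool" where
  "smooth f \<equiv> smooth_fun (atlas A) f"

lemma finite_dim_typical_fibre: "finite_dim TYPE('f)"
  and fibre_subspace: "subspace (fibre A x)"
  and ex_triv: "\<exists>(U, \<phi>)\<in>trivs A. x \<in> U"
  and triv_open: "(U, \<phi>) \<in> trivs A \<Longrightarrow> open U"
  and triv_linear: "(U, \<phi>) \<in> trivs A \<Longrightarrow> x \<in> U \<Longrightarrow> linear_on (fibre A x) (\<phi> x)"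
  and triv_bij: "(U, \<phi>) \<in> trivs A \<Longrightarrow> x \<in> U \<Longrightarrow> bij_betw (\<phi> x) (fibre A x) UNIV"
  and triv_transition: "(U, \<phi>) \<in> trivs A \<Longrightarrow> (V, \<psi>) \<in> trivs A \<Longrightarrow>
    smooth_map_on (atlas A) (U \<inter> V) (\<lambda>x. \<psi> x (local_vec A \<phi> w x))"
  using vector_bundle unfolding vector_bundle_def by fast+

lemma fibre_zero: "0 \<in> fibre A x"
  and fibre_add: "u \<in> fibre A x \<Longrightarrow> v \<in> fibre A x \<Longrightarrow> u + v \<in> fibre A x"
  and fibre_diff: "u \<in> fibre A x \<Longrightarrow> v \<in> fibre A x \<Longrightarrow> u - v \<in> fibre A x"
  and fibre_scaleR: "u \<in> fibre A x \<Longrightarrow> a *\<^sub>R u \<in> fibre A x"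
  and fibre_minus: "u \<in> fibre A x \<Longrightarrow> - u \<in> fibre A x"
  and fibre_sum: "(\<And>i. i \<in> I \<Longrightarrow> w i \<in> fibre A x) \<Longrightarrow> (\<Sum>i\<in>I. w i) \<in> fibre A x"
  using fibre_subspace[of x]
  by (auto intro: subspace_0 subspace_add subspace_diff subspace_scale subspace_neg subspace_sum)

lemmas fibre_intros = fibre_zero fibre_add fibre_diff fibre_scaleR fibre_minus fibre_sum

lemma local_vec_fibre: "(U, \<phi>) \<in> trivs A \<Longrightarrow> x \<in> U \<Longrightarrow> local_vec A \<phi> w x \<in> fibre A x"
  and triv_local_vec: "(U, \<phi>) \<in> trivs A \<Longrightarrow> x \<in> U \<Longrightarrow> \<phi> x (local_vec A \<phi> w x) = w"
  using triv_bij[of U \<phi> x] by (simp_all add: bij_betw_def inv_into_into f_inv_into_f)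

lemma local_expansion:
  assumes U: "(U, \<phi>) \<in> trivs A" "x \<in> U" and v: "v \<in> fibre A x"
    and e: "\<And>w. w = (\<Sum>j<n::nat. \<xi> j w *\<^sub>R e j)"
  shows "v = (\<Sum>j<n. \<xi> j (\<phi> x v) *\<^sub>R local_vec A \<phi> (e j) x)"
proof (rule inj_onD[OF bij_betw_imp_inj_on[OF triv_bij[OF U]]])
  show "\<phi> x v = \<phi> x (\<Sum>j<n. \<xi> j (\<phi> x v) *\<^sub>R local_vec A \<phi> (e j) x)"
    unfolding linear_on_sum[OF fibre_subspace triv_linear[OF U] local_vec_fibre[OF U]]
      triv_local_vec[OF U] by (rule e)
qed (use v in \<open>auto intro!: fibre_sum fibre_scaleR local_vec_fibre[OF U]\<close>)

lemma sectionD: "X \<in> sections A \<Longrightarrow> X x \<in> fibre A x"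
  and section_smooth: "X \<in> sections A \<Longrightarrow> (U, \<phi>) \<in> trivs A
    \<Longrightarrow> smooth_map_on (atlas A) U (\<lambda>x. \<phi> x (X x))"
  by (auto simp: sections_def)

lemma cosectionD: "\<alpha> \<in> cosections A \<Longrightarrow> \<alpha> x \<in> dual_fibre A x"
  and cosection_smooth: "\<alpha> \<in> cosections A \<Longrightarrow> (U, \<phi>) \<in> trivs A
    \<Longrightarrow> smooth_map_on (atlas A) U (\<lambda>x. \<alpha> x (local_vec A \<phi> w x))"
  by (auto simp: cosections_def)

lemma dual_fibre_linear: "\<alpha> \<in> dual_fibre A x \<Longrightarrow> linear_on (fibre A x) \<alpha>"
  and dual_fibre_outside: "\<alpha> \<in> dual_fibre A x \<Longrightarrow> v \<notin> fibre A x \<Longrightarrow> \<alpha> v = 0"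
  by (auto simp: dual_fibre_def)

lemma dual_fibre_eqI:
  "\<alpha> \<in> dual_fibre A x \<Longrightarrow> \<beta> \<in> dual_fibre A x \<Longrightarrow> (\<And>v. v \<in> fibre A x \<Longrightarrow> \<alpha> v = \<beta> v) \<Longrightarrow> \<alpha> = \<beta>"
  by (rule ext) (metis dual_fibre_outside)

lemma dual_fibre_lincomb:
  "\<alpha> \<in> dual_fibre A x \<Longrightarrow> \<beta> \<in> dual_fibre A x \<Longrightarrow> (\<lambda>v. a * \<alpha> v + b * \<beta> v) \<in> dual_fibre A x"
  by (auto simp: dual_fibre_def linear_on_def algebra_simps)

lemma dual_fibre_zero: "(\<lambda>v. 0) \<in> dual_fibre A x"
  by (auto simp: dual_fibre_def linear_on_def)

lemma dual_fibre_sum: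
  "(\<And>i. i \<in> I \<Longrightarrow> \<alpha> i \<in> dual_fibre A x) \<Longrightarrow> (\<lambda>v. \<Sum>i\<in>I. a i * \<alpha> i v) \<in> dual_fibre A x"
proof (induction I rule: infinite_finite_induct)
  case (insert i I)
  then show ?case
    using dual_fibre_lincomb[of "\<alpha> i" x "\<lambda>v. \<Sum>i\<in>I. a i * \<alpha> i v" "a i" 1] by simp
qed (auto simp: dual_fibre_zero)

lemma restr_dual_fibre: "linear_on (fibre A x) \<xi> \<Longrightarrow> restr A x \<xi> \<in> dual_fibre A x"
  by (auto simp: dual_fibre_def restr_def linear_on_def fibre_add fibre_scaleR)

lemma restr_coordinate_dual_fibre:
  assumes "(U, \<phi>) \<in> trivs A" "x \<in> U" "linear \<xi>"
  shows "restr A x (\<lambda>v. \<xi> (\<phi> x v)) \<in> dual_fibre A x"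
  using triv_linear[OF assms(1,2)] assms(3)
  by (intro restr_dual_fibre) (auto simp: linear_on_def linear_add linear_scale)

lemma smooth_pairing:
  assumes "\<alpha> \<in> cosections A" "X \<in> sections A"
  shows "smooth (\<lambda>x. \<alpha> x (X x))"
proof (rule smooth_map_onI_local)
  fix x
  obtain U \<phi> where U: "(U, \<phi>) \<in> trivs A" "x \<in> U" using ex_triv[of x] by auto
  obtain n and e :: "nat \<Rightarrow> 'f" and \<xi> where \<xi>: "\<And>j. bounded_linear (\<xi> j)"
    and e: "\<And>w. w = (\<Sum>j<n. \<xi> j w *\<^sub>R e j)"
    by (rule finite_dim_coordinates[OF finite_dim_typical_fibre]) (rule that)
  let ?g = "\<lambda>y. \<Sum>j<n. \<xi> j (\<phi> y (X y)) * \<alpha> y (local_vec A \<phi> (e j) y)"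
  have "\<alpha> y (X y) = ?g y" if "y \<in> U" for y
    using arg_cong[OF local_expansion[OF U(1) that sectionD[OF assms(2)] e], of "\<alpha> y"]
      linear_on_sum[OF fibre_subspace dual_fibre_linear[OF cosectionD[OF assms(1)]]
        local_vec_fibre[OF U(1) that]]
    by simp
  moreover have "smooth_map_on (atlas A) U ?g"
    using triv_open[OF U(1)] U(1) assms
    by (intro smooth_map_on_intros smooth_map_on_bounded_linear[OF \<xi>] section_smooth
        cosection_smooth) auto
  ultimately show "\<exists>V g. open V \<and> x \<in> V \<and> (\<forall>y\<in>UNIV \<inter> V. \<alpha> y (X y) = g y)
      \<and> smooth_map_on (atlas A) (UNIV \<inter> V) g"
    using U triv_open by (intro exI[of _ U] exI[of _ ?g]) auto
qed simp

text \<open>Frame and coframe are cut off by the same bump function, which makes them global; on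
  \<open>V\<close> the expansion acquires the factor h^2 = 1. Only this reproducing property is
  recorded, not duality of the two families.\<close>

lemma local_frame:
  obtains V n and E :: "nat \<Rightarrow> 'm \<Rightarrow> 'v" and \<Xi> :: "nat \<Rightarrow> 'm \<Rightarrow> 'v \<Rightarrow> real"
  where "open V" "x \<in> V" "\<And>j. E j \<in> sections A" "\<And>j. \<Xi> j \<in> cosections A"
    "\<And>y v. y \<in> V \<Longrightarrow> v \<in> fibre A y \<Longrightarrow> v = (\<Sum>j<n. \<Xi> j y v *\<^sub>R E j y)"
proof -
  obtain U \<phi> where U: "(U, \<phi>) \<in> trivs A" "x \<in> U" using ex_triv[of x] by auto
  obtain n and e :: "nat \<Rightarrow> 'f" and \<xi> where \<xi>: "\<And>j. bounded_linear (\<xi> j)"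
    and e: "\<And>w. w = (\<Sum>j<n. \<xi> j w *\<^sub>R e j)"
    by (rule finite_dim_coordinates[OF finite_dim_typical_fibre]) (rule that)
  obtain h V K where h: "smooth h" and V: "open V" "x \<in> V" "V \<subseteq> K"
    and K: "closed K" "K \<subseteq> U" and h1: "\<And>z. z \<in> V \<Longrightarrow> h z = 1" and h0: "\<And>z. z \<notin> K \<Longrightarrow> h z = 0"
    using ex_bump[OF triv_open[OF U(1)] U(2)] by metis
  define E where "E j y = (if y \<in> U then h y *\<^sub>R local_vec A \<phi> (e j) y else 0)" for j y
  define \<Xi> where "\<Xi> j y v = (if y \<in> U then h y *\<^sub>R restr A y (\<lambda>v. \<xi> j (\<phi> y v)) v else 0)" for j y v
  have lin\<xi>: "linear (\<xi> j)" for j using \<xi> by (rule bounded_linear.linear)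
  have "E j \<in> sections A" for j
    unfolding sections_def
  proof (clarsimp, intro conjI allI ballI, goal_cases)
    case (1 y)
    then show ?case using local_vec_fibre[OF U(1)] by (auto simp: E_def intro: fibre_intros)
  next
    case (2 p)
    obtain V' \<psi> where p: "p = (V', \<psi>)" by force
    then have V': "(V', \<psi>) \<in> trivs A" using 2 by auto
    have "smooth_map_on (atlas A) V' (\<lambda>y. if y \<in> U then h y *\<^sub>R \<psi> y (local_vec A \<phi> (e j) y) else 0)"
      using triv_transition[OF U(1) V'] triv_open[OF U(1)] triv_open[OF V'] K h0 h
      by (intro smooth_map_on_extend_by_zero[of U K]) auto
    moreover have "\<psi> y (E j y) = (if y \<in> U then h y *\<^sub>R \<psi> y (local_vec A \<phi> (e j) y) else 0)"
      if "y \<in> V'" for y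
      using linear_on_scaleR[OF triv_linear[OF V' that] local_vec_fibre[OF U(1), of y "e j"]]
        linear_on_scaleR[OF triv_linear[OF V' that] fibre_zero, of 0]
      by (auto simp: E_def)
    ultimately have "smooth_map_on (atlas A) V' (\<lambda>y. \<psi> y (E j y))"
      using smooth_map_on_cong[OF triv_open[OF V'], of "\<lambda>y. \<psi> y (E j y)"] by simp
    then show ?case by (simp add: p)
  qed
  moreover have "\<Xi> j \<in> cosections A" for j
    unfolding cosections_def
  proof (clarsimp, intro conjI allI ballI, goal_cases)
    case (1 y)
    show ?case
    proof (cases "y \<in> U")
      case True
      have "\<Xi> j y = (\<lambda>v. h y * restr A y (\<lambda>v. \<xi> j (\<phi> y v)) v + 0 * 0)"
        using True by (simp add: \<Xi>_def fun_eq_iff)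
      then show ?thesis
        using dual_fibre_lincomb[OF restr_coordinate_dual_fibre[OF U(1) True lin\<xi>[of j]] dual_fibre_zero,
            of "h y" 0] by simp
    next
      case False
      then have "\<Xi> j y = (\<lambda>v. 0)" by (simp add: \<Xi>_def fun_eq_iff)
      then show ?thesis by (simp add: dual_fibre_zero)
    qed
  next
    case (2 p)
    obtain V' \<psi> where p: "p = (V', \<psi>)" by force
    then have V': "(V', \<psi>) \<in> trivs A" using 2 by auto
    have "smooth_map_on (atlas A) V' (\<lambda>y. if y \<in> U then h y *\<^sub>R \<xi> j (\<phi> y (local_vec A \<psi> w y)) else 0)"
      for w
      using triv_transition[OF V' U(1)] triv_open[OF U(1)] triv_open[OF V'] K h0 h
      by (intro smooth_map_on_extend_by_zero[of U K] smooth_map_on_bounded_linear[OF \<xi>])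
        (auto simp: Int_commute)
    moreover have "\<Xi> j y (local_vec A \<psi> w y)
        = (if y \<in> U then h y *\<^sub>R \<xi> j (\<phi> y (local_vec A \<psi> w y)) else 0)"
      if "y \<in> V'" for y w
      using local_vec_fibre[OF V' that] by (auto simp: \<Xi>_def restr_def)
    ultimately have "smooth_map_on (atlas A) V' (\<lambda>y. \<Xi> j y (local_vec A \<psi> w y))" for w
      using smooth_map_on_cong[OF triv_open[OF V'], of "\<lambda>y. \<Xi> j y (local_vec A \<psi> w y)"] by simp
    then show ?case by (simp add: p)
  qed
  moreover have "v = (\<Sum>j<n. \<Xi> j y v *\<^sub>R E j y)" if "y \<in> V" "v \<in> fibre A y" for y v
  proof -
    have "y \<in> U" using that V K by auto
    then show ?thesis
      using local_expansion[OF U(1) _ that(2) e] that h1 by (simp add: E_def \<Xi>_def restr_def)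
  qed
  ultimately show ?thesis using that V by blast
qed

section \<open>Testing smoothness and equality on global sections\<close>

lemma dual_frame_expansion:
  assumes "\<And>j. E j \<in> sections A" "\<And>v. v \<in> fibre A y \<Longrightarrow> v = (\<Sum>j<n::nat. \<Xi> j y v *\<^sub>R E j y)"
    and "\<alpha> \<in> dual_fibre A y" "v \<in> fibre A y"
  shows "\<alpha> v = (\<Sum>j<n. \<Xi> j y v * \<alpha> (E j y))"
  using arg_cong[OF assms(2)[OF assms(4)], of \<alpha>]
    linear_on_sum[OF fibre_subspace dual_fibre_linear[OF assms(3)], where I = "{..<n}" and u = "\<lambda>j. E j y"]
    sectionD[OF assms(1)] by simp

text \<open>Near each point the coframe supplies smooth coefficients of \<open>X\<close>, and the
  frame is smooth in every trivialisation. With this criterion and its dual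
  \<open>cosectionsI\<close>, most later constructions avoid trivialisations.\<close>

lemma sectionsI:
  assumes "\<And>x. X x \<in> fibre A x" "\<And>\<alpha>. \<alpha> \<in> cosections A \<Longrightarrow> smooth (\<lambda>x. \<alpha> x (X x))"
  shows "X \<in> sections A"
proof -
  have "smooth_map_on (atlas A) U (\<lambda>x. \<phi> x (X x))" if U: "(U, \<phi>) \<in> trivs A" for U \<phi>
  proof (rule smooth_map_onI_local[OF triv_open[OF U]])
    fix x assume "x \<in> U"
    obtain V n E \<Xi> where V: "open V" "x \<in> V" and E: "\<And>j. E j \<in> sections A"
      and \<Xi>: "\<And>j. \<Xi> j \<in> cosections A"
      and fr: "\<And>y v. y \<in> V \<Longrightarrow> v \<in> fibre A y \<Longrightarrow> v = (\<Sum>j<n::nat. \<Xi> j y v *\<^sub>R E j y)"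
      by (rule local_frame[of x]) (rule that)
    let ?g = "\<lambda>y. \<Sum>j<n. \<Xi> j y (X y) *\<^sub>R \<phi> y (E j y)"
    have "\<phi> y (X y) = ?g y" if "y \<in> U \<inter> V" for y
      using arg_cong[OF fr[OF _ assms(1)], of y "\<phi> y"] that
        linear_on_sum[OF fibre_subspace triv_linear[OF U, of y] sectionD[OF E], where I = "{..<n}"]
      by simp
    moreover have "smooth_map_on (atlas A) (U \<inter> V) ?g"
      using triv_open[OF U] V smooth_map_on_subset[OF assms(2)[OF \<Xi>]]
        smooth_map_on_subset[OF section_smooth[OF E U]]
      by (intro smooth_map_on_intros) auto
    ultimately show "\<exists>V g. open V \<and> x \<in> V \<and> (\<forall>y\<in>U \<inter> V. \<phi> y (X y) = g y)
        \<and> smooth_map_on (atlas A) (U \<inter> V) g"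
      using V by (intro exI[of _ V] exI[of _ ?g]) auto
  qed
  then show ?thesis using assms(1) by (auto simp: sections_def)
qed

lemma cosectionsI:
  assumes "\<And>x. \<alpha> x \<in> dual_fibre A x" "\<And>X. X \<in> sections A \<Longrightarrow> smooth (\<lambda>x. \<alpha> x (X x))"
  shows "\<alpha> \<in> cosections A"
proof -
  have "smooth_map_on (atlas A) U (\<lambda>x. \<alpha> x (local_vec A \<phi> w x))" if U: "(U, \<phi>) \<in> trivs A" for U \<phi> w
  proof (rule smooth_map_onI_local[OF triv_open[OF U]])
    fix x assume "x \<in> U"
    obtain V n E \<Xi> where V: "open V" "x \<in> V" and E: "\<And>j. E j \<in> sections A"
      and \<Xi>: "\<And>j. \<Xi> j \<in> cosections A"
      and fr: "\<And>y v. y \<in> V \<Longrightarrow> v \<in> fibre A y \<Longrightarrow> v = (\<Sum>j<n::nat. \<Xi> j y v *\<^sub>R E j y)"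
      by (rule local_frame[of x]) (rule that)
    let ?g = "\<lambda>y. \<Sum>j<n. \<Xi> j y (local_vec A \<phi> w y) * \<alpha> y (E j y)"
    have "\<alpha> y (local_vec A \<phi> w y) = ?g y" if "y \<in> U \<inter> V" for y
      using that by (intro dual_frame_expansion E fr assms(1) local_vec_fibre[OF U]) auto
    moreover have "smooth_map_on (atlas A) (U \<inter> V) ?g"
      using triv_open[OF U] V smooth_map_on_subset[OF assms(2)[OF E]]
        smooth_map_on_subset[OF cosection_smooth[OF \<Xi> U]]
      by (intro smooth_map_on_intros) auto
    ultimately show "\<exists>V g. open V \<and> x \<in> V \<and> (\<forall>y\<in>U \<inter> V. \<alpha> y (local_vec A \<phi> w y) = g y)
        \<and> smooth_map_on (atlas A) (U \<inter> V) g"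
      using V by (intro exI[of _ V] exI[of _ ?g]) auto
  qed
  then show ?thesis using assms(1) by (auto simp: cosections_def)
qed

lemma sections_scaleR:
  assumes "smooth f" "X \<in> sections A"
  shows "(\<lambda>y. f y *\<^sub>R X y) \<in> sections A"
proof (rule sectionsI)
  show "smooth (\<lambda>x. \<alpha> x (f x *\<^sub>R X x))" if "\<alpha> \<in> cosections A" for \<alpha>
    using smooth_map_on_mult[OF open_UNIV assms(1) smooth_pairing[OF that assms(2)]]
      linear_on_scaleR[OF dual_fibre_linear[OF cosectionD[OF that]] sectionD[OF assms(2)]] by simp
qed (use assms in \<open>auto intro: fibre_intros sectionD\<close>)

lemma sections_add:
  assumes "X \<in> sections A" "Y \<in> sections A"
  shows "(\<lambda>y. X y + Y y) \<in> sections A"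
proof (rule sectionsI)
  show "smooth (\<lambda>x. \<alpha> x (X x + Y x))" if "\<alpha> \<in> cosections A" for \<alpha>
    using smooth_map_on_add[OF open_UNIV smooth_pairing[OF that assms(1)] smooth_pairing[OF that assms(2)]]
      linear_on_add[OF dual_fibre_linear[OF cosectionD[OF that]] sectionD[OF assms(1)] sectionD[OF assms(2)]]
    by simp
qed (use assms in \<open>auto intro: fibre_intros sectionD\<close>)

lemma sections_zero: "(\<lambda>y. 0) \<in> sections A"
proof (rule sectionsI)
  show "smooth (\<lambda>x. \<alpha> x 0)" if "\<alpha> \<in> cosections A" for \<alpha>
    using linear_on_scaleR[OF dual_fibre_linear[OF cosectionD[OF that]] fibre_zero, of _ 0]
    by (simp add: smooth_map_on_const)
qed (rule fibre_zero)

lemma sections_const_scaleR: "X \<in> sections A \<Longrightarrow> (\<lambda>y. a *\<^sub>R X y) \<in> sections A"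
  by (intro sections_scaleR smooth_map_on_const)

lemma sections_minus: "X \<in> sections A \<Longrightarrow> (\<lambda>y. - X y) \<in> sections A"
  using sections_const_scaleR[of X "-1"] by simp

lemma sections_diff: "X \<in> sections A \<Longrightarrow> Y \<in> sections A \<Longrightarrow> (\<lambda>y. X y - Y y) \<in> sections A"
  using sections_add[OF _ sections_minus, of X Y] by simp

lemma sections_sum: "(\<And>i. i \<in> I \<Longrightarrow> X i \<in> sections A) \<Longrightarrow> (\<lambda>y. \<Sum>i\<in>I. X i y) \<in> sections A"
  by (induction I rule: infinite_finite_induct) (auto intro: sections_zero sections_add)

lemma cosections_lincomb:
  assumes "\<alpha> \<in> cosections A" "\<beta> \<in> cosections A" "smooth f" "smooth g"
  shows "(\<lambda>y v. f y * \<alpha> y v + g y * \<beta> y v) \<in> cosections A"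
proof (rule cosectionsI)
  show "(\<lambda>v. f x * \<alpha> x v + g x * \<beta> x v) \<in> dual_fibre A x" for x
    using assms by (intro dual_fibre_lincomb cosectionD)
  show "smooth (\<lambda>x. f x * \<alpha> x (X x) + g x * \<beta> x (X x))" if "X \<in> sections A" for X
    by (intro smooth_map_on_intros open_UNIV assms smooth_pairing[OF assms(1) that]
        smooth_pairing[OF assms(2) that])
qed

lemma cosections_add:
  "\<alpha> \<in> cosections A \<Longrightarrow> \<beta> \<in> cosections A \<Longrightarrow> (\<lambda>y v. \<alpha> y v + \<beta> y v) \<in> cosections A"
  using cosections_lincomb[OF _ _ smooth_map_on_const[of _ 1] smooth_map_on_const[of _ 1]] by simp

lemma cosections_diff:
  "\<alpha> \<in> cosections A \<Longrightarrow> \<beta> \<in> cosections A \<Longrightarrow> (\<lambda>y v. \<alpha> y v - \<beta> y v) \<in> cosections A"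
  using cosections_lincomb[OF _ _ smooth_map_on_const[of _ 1] smooth_map_on_const[of _ "-1"]] by simp

text \<open>Bracket identities make sense only for sections; extending a fibre vector is the device
  that draws pointwise conclusions from them.\<close>

lemma ex_section_through:
  assumes "v \<in> fibre A x"
  obtains X where "X \<in> sections A" "X x = v"
proof -
  obtain V n E \<Xi> where V: "open V" "x \<in> V" and E: "\<And>j. E j \<in> sections A"
    and \<Xi>: "\<And>j. \<Xi> j \<in> cosections A"
    and fr: "\<And>y v. y \<in> V \<Longrightarrow> v \<in> fibre A y \<Longrightarrow> v = (\<Sum>j<n::nat. \<Xi> j y v *\<^sub>R E j y)"
    by (rule local_frame[of x]) (rule that)
  have "(\<lambda>y. \<Sum>j<n. \<Xi> j x v *\<^sub>R E j y) \<in> sections A"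
    by (intro sections_sum sections_const_scaleR E)
  then show ?thesis using that fr[OF V(2) assms] by auto
qed

lemma ex_cosection_through:
  assumes "\<alpha> \<in> dual_fibre A x"
  obtains \<beta> where "\<beta> \<in> cosections A" "\<beta> x = \<alpha>"
proof -
  obtain V n E \<Xi> where V: "open V" "x \<in> V" and E: "\<And>j. E j \<in> sections A"
    and \<Xi>: "\<And>j. \<Xi> j \<in> cosections A"
    and fr: "\<And>y v. y \<in> V \<Longrightarrow> v \<in> fibre A y \<Longrightarrow> v = (\<Sum>j<n::nat. \<Xi> j y v *\<^sub>R E j y)"
    by (rule local_frame[of x]) (rule that)
  let ?\<beta> = "\<lambda>y v. \<Sum>j<n. \<alpha> (E j x) * \<Xi> j y v"
  have "?\<beta> \<in> cosections A"
    by (intro cosectionsI dual_fibre_sum cosectionD[OF \<Xi>] smooth_map_on_intros smooth_pairing[OF \<Xi>]) auto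
  moreover have "?\<beta> x = \<alpha>"
  proof (rule dual_fibre_eqI[OF dual_fibre_sum[OF cosectionD[OF \<Xi>]] assms])
    show "?\<beta> x v = \<alpha> v" if "v \<in> fibre A x" for v
      using dual_frame_expansion[of E x \<Xi> n \<alpha> v, OF E fr[OF V(2)] assms that] by (simp add: mult.commute)
  qed
  ultimately show ?thesis using that by blast
qed

section \<open>Anchor, bracket and Lie derivative\<close>

lemma anchor_derivation: "v \<in> fibre A x \<Longrightarrow> derivation_at (atlas A) x (anchor A x v)"
  and anchor_linear_on: "smooth f \<Longrightarrow> linear_on (fibre A x) (\<lambda>v. anchor A x v f)"
  and smooth_anchor: "X \<in> sections A \<Longrightarrow> smooth f \<Longrightarrow> smooth (\<lambda>x. anchor A x (X x) f)"
  and bracket_section: "X \<in> sections A \<Longrightarrow> Y \<in> sections A \<Longrightarrow> bracket A X Y \<in> sections A"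
  and bracket_lincomb: "X \<in> sections A \<Longrightarrow> Y \<in> sections A \<Longrightarrow> Z \<in> sections A \<Longrightarrow>
    bracket A (\<lambda>y. a *\<^sub>R X y + b *\<^sub>R Y y) Z x = a *\<^sub>R bracket A X Z x + b *\<^sub>R bracket A Y Z x"
  and bracket_antisym: "X \<in> sections A \<Longrightarrow> Y \<in> sections A \<Longrightarrow> bracket A X Y x = - bracket A Y X x"
  and bracket_Leibniz: "X \<in> sections A \<Longrightarrow> Y \<in> sections A \<Longrightarrow> smooth f \<Longrightarrow>
    bracket A X (\<lambda>y. f y *\<^sub>R Y y) x = f x *\<^sub>R bracket A X Y x + anchor A x (X x) f *\<^sub>R Y x"
proof -
  note L0 = lie_algebroid[unfolded lie_algebroid_def, THEN conjunct2]
  note L1 = L0[THEN conjunct2]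
  note L2 = L1[THEN conjunct2]
  note L3 = L2[THEN conjunct2]
  note L4 = L3[THEN conjunct2]
  note L5 = L4[THEN conjunct2]
  note L6 = L5[THEN conjunct2]
  show "v \<in> fibre A x \<Longrightarrow> derivation_at (atlas A) x (anchor A x v)"
    by (rule L0[THEN conjunct1, rule_format])
  show "smooth f \<Longrightarrow> linear_on (fibre A x) (\<lambda>v. anchor A x v f)"
    by (rule L1[THEN conjunct1, rule_format])
  show "X \<in> sections A \<Longrightarrow> smooth f \<Longrightarrow> smooth (\<lambda>x. anchor A x (X x) f)"
    by (rule L2[THEN conjunct1, rule_format])
  show "X \<in> sections A \<Longrightarrow> Y \<in> sections A \<Longrightarrow> bracket A X Y \<in> sections A"
    by (rule L3[THEN conjunct1, rule_format])
  show "X \<in> sections A \<Longrightarrow> Y \<in> sections A \<Longrightarrow> Z \<in> sections A \<Longrightarrow>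
    bracket A (\<lambda>y. a *\<^sub>R X y + b *\<^sub>R Y y) Z x = a *\<^sub>R bracket A X Z x + b *\<^sub>R bracket A Y Z x"
    by (rule L4[THEN conjunct1, rule_format])
  show "X \<in> sections A \<Longrightarrow> Y \<in> sections A \<Longrightarrow> bracket A X Y x = - bracket A Y X x"
    by (rule L5[THEN conjunct1, rule_format])
  show "X \<in> sections A \<Longrightarrow> Y \<in> sections A \<Longrightarrow> smooth f \<Longrightarrow>
    bracket A X (\<lambda>y. f y *\<^sub>R Y y) x = f x *\<^sub>R bracket A X Y x + anchor A x (X x) f *\<^sub>R Y x"
    by (rule L6[THEN conjunct2, rule_format])
qed

lemma anchor_lincomb:
  assumes "v \<in> fibre A x" "smooth f" "smooth g"
  shows "anchor A x v (\<lambda>y. a * f y + b * g y) = a * anchor A x v f + b * anchor A x v g"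
  using anchor_derivation[OF assms(1)] assms(2,3) by (simp add: derivation_at_def)

lemma anchor_mult:
  assumes "v \<in> fibre A x" "smooth f" "smooth g"
  shows "anchor A x v (\<lambda>y. f y * g y) = f x * anchor A x v g + g x * anchor A x v f"
  using anchor_derivation[OF assms(1)] assms(2,3) by (simp add: derivation_at_def)

lemma anchor_add:
  "v \<in> fibre A x \<Longrightarrow> smooth f \<Longrightarrow> smooth g
    \<Longrightarrow> anchor A x v (\<lambda>y. f y + g y) = anchor A x v f + anchor A x v g"
  using anchor_lincomb[of v x f g 1 1] by simp

lemma anchor_diff:
  "v \<in> fibre A x \<Longrightarrow> smooth f \<Longrightarrow> smooth g
    \<Longrightarrow> anchor A x v (\<lambda>y. f y - g y) = anchor A x v f - anchor A x v g"
  using anchor_lincomb[of v x f g 1 "-1"] by simp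

lemma anchor_cmult:
  "v \<in> fibre A x \<Longrightarrow> smooth f \<Longrightarrow> anchor A x v (\<lambda>y. c * f y) = c * anchor A x v f"
  using anchor_lincomb[of v x f f c 0] by simp

lemma anchor_minus:
  "v \<in> fibre A x \<Longrightarrow> smooth f \<Longrightarrow> anchor A x v (\<lambda>y. - f y) = - anchor A x v f"
  using anchor_cmult[of v x f "-1"] by simp

lemma anchor_zero: "v \<in> fibre A x \<Longrightarrow> anchor A x v (\<lambda>y. 0) = 0"
  using anchor_cmult[of v x "\<lambda>y. 0" 0] by (simp add: smooth_map_on_const)

lemma anchor_sum:
  assumes "v \<in> fibre A x" "\<And>i. i \<in> I \<Longrightarrow> smooth (f i)"
  shows "anchor A x v (\<lambda>y. \<Sum>i\<in>I. f i y) = (\<Sum>i\<in>I. anchor A x v (f i))"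
  using assms(2)
  by (induction I rule: infinite_finite_induct)
    (auto simp: anchor_zero anchor_add assms(1) smooth_map_on_sum)

text \<open>With a bump function h supported in \<open>V\<close>, the function h (f - g) vanishes
  everywhere. The product rule at \<open>x\<close>, where h is 1 and f - g is 0, leaves the
  derivative of f - g.\<close>

lemma anchor_cong_local:
  assumes v: "v \<in> fibre A x" and f: "smooth f" "smooth g"
    and V: "open V" "x \<in> V" "\<And>y. y \<in> V \<Longrightarrow> f y = g y"
  shows "anchor A x v f = anchor A x v g"
proof -
  obtain h V' K where h: "smooth h" "x \<in> V'" "V' \<subseteq> K" "K \<subseteq> V"
    "\<And>z. z \<in> V' \<Longrightarrow> h z = 1" "\<And>z. z \<notin> K \<Longrightarrow> h z = 0"
    using ex_bump[OF V(1,2)] by metis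
  have "(\<lambda>y. h y * (f y - g y)) = (\<lambda>y. 0)"
    using h(4,6) V(3) by (intro ext) (metis diff_self mult_eq_0_iff subsetD)
  then have "anchor A x v (\<lambda>y. h y * (f y - g y)) = 0" using anchor_zero[OF v] by simp
  moreover have "h x = 1" using h by blast
  ultimately show ?thesis
    using anchor_mult[OF v h(1) smooth_map_on_diff[OF open_UNIV f]] anchor_diff[OF v f] V by simp
qed

lemma bracket_lincomb_right:
  assumes "X \<in> sections A" "Y \<in> sections A" "Z \<in> sections A"
  shows "bracket A Z (\<lambda>y. a *\<^sub>R X y + b *\<^sub>R Y y) x = a *\<^sub>R bracket A Z X x + b *\<^sub>R bracket A Z Y x"
proof -
  have "(\<lambda>y. a *\<^sub>R X y + b *\<^sub>R Y y) \<in> sections A"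
    by (intro sections_add sections_const_scaleR assms)
  then show ?thesis
    using bracket_antisym[of Z _ x] bracket_lincomb assms by (simp add: scaleR_minus_right)
qed

lemma bracket_add_right:
  "X \<in> sections A \<Longrightarrow> Y \<in> sections A \<Longrightarrow> Z \<in> sections A
    \<Longrightarrow> bracket A Z (\<lambda>y. X y + Y y) x = bracket A Z X x + bracket A Z Y x"
  using bracket_lincomb_right[of X Y Z 1 1] by simp

lemma bracket_zero_right: "X \<in> sections A \<Longrightarrow> bracket A X (\<lambda>y. 0) x = 0"
  using bracket_lincomb_right[of X X X 0 0] by simp

lemma bracket_sum_right:
  assumes "\<And>i. i \<in> I \<Longrightarrow> X i \<in> sections A" "Z \<in> sections A"
  shows "bracket A Z (\<lambda>y. \<Sum>i\<in>I. X i y) x = (\<Sum>i\<in>I. bracket A Z (X i) x)"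
  using assms(1)
  by (induction I rule: infinite_finite_induct)
    (auto simp: bracket_zero_right bracket_add_right assms(2) sections_sum)

lemma bracket_sum_left:
  assumes "\<And>i. i \<in> I \<Longrightarrow> X i \<in> sections A" "Z \<in> sections A"
  shows "bracket A (\<lambda>y. \<Sum>i\<in>I. X i y) Z x = (\<Sum>i\<in>I. bracket A (X i) Z x)"
proof -
  have "bracket A (\<lambda>y. \<Sum>i\<in>I. X i y) Z x = - (\<Sum>i\<in>I. bracket A Z (X i) x)"
    by (simp only: bracket_antisym[OF sections_sum[of I X, OF assms(1)] assms(2)]
        bracket_sum_right[of I X, OF assms])
  also have "\<dots> = (\<Sum>i\<in>I. bracket A (X i) Z x)"
    unfolding sum_negf[symmetric] using assms by (intro sum.cong refl bracket_antisym[symmetric])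
  finally show ?thesis .
qed

lemma bracket_Leibniz_left:
  assumes "X \<in> sections A" "Y \<in> sections A" "smooth f"
  shows "bracket A (\<lambda>y. f y *\<^sub>R X y) Y x = f x *\<^sub>R bracket A X Y x - anchor A x (Y x) f *\<^sub>R X x"
  using bracket_Leibniz[OF assms(2,1,3), of x] bracket_antisym[OF assms(1,2), of x]
    bracket_antisym[OF sections_scaleR[OF assms(3,1)] assms(2), of x] by simp

text \<open>The same bump argument, with the Leibniz rule of the bracket in place of the product
  rule.\<close>

lemma bracket_cong_right:
  assumes X: "X \<in> sections A" "X' \<in> sections A" and Y: "Y \<in> sections A"
    and V: "open V" "x \<in> V" "\<And>y. y \<in> V \<Longrightarrow> X y = X' y"
  shows "bracket A Y X x = bracket A Y X' x"
proof -
  obtain h V' K where h: "smooth h" "x \<in> V'" "V' \<subseteq> K" "K \<subseteq> V"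
    "\<And>z. z \<in> V' \<Longrightarrow> h z = 1" "\<And>z. z \<notin> K \<Longrightarrow> h z = 0"
    using ex_bump[OF V(1,2)] by metis
  have "(\<lambda>y. h y *\<^sub>R (X y - X' y)) = (\<lambda>y. 0)"
    using h(4,6) V(3) by (intro ext) (metis diff_self scaleR_eq_0_iff subsetD)
  then have "bracket A Y (\<lambda>y. h y *\<^sub>R (X y - X' y)) x = 0" using bracket_zero_right[OF Y] by simp
  moreover have "h x = 1" using h by blast
  ultimately show ?thesis
    using bracket_Leibniz[OF Y sections_diff[OF X] h(1), of x]
      bracket_lincomb_right[OF X Y, of 1 "-1" x] V by simp
qed

lemma bracket_cong:
  assumes "X \<in> sections A" "X' \<in> sections A" "Y \<in> sections A" "Y' \<in> sections A"
    and "open V" "x \<in> V" "\<And>y. y \<in> V \<Longrightarrow> X y = X' y" "\<And>y. y \<in> V \<Longrightarrow> Y y = Y' y"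
  shows "bracket A X Y x = bracket A X' Y' x"
  using bracket_cong_right[OF assms(3,4,1,5,6,8)] bracket_cong_right[OF assms(1,2,4,5,6,7)]
    bracket_antisym[OF assms(1,4)] bracket_antisym[OF assms(2,4)] by simp

text \<open>Linearity over smooth functions removes every dependence on derivatives of the section:
  this is the tensoriality principle, and it supplies the existence of Lie derivatives.\<close>

lemma cosection_of_tensorial:
  assumes smooth: "\<And>Y. Y \<in> sections A \<Longrightarrow> smooth (F Y)"
    and add: "\<And>Y Z x. Y \<in> sections A \<Longrightarrow> Z \<in> sections A \<Longrightarrow> F (\<lambda>y. Y y + Z y) x = F Y x + F Z x"
    and scale: "\<And>Y f x. Y \<in> sections A \<Longrightarrow> smooth f \<Longrightarrow> F (\<lambda>y. f y *\<^sub>R Y y) x = f x * F Y x"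
  obtains \<gamma> where "\<gamma> \<in> cosections A" "\<And>Y x. Y \<in> sections A \<Longrightarrow> \<gamma> x (Y x) = F Y x"
proof -
  have zero: "F (\<lambda>y. 0) x = 0" for x
    using scale[OF sections_zero smooth_map_on_const[of _ 0], of x] by simp
  have sum: "F (\<lambda>y. \<Sum>i\<in>I. X i y) x = (\<Sum>i\<in>I. F (X i) x)" if "\<And>i. i \<in> I \<Longrightarrow> X i \<in> sections A"
    for I :: "nat set" and X x
    using that by (induction I rule: infinite_finite_induct) (auto simp: zero add sections_sum)
  have eq: "F Y x = F Y' x" if Y: "Y \<in> sections A" "Y' \<in> sections A" "Y x = Y' x" for Y Y' x
  proof -
    obtain V n E \<Xi> where V: "open V" "x \<in> V" and E: "\<And>j. E j \<in> sections A"
      and \<Xi>: "\<And>j. \<Xi> j \<in> cosections A"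
      and fr: "\<And>y v. y \<in> V \<Longrightarrow> v \<in> fibre A y \<Longrightarrow> v = (\<Sum>j<n::nat. \<Xi> j y v *\<^sub>R E j y)"
      by (rule local_frame[of x]) (rule that)
    obtain h V' K where h: "smooth h" "x \<in> V'" "V' \<subseteq> K" "K \<subseteq> V"
      "\<And>z. z \<in> V' \<Longrightarrow> h z = 1" "\<And>z. z \<notin> K \<Longrightarrow> h z = 0"
      using ex_bump[OF V(1,2)] by metis
    have hx: "h x = 1" using h by blast
    have "F Y x = (\<Sum>j<n. \<Xi> j x (Y x) * F (E j) x)" if Y: "Y \<in> sections A" for Y
    proof -
      \<comment> \<open>The frame expansion holds only on \<open>V\<close>. Multiplying by
        \<open>h\<close> makes it an identity of global sections, to which \<open>F\<close> applies,
        and \<open>h x = 1\<close> removes the factor again.\<close>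
      have "h y *\<^sub>R Y y = (\<Sum>j<n. (h y * \<Xi> j y (Y y)) *\<^sub>R E j y)" for y
      proof (cases "y \<in> V")
        case True
        show ?thesis
          using arg_cong[OF fr[OF True sectionD[OF Y]], of "\<lambda>v. h y *\<^sub>R v"]
          by (simp add: scaleR_sum_right)
      next
        case False
        then have "h y = 0" using h(4,6) by blast
        then show ?thesis by simp
      qed
      then have "F (\<lambda>y. h y *\<^sub>R Y y) x = (\<Sum>j<n. h x * \<Xi> j x (Y x) * F (E j) x)"
        using smooth_map_on_mult[OF open_UNIV h(1) smooth_pairing[OF \<Xi> Y]] E
        by (simp add: sum scale sections_scaleR)
      then show ?thesis using scale[OF Y h(1)] hx by simp
    qed
    then show ?thesis using Y by simp
  qed
  define ext where "ext x v = (SOME Y. Y \<in> sections A \<and> Y x = v)" for x v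
  have ext: "ext x v \<in> sections A" "ext x v x = v" if "v \<in> fibre A x" for x v
  proof -
    obtain Y where "Y \<in> sections A" "Y x = v" by (rule ex_section_through[OF \<open>v \<in> fibre A x\<close>])
    then have "Y \<in> sections A \<and> Y x = v" by simp
    then have "ext x v \<in> sections A \<and> ext x v x = v" 
      unfolding ext_def by (rule someI[where P = "\<lambda>Y. Y \<in> sections A \<and> Y x = v"])
    then show "ext x v \<in> sections A" "ext x v x = v" by auto
  qed
  define \<gamma> where "\<gamma> x = restr A x (\<lambda>v. F (ext x v) x)" for x
  have val: "\<gamma> x (Y x) = F Y x" if "Y \<in> sections A" for Y x
    using eq[OF ext(1)[OF sectionD[OF that]] that] ext(2)[OF sectionD[OF that]]
    by (simp add: \<gamma>_def restr_def sectionD[OF that])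
  have "\<gamma> \<in> cosections A"
  proof (rule cosectionsI)
    fix x
    show "\<gamma> x \<in> dual_fibre A x"
      unfolding \<gamma>_def
    proof (rule restr_dual_fibre, unfold linear_on_def, intro ballI allI)
      fix u v a b assume uv: "u \<in> fibre A x" "v \<in> fibre A x"
      let ?Y = "\<lambda>y. a *\<^sub>R ext x u y + b *\<^sub>R ext x v y"
      have "F (ext x (a *\<^sub>R u + b *\<^sub>R v)) x = F ?Y x"
        using uv fibre_add[OF fibre_scaleR[OF uv(1)] fibre_scaleR[OF uv(2)]]
        by (intro eq sections_add sections_const_scaleR) (simp_all add: ext)
      also have "\<dots> = a * F (ext x u) x + b * F (ext x v) x"
        using uv scale[OF _ smooth_map_on_const]
        by (simp add: add sections_const_scaleR ext)
      finally show "F (ext x (a *\<^sub>R u + b *\<^sub>R v)) x = a *\<^sub>R F (ext x u) x + b *\<^sub>R F (ext x v) x" by simp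
    qed
  qed (simp add: val smooth)
  then show ?thesis using that val by blast
qed

lemma cosections_eqI:
  assumes "\<alpha> \<in> cosections A" "\<beta> \<in> cosections A"
    and "\<And>Y x. Y \<in> sections A \<Longrightarrow> \<alpha> x (Y x) = \<beta> x (Y x)"
  shows "\<alpha> = \<beta>"
proof (rule ext, rule dual_fibre_eqI)
  show "\<alpha> x v = \<beta> x v" if "v \<in> fibre A x" for x v
    using ex_section_through[OF that] assms(3) by metis
qed (use assms in \<open>auto intro: cosectionD\<close>)

text \<open>The derivative of f along X enters once through the product rule and once through the
  Leibniz rule, with opposite signs, so the defining formula is tensorial in Y. That gives
  existence; uniqueness holds because a section passes through every fibre vector.\<close>

lemma lie_deriv:
  assumes X: "X \<in> sections A" and \<beta>: "\<beta> \<in> cosections A"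
  shows lie_deriv_cosection: "lie_deriv A X \<beta> \<in> cosections A"
    and lie_deriv_pairing: "Y \<in> sections A \<Longrightarrow>
      lie_deriv A X \<beta> x (Y x) = anchor A x (X x) (\<lambda>y. \<beta> y (Y y)) - \<beta> x (bracket A X Y x)"
proof -
  let ?F = "\<lambda>Y x. anchor A x (X x) (\<lambda>y. \<beta> y (Y y)) - \<beta> x (bracket A X Y x)"
  note lin = dual_fibre_linear[OF cosectionD[OF \<beta>]]
  obtain \<gamma> where \<gamma>: "\<gamma> \<in> cosections A" "\<And>Y x. Y \<in> sections A \<Longrightarrow> \<gamma> x (Y x) = ?F Y x"
  proof (rule cosection_of_tensorial[of ?F])
    show "smooth (?F Y)" if "Y \<in> sections A" for Y
      using that X \<beta>
      by (intro smooth_map_on_diff open_UNIV smooth_anchor smooth_pairing bracket_section)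
  next
    fix Y Z x assume "Y \<in> sections A" "Z \<in> sections A"
    then show "?F (\<lambda>y. Y y + Z y) x = ?F Y x + ?F Z x"
      using X \<beta>
      by (simp add: linear_on_add[OF lin] sectionD anchor_add smooth_pairing bracket_add_right
          bracket_section)
  next
    fix Y f x assume "Y \<in> sections A" "smooth f"
    then show "?F (\<lambda>y. f y *\<^sub>R Y y) x = f x * ?F Y x"
      using X \<beta>
      by (simp add: linear_on_scaleR[OF lin] linear_on_add[OF lin] sectionD anchor_mult
          smooth_pairing bracket_Leibniz bracket_section fibre_scaleR algebra_simps)
  qed (rule that)
  have "lie_deriv A X \<beta> = \<gamma>"
    unfolding lie_deriv_def
  proof (rule the_equality)
    fix \<delta> assume "\<delta> \<in> cosections A \<and> (\<forall>Y\<in>sections A. \<forall>x. \<delta> x (Y x) = ?F Y x)"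
    then show "\<delta> = \<gamma>" using \<gamma> by (intro cosections_eqI) auto
  qed (use \<gamma> in auto)
  then show "lie_deriv A X \<beta> \<in> cosections A"
    "Y \<in> sections A \<Longrightarrow> lie_deriv A X \<beta> x (Y x) = ?F Y x"
    using \<gamma> by auto
qed

section \<open>Tensors acting on sections\<close>

lemma two_form_linear: "two_form A \<omega> \<Longrightarrow> u \<in> fibre A x \<Longrightarrow> linear_on (fibre A x) (\<omega> x u)"
  and two_form_skew: "two_form A \<omega> \<Longrightarrow> u \<in> fibre A x \<Longrightarrow> v \<in> fibre A x \<Longrightarrow> \<omega> x u v = - \<omega> x v u"
  and two_form_smooth_local: "two_form A \<omega> \<Longrightarrow> (U, \<phi>) \<in> trivs A \<Longrightarrow>
    smooth_map_on (atlas A) U (\<lambda>x. \<omega> x (local_vec A \<phi> w x) (local_vec A \<phi> w' x))"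
  unfolding two_form_def by fast+

lemma two_form_linear_left:
  "two_form A \<omega> \<Longrightarrow> v \<in> fibre A x \<Longrightarrow> linear_on (fibre A x) (\<lambda>u. \<omega> x u v)"
  using two_form_linear[of \<omega> v x] two_form_skew[of \<omega> _ x v]
  by (auto simp: linear_on_def fibre_intros)

lemma flat_dual_fibre: "two_form A \<omega> \<Longrightarrow> u \<in> fibre A x \<Longrightarrow> flat A \<omega> x u \<in> dual_fibre A x"
  unfolding flat_def by (intro restr_dual_fibre two_form_linear)

lemma flat_apply: "v \<in> fibre A x \<Longrightarrow> flat A \<omega> x u v = \<omega> x u v"
  by (simp add: flat_def restr_def)

lemma smooth_two_form:
  assumes "two_form A \<omega>" "X \<in> sections A" "Y \<in> sections A"
  shows "smooth (\<lambda>x. \<omega> x (X x) (Y x))"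
proof (rule smooth_map_onI_local)
  fix x
  obtain U \<phi> where U: "(U, \<phi>) \<in> trivs A" "x \<in> U" using ex_triv[of x] by auto
  obtain n and e :: "nat \<Rightarrow> 'f" and \<xi> where \<xi>: "\<And>j. bounded_linear (\<xi> j)"
    and e: "\<And>w. w = (\<Sum>j<n. \<xi> j w *\<^sub>R e j)"
    by (rule finite_dim_coordinates[OF finite_dim_typical_fibre]) (rule that)
  let ?g = "\<lambda>y. \<Sum>j<n. \<xi> j (\<phi> y (X y)) * (\<Sum>k<n. \<xi> k (\<phi> y (Y y)) *
      \<omega> y (local_vec A \<phi> (e j) y) (local_vec A \<phi> (e k) y))"
  have "\<omega> y (X y) (Y y) = ?g y" if y: "y \<in> U" for y
  proof -
    note lv = local_vec_fibre[OF U(1) y]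
    have "\<omega> y (X y) (Y y)
        = (\<Sum>j<n. \<xi> j (\<phi> y (X y)) *\<^sub>R \<omega> y (local_vec A \<phi> (e j) y) (Y y))"
      using arg_cong[OF local_expansion[OF U(1) y sectionD[OF assms(2)] e], of "\<lambda>u. \<omega> y u (Y y)"]
        linear_on_sum[OF fibre_subspace two_form_linear_left[OF assms(1) sectionD[OF assms(3)]] lv]
      by simp
    moreover have "\<omega> y (local_vec A \<phi> (e j) y) (Y y)
        = (\<Sum>k<n. \<xi> k (\<phi> y (Y y)) *\<^sub>R \<omega> y (local_vec A \<phi> (e j) y) (local_vec A \<phi> (e k) y))" for j
      using arg_cong[OF local_expansion[OF U(1) y sectionD[OF assms(3)] e],
          of "\<omega> y (local_vec A \<phi> (e j) y)"]
        linear_on_sum[OF fibre_subspace two_form_linear[OF assms(1) lv] lv]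
      by simp
    ultimately show ?thesis by simp
  qed
  moreover have "smooth_map_on (atlas A) U ?g"
    using triv_open[OF U(1)] U(1) assms
    by (intro smooth_map_on_intros smooth_map_on_bounded_linear[OF \<xi>] section_smooth
        two_form_smooth_local) auto
  ultimately show "\<exists>V g. open V \<and> x \<in> V \<and> (\<forall>y\<in>UNIV \<inter> V. \<omega> y (X y) (Y y) = g y)
      \<and> smooth_map_on (atlas A) (UNIV \<inter> V) g"
    using U triv_open by (intro exI[of _ U] exI[of _ ?g]) auto
qed simp

lemma flat_cosection:
  assumes "two_form A \<omega>" "X \<in> sections A"
  shows "(\<lambda>x. flat A \<omega> x (X x)) \<in> cosections A"
proof (rule cosectionsI)
  show "flat A \<omega> x (X x) \<in> dual_fibre A x" for x
    by (intro flat_dual_fibre assms sectionD)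
  show "smooth (\<lambda>x. flat A \<omega> x (X x) (Y x))" if "Y \<in> sections A" for Y
    using smooth_two_form[OF assms that] that by (simp add: flat_apply sectionD)
qed

section \<open>Bivectors and their sharp maps\<close>

lemma bivector_lincomb: "bivector A \<pi> \<Longrightarrow> \<alpha> \<in> dual_fibre A x \<Longrightarrow> \<beta> \<in> dual_fibre A x \<Longrightarrow>
    \<gamma> \<in> dual_fibre A x \<Longrightarrow> \<pi> x (\<lambda>v. a * \<alpha> v + b * \<beta> v) \<gamma> = a * \<pi> x \<alpha> \<gamma> + b * \<pi> x \<beta> \<gamma>"
  and bivector_skew: "bivector A \<pi> \<Longrightarrow> \<alpha> \<in> dual_fibre A x \<Longrightarrow> \<beta> \<in> dual_fibre A x \<Longrightarrow>
    \<pi> x \<alpha> \<beta> = - \<pi> x \<beta> \<alpha>"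
  and bivector_smooth_local: "bivector A \<pi> \<Longrightarrow> (U, \<phi>) \<in> trivs A \<Longrightarrow> linear \<xi> \<Longrightarrow> linear \<eta> \<Longrightarrow>
    smooth_map_on (atlas A) U
      (\<lambda>x. \<pi> x (restr A x (\<lambda>v. \<xi> (\<phi> x v))) (restr A x (\<lambda>v. \<eta> (\<phi> x v))))"
proof -
  assume b: "bivector A \<pi>"
  note B = b[unfolded bivector_def, THEN conjunct2, THEN conjunct1]
    b[unfolded bivector_def, THEN conjunct1] b[unfolded bivector_def, THEN conjunct2, THEN conjunct2]
  show "\<alpha> \<in> dual_fibre A x \<Longrightarrow> \<beta> \<in> dual_fibre A x \<Longrightarrow> \<pi> x \<alpha> \<beta> = - \<pi> x \<beta> \<alpha>"
    using B(1) by blast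
  show "\<alpha> \<in> dual_fibre A x \<Longrightarrow> \<beta> \<in> dual_fibre A x \<Longrightarrow> \<gamma> \<in> dual_fibre A x \<Longrightarrow>
      \<pi> x (\<lambda>v. a * \<alpha> v + b * \<beta> v) \<gamma> = a * \<pi> x \<alpha> \<gamma> + b * \<pi> x \<beta> \<gamma>"
    using B(2) by simp
  show "(U, \<phi>) \<in> trivs A \<Longrightarrow> linear \<xi> \<Longrightarrow> linear \<eta> \<Longrightarrow> smooth_map_on (atlas A) U
      (\<lambda>x. \<pi> x (restr A x (\<lambda>v. \<xi> (\<phi> x v))) (restr A x (\<lambda>v. \<eta> (\<phi> x v))))"
    using B(3) by fast
qed

lemma bivector_sum:
  assumes "bivector A \<pi>" "\<And>i. i \<in> I \<Longrightarrow> \<alpha> i \<in> dual_fibre A x" "\<gamma> \<in> dual_fibre A x"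
  shows "\<pi> x (\<lambda>v. \<Sum>i\<in>I. a i * \<alpha> i v) \<gamma> = (\<Sum>i\<in>I. a i * \<pi> x (\<alpha> i) \<gamma>)"
proof -
  have "\<pi> x (\<lambda>v. 0) \<gamma> = 0"
    using bivector_lincomb[OF assms(1) dual_fibre_zero dual_fibre_zero assms(3), of 0 0] by simp
  then show ?thesis using assms(2)
  proof (induction I rule: infinite_finite_induct)
    case (insert i I)
    then show ?case
      using bivector_lincomb[OF assms(1) insert.prems(2) dual_fibre_sum assms(3), of i I \<alpha> "a i" 1 a]
      by simp
  qed auto
qed

lemma bivector_sum_right:
  assumes "bivector A \<pi>" "\<And>i. i \<in> I \<Longrightarrow> \<alpha> i \<in> dual_fibre A x" "\<gamma> \<in> dual_fibre A x"
  shows "\<pi> x \<gamma> (\<lambda>v. \<Sum>i\<in>I. a i * \<alpha> i v) = (\<Sum>i\<in>I. a i * \<pi> x \<gamma> (\<alpha> i))"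
proof -
  have "\<pi> x \<gamma> (\<lambda>v. \<Sum>i\<in>I. a i * \<alpha> i v) = - (\<Sum>i\<in>I. a i * \<pi> x (\<alpha> i) \<gamma>)"
    by (simp only: bivector_skew[OF assms(1,3) dual_fibre_sum[OF assms(2)]] bivector_sum[OF assms])
  also have "\<dots> = (\<Sum>i\<in>I. a i * \<pi> x \<gamma> (\<alpha> i))"
    unfolding sum_negf[symmetric]
    using bivector_skew[OF assms(1,3) assms(2)] by (intro sum.cong) auto
  finally show ?thesis .
qed

lemma smooth_bivector:
  assumes b: "bivector A \<pi>" and \<alpha>: "\<alpha> \<in> cosections A" and \<beta>: "\<beta> \<in> cosections A"
  shows "smooth (\<lambda>x. \<pi> x (\<alpha> x) (\<beta> x))"
proof (rule smooth_map_onI_local)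
  fix x
  obtain U \<phi> where U: "(U, \<phi>) \<in> trivs A" "x \<in> U" using ex_triv[of x] by auto
  obtain n and e :: "nat \<Rightarrow> 'f" and \<xi> where \<xi>: "\<And>j. bounded_linear (\<xi> j)"
    and e: "\<And>w. w = (\<Sum>j<n. \<xi> j w *\<^sub>R e j)"
    by (rule finite_dim_coordinates[OF finite_dim_typical_fibre]) (rule that)
  define \<theta> where "\<theta> j y = restr A y (\<lambda>v. \<xi> j (\<phi> y v))" for j y
  have \<theta>: "\<theta> j y \<in> dual_fibre A y" if "y \<in> U" for j y
    unfolding \<theta>_def
    using U(1) that bounded_linear.linear[OF \<xi>] by (rule restr_coordinate_dual_fibre)
  have ex: "\<mu> = (\<lambda>v. \<Sum>j<n. \<mu> (local_vec A \<phi> (e j) y) * \<theta> j y v)"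
    if y: "y \<in> U" and \<mu>: "\<mu> \<in> dual_fibre A y" for y \<mu>
  proof (rule dual_fibre_eqI[OF \<mu> dual_fibre_sum[OF \<theta>[OF y]]])
    fix v assume v: "v \<in> fibre A y"
    show "\<mu> v = (\<Sum>j<n. \<mu> (local_vec A \<phi> (e j) y) * \<theta> j y v)"
      using arg_cong[OF local_expansion[OF U(1) y v e], of \<mu>] v
        linear_on_sum[OF fibre_subspace dual_fibre_linear[OF \<mu>] local_vec_fibre[OF U(1) y]]
      by (simp add: \<theta>_def restr_def mult.commute)
  qed
  let ?g = "\<lambda>y. \<Sum>j<n. \<alpha> y (local_vec A \<phi> (e j) y) *
      (\<Sum>k<n. \<beta> y (local_vec A \<phi> (e k) y) * \<pi> y (\<theta> j y) (\<theta> k y))"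
  have "\<pi> y (\<alpha> y) (\<beta> y) = ?g y" if y: "y \<in> U" for y
  proof -
    have "\<pi> y (\<alpha> y) (\<beta> y) = (\<Sum>j<n. \<alpha> y (local_vec A \<phi> (e j) y) * \<pi> y (\<theta> j y) (\<beta> y))"
      using arg_cong[OF ex[OF y cosectionD[OF \<alpha>]], of "\<lambda>\<mu>. \<pi> y \<mu> (\<beta> y)"]
        bivector_sum[OF b \<theta>[OF y] cosectionD[OF \<beta>]] by simp
    moreover have "\<pi> y (\<theta> j y) (\<beta> y) = (\<Sum>k<n. \<beta> y (local_vec A \<phi> (e k) y) * \<pi> y (\<theta> j y) (\<theta> k y))" for j
      using arg_cong[OF ex[OF y cosectionD[OF \<beta>]], of "\<pi> y (\<theta> j y)"]
        bivector_sum_right[OF b \<theta>[OF y] \<theta>[OF y]] by simp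
    ultimately show ?thesis by simp
  qed
  moreover have "smooth_map_on (atlas A) U ?g"
    unfolding \<theta>_def
    using triv_open[OF U(1)] U(1) assms bounded_linear.linear[OF \<xi>]
    by (intro smooth_map_on_intros cosection_smooth bivector_smooth_local) auto
  ultimately show "\<exists>V g. open V \<and> x \<in> V \<and> (\<forall>y\<in>UNIV \<inter> V. \<pi> y (\<alpha> y) (\<beta> y) = g y)
      \<and> smooth_map_on (atlas A) (UNIV \<inter> V) g"
    using U triv_open by (intro exI[of _ U] exI[of _ ?g]) auto
qed simp

text \<open>The coframe at \<open>x\<close> already separates the vectors of the fibre.\<close>

lemma fibre_eqI:
  assumes u: "u \<in> fibre A x" and v: "v \<in> fibre A x"
    and eq: "\<And>\<alpha>. \<alpha> \<in> dual_fibre A x \<Longrightarrow> \<alpha> u = \<alpha> v"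
  shows "u = v"
proof -
  obtain V n E \<Xi> where V: "open V" "x \<in> V" and E: "\<And>j. E j \<in> sections A"
    and \<Xi>: "\<And>j. \<Xi> j \<in> cosections A"
    and fr: "\<And>y v. y \<in> V \<Longrightarrow> v \<in> fibre A y \<Longrightarrow> v = (\<Sum>j<n::nat. \<Xi> j y v *\<^sub>R E j y)"
    by (rule local_frame[of x]) (rule that)
  have "(\<Sum>j<n. \<Xi> j x u *\<^sub>R E j x) = (\<Sum>j<n. \<Xi> j x v *\<^sub>R E j x)"
    using eq[OF cosectionD[OF \<Xi>]] by simp
  then show ?thesis using fr[OF V(2) u] fr[OF V(2) v] by simp
qed

text \<open>The vector sought is the sum of the \<open>E j x\<close> with coefficients
  \<open>\<pi> x \<alpha> (\<Xi> j x)\<close>: reflexivity of a finite-dimensional fibre, written in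
  a frame. Uniqueness is \<open>fibre_eqI\<close>.\<close>

lemma sharp:
  assumes b: "bivector A \<pi>" and \<alpha>: "\<alpha> \<in> dual_fibre A x"
  shows sharp_fibre: "sharp A \<pi> x \<alpha> \<in> fibre A x"
    and sharp_pairing: "\<beta> \<in> dual_fibre A x \<Longrightarrow> \<beta> (sharp A \<pi> x \<alpha>) = \<pi> x \<alpha> \<beta>"
proof -
  obtain V n E \<Xi> where V: "open V" "x \<in> V" and E: "\<And>j. E j \<in> sections A"
    and \<Xi>: "\<And>j. \<Xi> j \<in> cosections A"
    and fr: "\<And>y v. y \<in> V \<Longrightarrow> v \<in> fibre A y \<Longrightarrow> v = (\<Sum>j<n::nat. \<Xi> j y v *\<^sub>R E j y)"
    by (rule local_frame[of x]) (rule that)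
  let ?v = "\<Sum>j<n. \<pi> x \<alpha> (\<Xi> j x) *\<^sub>R E j x"
  have v: "?v \<in> fibre A x" by (intro fibre_intros sectionD E)
  have pair: "\<beta> ?v = \<pi> x \<alpha> \<beta>" if \<beta>: "\<beta> \<in> dual_fibre A x" for \<beta>
  proof -
    have "\<beta> = (\<lambda>v. \<Sum>j<n. \<beta> (E j x) * \<Xi> j x v)"
      by (rule dual_fibre_eqI[OF \<beta> dual_fibre_sum[OF cosectionD[OF \<Xi>]]])
        (use dual_frame_expansion[of E x \<Xi> n \<beta>, OF E fr[OF V(2)] \<beta>] in \<open>simp add: mult.commute\<close>)
    then have "\<pi> x \<alpha> \<beta> = \<pi> x \<alpha> (\<lambda>v. \<Sum>j<n. \<beta> (E j x) * \<Xi> j x v)" by simp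
    also have "\<dots> = (\<Sum>j<n. \<beta> (E j x) * \<pi> x \<alpha> (\<Xi> j x))"
      by (rule bivector_sum_right[OF b cosectionD[OF \<Xi>] \<alpha>])
    also have "\<dots> = \<beta> ?v"
      using linear_on_sum[OF fibre_subspace dual_fibre_linear[OF \<beta>], of "{..<n}" "\<lambda>j. E j x"]
        sectionD[OF E] by (simp add: mult.commute)
    finally show ?thesis by simp
  qed
  have "sharp A \<pi> x \<alpha> = ?v"
    unfolding sharp_def by (rule the_equality) (use v pair in \<open>auto intro: fibre_eqI\<close>)
  then show "sharp A \<pi> x \<alpha> \<in> fibre A x" "\<beta> \<in> dual_fibre A x \<Longrightarrow> \<beta> (sharp A \<pi> x \<alpha>) = \<pi> x \<alpha> \<beta>"
    using v pair by auto
qed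

lemma sharp_section:
  assumes "bivector A \<pi>" "\<alpha> \<in> cosections A"
  shows "(\<lambda>x. sharp A \<pi> x (\<alpha> x)) \<in> sections A"
proof (rule sectionsI)
  show "sharp A \<pi> x (\<alpha> x) \<in> fibre A x" for x
    by (intro sharp_fibre assms cosectionD)
  show "smooth (\<lambda>x. \<beta> x (sharp A \<pi> x (\<alpha> x)))" if "\<beta> \<in> cosections A" for \<beta>
    using smooth_bivector[OF assms that] sharp_pairing[OF assms(1) cosectionD[OF assms(2)] cosectionD[OF that]]
    by simp
qed

section \<open>Endomorphisms, transposes and the deformed structure\<close>

lemma endomorphism_fibre: "endomorphism A N \<Longrightarrow> v \<in> fibre A x \<Longrightarrow> N x v \<in> fibre A x"
  and endomorphism_linear: "endomorphism A N \<Longrightarrow> linear_on (fibre A x) (N x)"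
  and endomorphism_smooth_local: "endomorphism A N \<Longrightarrow> (U, \<phi>) \<in> trivs A \<Longrightarrow>
    smooth_map_on (atlas A) U (\<lambda>x. \<phi> x (N x (local_vec A \<phi> w x)))"
  unfolding endomorphism_def by fast+

lemma endomorphism_section:
  assumes N: "endomorphism A N" and X: "X \<in> sections A"
  shows "(\<lambda>x. N x (X x)) \<in> sections A"
proof (rule sectionsI)
  show "N x (X x) \<in> fibre A x" for x by (intro endomorphism_fibre[OF N] sectionD[OF X])
  show "smooth (\<lambda>x. \<alpha> x (N x (X x)))" if \<alpha>: "\<alpha> \<in> cosections A" for \<alpha>
  proof (rule smooth_map_onI_local)
    fix x
    obtain U \<phi> where U: "(U, \<phi>) \<in> trivs A" "x \<in> U" using ex_triv[of x] by auto
    obtain n and e :: "nat \<Rightarrow> 'f" and \<xi> where \<xi>: "\<And>j. bounded_linear (\<xi> j)"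
      and e: "\<And>w. w = (\<Sum>j<n. \<xi> j w *\<^sub>R e j)"
      by (rule finite_dim_coordinates[OF finite_dim_typical_fibre]) (rule that)
    let ?g = "\<lambda>y. \<Sum>j<n. \<xi> j (\<phi> y (X y)) * (\<Sum>k<n. \<xi> k (\<phi> y (N y (local_vec A \<phi> (e j) y))) *
        \<alpha> y (local_vec A \<phi> (e k) y))"
    have "\<alpha> y (N y (X y)) = ?g y" if y: "y \<in> U" for y
    proof -
      note lv = local_vec_fibre[OF U(1) y]
      note lin = dual_fibre_linear[OF cosectionD[OF \<alpha>]]
      have "N y (X y) = (\<Sum>j<n. \<xi> j (\<phi> y (X y)) *\<^sub>R N y (local_vec A \<phi> (e j) y))"
        using arg_cong[OF local_expansion[OF U(1) y sectionD[OF X] e], of "N y"]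
          linear_on_sum[OF fibre_subspace endomorphism_linear[OF N] lv] by simp
      then have "\<alpha> y (N y (X y)) = (\<Sum>j<n. \<xi> j (\<phi> y (X y)) * \<alpha> y (N y (local_vec A \<phi> (e j) y)))"
        using linear_on_sum[OF fibre_subspace lin endomorphism_fibre[OF N lv]] by simp
      moreover have "\<alpha> y (N y (local_vec A \<phi> (e j) y)) = (\<Sum>k<n. \<xi> k (\<phi> y (N y (local_vec A \<phi> (e j) y))) *
        \<alpha> y (local_vec A \<phi> (e k) y))" for j
        using arg_cong[OF local_expansion[OF U(1) y endomorphism_fibre[OF N lv] e], of "\<alpha> y"]
          linear_on_sum[OF fibre_subspace lin lv] by simp
      ultimately show ?thesis by simp
    qed
    moreover have "smooth_map_on (atlas A) U ?g"
      using triv_open[OF U(1)] U(1) X N \<alpha>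
      by (intro smooth_map_on_intros smooth_map_on_bounded_linear[OF \<xi>] section_smooth
          cosection_smooth endomorphism_smooth_local) auto
    ultimately show "\<exists>V g. open V \<and> x \<in> V \<and> (\<forall>y\<in>UNIV \<inter> V. \<alpha> y (N y (X y)) = g y)
        \<and> smooth_map_on (atlas A) (UNIV \<inter> V) g"
      using U triv_open by (intro exI[of _ U] exI[of _ ?g]) auto
  qed simp
qed

lemma endomorphismI:
  assumes fib: "\<And>x v. v \<in> fibre A x \<Longrightarrow> N x v \<in> fibre A x"
    and lin: "\<And>x. linear_on (fibre A x) (N x)"
    and sec: "\<And>X. X \<in> sections A \<Longrightarrow> (\<lambda>x. N x (X x)) \<in> sections A"
  shows "endomorphism A N"
proof -
  have "smooth_map_on (atlas A) U (\<lambda>x. \<phi> x (N x (local_vec A \<phi> w x)))" if U: "(U, \<phi>) \<in> trivs A" for U \<phi> w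
  proof (rule smooth_map_onI_local[OF triv_open[OF U]])
    fix x assume "x \<in> U"
    obtain V n E \<Xi> where V: "open V" "x \<in> V" and E: "\<And>j. E j \<in> sections A"
      and \<Xi>: "\<And>j. \<Xi> j \<in> cosections A"
      and fr: "\<And>y v. y \<in> V \<Longrightarrow> v \<in> fibre A y \<Longrightarrow> v = (\<Sum>j<n::nat. \<Xi> j y v *\<^sub>R E j y)"
      by (rule local_frame[of x]) (rule that)
    let ?g = "\<lambda>y. \<Sum>j<n. \<Xi> j y (local_vec A \<phi> w y) *\<^sub>R \<phi> y (N y (E j y))"
    have "\<phi> y (N y (local_vec A \<phi> w y)) = ?g y" if y: "y \<in> U \<inter> V" for y
    proof -
      have "N y (local_vec A \<phi> w y) = (\<Sum>j<n. \<Xi> j y (local_vec A \<phi> w y) *\<^sub>R N y (E j y))"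
        using arg_cong[OF fr[OF _ local_vec_fibre[OF U, of y w]], of "N y"] y
          linear_on_sum[OF fibre_subspace lin sectionD[OF E], where I = "{..<n}"] by simp
      then show ?thesis
        using linear_on_sum[OF fibre_subspace triv_linear[OF U, of y] fib[OF sectionD[OF E]],
            where I = "{..<n}"] y by simp
    qed
    moreover have "smooth_map_on (atlas A) (U \<inter> V) ?g"
      using triv_open[OF U] V smooth_map_on_subset[OF cosection_smooth[OF \<Xi> U]]
        smooth_map_on_subset[OF section_smooth[OF sec[OF E] U]]
      by (intro smooth_map_on_intros) auto
    ultimately show "\<exists>V g. open V \<and> x \<in> V \<and> (\<forall>y\<in>U \<inter> V. \<phi> y (N y (local_vec A \<phi> w y)) = g y)
        \<and> smooth_map_on (atlas A) (U \<inter> V) g"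
      using V by (intro exI[of _ V] exI[of _ ?g]) auto
  qed
  then show ?thesis using fib lin by (auto simp: endomorphism_def)
qed

lemma transpose_apply: "v \<in> fibre A x \<Longrightarrow> transpose_endo A N x \<alpha> v = \<alpha> (N x v)"
  by (simp add: transpose_endo_def restr_def)

lemma transpose_dual_fibre:
  assumes "endomorphism A N" "\<alpha> \<in> dual_fibre A x"
  shows "transpose_endo A N x \<alpha> \<in> dual_fibre A x"
  unfolding transpose_endo_def
  using endomorphism_linear[OF assms(1), of x] endomorphism_fibre[OF assms(1), of _ x]
    dual_fibre_linear[OF assms(2)]
  by (intro restr_dual_fibre) (auto simp: linear_on_def)

lemma transpose_cosection:
  assumes "endomorphism A N" "\<alpha> \<in> cosections A"
  shows "(\<lambda>x. transpose_endo A N x (\<alpha> x)) \<in> cosections A"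
proof (rule cosectionsI)
  show "transpose_endo A N x (\<alpha> x) \<in> dual_fibre A x" for x
    by (intro transpose_dual_fibre assms cosectionD)
  show "smooth (\<lambda>x. transpose_endo A N x (\<alpha> x) (X x))" if "X \<in> sections A" for X
    using smooth_pairing[OF assms(2) endomorphism_section[OF assms(1) that]] that
    by (simp add: transpose_apply sectionD)
qed

text \<open>Deformation keeps the underlying bundle, so whatever is defined without anchor and
  bracket is unchanged.\<close>

lemma deformed_simps:
  "fibre (deformed A N) = fibre A" "anchor (deformed A N) = (\<lambda>x v. anchor A x (N x v))"
  "bracket (deformed A N) = deformed_bracket A N" "sections (deformed A N) = sections A"
  "cosections (deformed A N) = cosections A" "sharp (deformed A N) = sharp A"
  by (auto simp: deformed_def sections_def cosections_def dual_fibre_def sharp_def fun_eq_iff)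

text \<open>The three Lie derivatives on the right of \<open>\<gamma>\<close> avoid showing that \<open>deformed A N\<close> is itself a
  Lie algebroid.\<close>

lemma lie_deriv_deformed_pairing:
  assumes N: "endomorphism A N" and X: "X \<in> sections A" and \<beta>: "\<beta> \<in> cosections A"
    and Y: "Y \<in> sections A"
  shows "lie_deriv (deformed A N) X \<beta> x (Y x)
    = anchor A x (N x (X x)) (\<lambda>y. \<beta> y (Y y)) - \<beta> x (deformed_bracket A N X Y x)"
proof -
  let ?NX = "\<lambda>y. N y (X y)" and ?N\<beta> = "\<lambda>y. transpose_endo A N y (\<beta> y)"
  define \<gamma> where "\<gamma> = (\<lambda>y v. lie_deriv A ?NX \<beta> y v
    + (transpose_endo A N y (lie_deriv A X \<beta> y) v - lie_deriv A X ?N\<beta> y v))"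
  note NX = endomorphism_section[OF N X] and N\<beta> = transpose_cosection[OF N \<beta>]
  have \<gamma>: "\<gamma> \<in> cosections A"
    unfolding \<gamma>_def
    by (intro cosections_add cosections_diff lie_deriv_cosection transpose_cosection N X \<beta> NX)
  have pair: "\<gamma> x (Y x) = anchor A x (N x (X x)) (\<lambda>y. \<beta> y (Y y)) - \<beta> x (deformed_bracket A N X Y x)"
    if Y: "Y \<in> sections A" for Y x
  proof -
    note NY = endomorphism_section[OF N Y]
    note lin = dual_fibre_linear[OF cosectionD[OF \<beta>], of x]
    have f: "bracket A X Y x \<in> fibre A x" "bracket A ?NX Y x \<in> fibre A x"
      "bracket A X (\<lambda>y. N y (Y y)) x \<in> fibre A x" "N x (bracket A X Y x) \<in> fibre A x"
      by (intro sectionD bracket_section endomorphism_fibre[OF N] X Y NX NY)+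
    have "transpose_endo A N x (lie_deriv A X \<beta> x) (Y x)
        = anchor A x (X x) (\<lambda>y. \<beta> y (N y (Y y))) - \<beta> x (bracket A X (\<lambda>y. N y (Y y)) x)"
      using lie_deriv_pairing[OF X \<beta> NY] sectionD[OF Y] by (simp add: transpose_apply)
    moreover have "lie_deriv A X ?N\<beta> x (Y x)
        = anchor A x (X x) (\<lambda>y. \<beta> y (N y (Y y))) - \<beta> x (N x (bracket A X Y x))"
      using lie_deriv_pairing[OF X N\<beta> Y] sectionD[OF Y] f by (simp add: transpose_apply)
    ultimately show ?thesis
      using f by (simp add: \<gamma>_def deformed_bracket_def lie_deriv_pairing[OF NX \<beta> Y]
          linear_on_diff[OF lin] linear_on_add[OF lin] fibre_add)
  qed
  have "lie_deriv (deformed A N) X \<beta> = \<gamma>"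
    unfolding lie_deriv_def deformed_simps
  proof (rule the_equality)
    fix \<delta> assume "\<delta> \<in> cosections A \<and> (\<forall>Y\<in>sections A. \<forall>x. \<delta> x (Y x)
      = anchor A x (N x (X x)) (\<lambda>y. \<beta> y (Y y)) - \<beta> x (deformed_bracket A N X Y x))"
    then show "\<delta> = \<gamma>" using \<gamma> pair by (intro cosections_eqI) auto
  qed (use \<gamma> pair in auto)
  then show ?thesis using pair[OF Y] by simp
qed

section \<open>Closed forms and compatible endomorphisms\<close>

text \<open>The two tensors are proportional on fibre vectors only, their values elsewhere being
  arbitrary, so this is not a substitution of equal functions. Smooth pairings are assumed instead
  of \<open>two_form\<close> so that the lemma also covers \<open>sigma i\<close>.\<close>

lemma d_two_form_scale:
  assumes "\<And>X Y. X \<in> sections A \<Longrightarrow> Y \<in> sections A \<Longrightarrow> smooth (\<lambda>x. \<omega> x (X x) (Y x))"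
    and "\<And>x u v. u \<in> fibre A x \<Longrightarrow> v \<in> fibre A x \<Longrightarrow> \<omega>' x u v = c * \<omega> x u v"
    and X: "X \<in> sections A" and Y: "Y \<in> sections A" and Z: "Z \<in> sections A"
  shows "d_two_form A \<omega>' X Y Z x = c * d_two_form A \<omega> X Y Z x"
  using sectionD[OF bracket_section[OF X Y]] sectionD[OF bracket_section[OF X Z]]
    sectionD[OF bracket_section[OF Y Z]]
  by (simp add: d_two_form_def assms sectionD anchor_cmult algebra_simps)

text \<open>Moving \<open>N\<close> across \<omega> by \<open>sym\<close> makes all anchor terms
  cancel, and of the bracket terms exactly the four of the torsion survive. Linearity in the first
  argument replaces \<open>two_form\<close>, again with \<open>sigma i\<close> in view.\<close>

lemma torsion_pairing:
  assumes linear: "\<And>x v. v \<in> fibre A x \<Longrightarrow> linear_on (fibre A x) (\<lambda>u. \<omega> x u v)" and N: "endomorphism A N"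
    and sym: "\<And>x u v. u \<in> fibre A x \<Longrightarrow> v \<in> fibre A x \<Longrightarrow> \<omega> x u (N x v) = \<omega> x (N x u) v"
    and X: "X \<in> sections A" and Y: "Y \<in> sections A" and Z: "Z \<in> sections A"
  shows "\<omega> x (torsion A N X Y x) (Z x) =
      d_two_form A (\<lambda>x u. \<omega> x (N x u)) (\<lambda>y. N y (X y)) Y Z x
    + d_two_form A (\<lambda>x u. \<omega> x (N x u)) X (\<lambda>y. N y (Y y)) Z x
    - d_two_form A \<omega> (\<lambda>y. N y (X y)) (\<lambda>y. N y (Y y)) Z x
    - d_two_form A (\<lambda>x u. \<omega> x (N x (N x u))) X Y Z x"
proof -
  note NX = endomorphism_section[OF N X] and NY = endomorphism_section[OF N Y]
  note f = sectionD[OF X] sectionD[OF Y] sectionD[OF Z] sectionD[OF NX] sectionD[OF NY]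
    sectionD[OF bracket_section[OF X Y]] sectionD[OF bracket_section[OF X Z]]
    sectionD[OF bracket_section[OF Y Z]] sectionD[OF bracket_section[OF NX Y]]
    sectionD[OF bracket_section[OF NX Z]] sectionD[OF bracket_section[OF X NY]]
    sectionD[OF bracket_section[OF NY Z]] sectionD[OF bracket_section[OF NX NY]]
    endomorphism_fibre[OF N]
  note lin = linear_on_diff[OF linear] linear_on_add[OF linear]
    linear_on_diff[OF endomorphism_linear[OF N]] linear_on_add[OF endomorphism_linear[OF N]]
  show ?thesis
    by (simp add: d_two_form_def torsion_def deformed_bracket_def lin sym f fibre_add fibre_diff)
qed

text \<open>This is d_N = i_N d - d i_N for the differential d_N of the deformed structure: the
  first three terms are i_N d\<omega>, and by \<open>sym\<close> the form i_N \<omega> is twice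
  \<omega>(Nu, v).\<close>

lemma d_two_form_deformed:
  assumes \<omega>: "two_form A \<omega>" and N: "endomorphism A N"
    and sym: "\<And>x u v. u \<in> fibre A x \<Longrightarrow> v \<in> fibre A x \<Longrightarrow> \<omega> x u (N x v) = \<omega> x (N x u) v"
    and X: "X \<in> sections A" and Y: "Y \<in> sections A" and Z: "Z \<in> sections A"
  shows "d_two_form (deformed A N) \<omega> X Y Z x =
      d_two_form A \<omega> (\<lambda>y. N y (X y)) Y Z x + d_two_form A \<omega> X (\<lambda>y. N y (Y y)) Z x
    + d_two_form A \<omega> X Y (\<lambda>y. N y (Z y)) x - 2 * d_two_form A (\<lambda>x u. \<omega> x (N x u)) X Y Z x"
proof -
  note NX = endomorphism_section[OF N X] and NY = endomorphism_section[OF N Y]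
    and NZ = endomorphism_section[OF N Z]
  note f = sectionD[OF X] sectionD[OF Y] sectionD[OF Z] sectionD[OF NX] sectionD[OF NY] sectionD[OF NZ]
    sectionD[OF bracket_section[OF X Y]] sectionD[OF bracket_section[OF X Z]]
    sectionD[OF bracket_section[OF Y Z]] sectionD[OF bracket_section[OF NX Y]]
    sectionD[OF bracket_section[OF NX Z]] sectionD[OF bracket_section[OF X NY]]
    sectionD[OF bracket_section[OF NY Z]] sectionD[OF bracket_section[OF X NZ]]
    sectionD[OF bracket_section[OF Y NZ]] endomorphism_fibre[OF N]
  note lin = linear_on_diff[OF two_form_linear_left[OF \<omega>]] linear_on_add[OF two_form_linear_left[OF \<omega>]]
  show ?thesis
    by (simp add: d_two_form_def deformed_simps deformed_bracket_def lin sym f fibre_add fibre_diff)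
qed

section \<open>Symplectic forms and their inverse bivectors\<close>

lemma symplectic_two_form: "symplectic A \<omega> \<Longrightarrow> two_form A \<omega>"
  and symplectic_closed: "symplectic A \<omega> \<Longrightarrow> X \<in> sections A \<Longrightarrow> Y \<in> sections A \<Longrightarrow>
    Z \<in> sections A \<Longrightarrow> d_two_form A \<omega> X Y Z x = 0"
  and symplectic_bij: "symplectic A \<omega> \<Longrightarrow> bij_betw (flat A \<omega> x) (fibre A x) (dual_fibre A x)"
  by (auto simp: symplectic_def)

lemma symplectic_nondegenerate:
  assumes "symplectic A \<omega>" "u \<in> fibre A x" "v \<in> fibre A x"
    and "\<And>w. w \<in> fibre A x \<Longrightarrow> \<omega> x u w = \<omega> x v w"
  shows "u = v"
proof (rule inj_onD[OF bij_betw_imp_inj_on[OF symplectic_bij[OF assms(1)]]])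
  show "flat A \<omega> x u = flat A \<omega> x v"
    using assms(4) by (auto simp: flat_def restr_def fun_eq_iff)
qed (use assms in auto)

lemma inverse_bivector_bivector: "inverse_bivector A \<omega> \<pi> \<Longrightarrow> bivector A \<pi>"
  and flat_sharp: "inverse_bivector A \<omega> \<pi> \<Longrightarrow> \<alpha> \<in> dual_fibre A x \<Longrightarrow>
    flat A \<omega> x (sharp A \<pi> x \<alpha>) = \<alpha>"
  and sharp_flat: "inverse_bivector A \<omega> \<pi> \<Longrightarrow> v \<in> fibre A x \<Longrightarrow>
    sharp A \<pi> x (flat A \<omega> x v) = v"
  by (auto simp: inverse_bivector_def)

text \<open>The arguments come out swapped because \<open>sharp\<close> pairs with the second
  argument of \<pi>: the value is the flat of v evaluated at u.\<close>

lemma inverse_bivector_flat: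
  assumes "two_form A \<omega>" "inverse_bivector A \<omega> \<pi>" "u \<in> fibre A x" "v \<in> fibre A x"
  shows "\<pi> x (flat A \<omega> x u) (flat A \<omega> x v) = \<omega> x v u"
  using sharp_pairing[OF inverse_bivector_bivector[OF assms(2)] flat_dual_fibre[OF assms(1,3)]
      flat_dual_fibre[OF assms(1,4)]] sharp_flat[OF assms(2,3)] flat_apply[OF assms(3)] by simp

lemma cosection_eq_flat:
  assumes "two_form A \<omega>" "inverse_bivector A \<omega> \<pi>" "\<alpha> \<in> cosections A"
  obtains a where "a \<in> sections A" "\<alpha> = (\<lambda>x. flat A \<omega> x (a x))"
proof
  show "(\<lambda>x. sharp A \<pi> x (\<alpha> x)) \<in> sections A"
    by (intro sharp_section inverse_bivector_bivector[OF assms(2)] assms)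
  show "\<alpha> = (\<lambda>x. flat A \<omega> x (sharp A \<pi> x (\<alpha> x)))"
    using flat_sharp[OF assms(2) cosectionD[OF assms(3)]] by simp
qed

text \<open>Unfolded on sections, the left side is d\<omega>(a, b, Y) + \<omega>([a, b], Y).
  Closedness therefore makes the flat map carry the bracket of sections to the bracket of
  cosections.\<close>

lemma bivector_bracket_flat:
  assumes \<omega>: "symplectic A \<omega>" and \<pi>: "inverse_bivector A \<omega> \<pi>"
    and a: "a \<in> sections A" and b: "b \<in> sections A" and v: "v \<in> fibre A x"
  shows "bivector_bracket A \<pi> (\<lambda>y. flat A \<omega> y (a y)) (\<lambda>y. flat A \<omega> y (b y)) x v
    = \<omega> x (bracket A a b x) v"
proof -
  note tf = symplectic_two_form[OF \<omega>]
  obtain Y where Y: "Y \<in> sections A" "Y x = v" by (rule ex_section_through[OF v])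
  note fa = sectionD[OF a] and fb = sectionD[OF b] and fY = sectionD[OF Y(1)]
  have "bivector_bracket A \<pi> (\<lambda>y. flat A \<omega> y (a y)) (\<lambda>y. flat A \<omega> y (b y)) x (Y x)
    = anchor A x (a x) (\<lambda>y. \<omega> y (b y) (Y y)) - \<omega> x (b x) (bracket A a Y x)
    - (anchor A x (b x) (\<lambda>y. \<omega> y (a y) (Y y)) - \<omega> x (a x) (bracket A b Y x))
    - anchor A x (Y x) (\<lambda>y. \<omega> y (b y) (a y))"
    using sectionD[OF bracket_section[OF a Y(1)], of x] sectionD[OF bracket_section[OF b Y(1)], of x]
    by (simp add: bivector_bracket_def sharp_flat[OF \<pi>] fa fb fY flat_apply d_fun_def restr_def
        lie_deriv_pairing[OF a flat_cosection[OF tf b] Y(1)]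
        lie_deriv_pairing[OF b flat_cosection[OF tf a] Y(1)] inverse_bivector_flat[OF tf \<pi>])
  moreover have "(\<lambda>y. \<omega> y (b y) (a y)) = (\<lambda>y. - \<omega> y (a y) (b y))"
    using two_form_skew[OF tf fb fa] by simp
  moreover have "\<omega> x (b x) (bracket A a Y x) = - \<omega> x (bracket A a Y x) (b x)"
    "\<omega> x (a x) (bracket A b Y x) = - \<omega> x (bracket A b Y x) (a x)"
    by (intro two_form_skew[OF tf] fa fb sectionD bracket_section a b Y(1))+
  ultimately show ?thesis
    unfolding Y(2)[symmetric]
    using symplectic_closed[OF \<omega> a b Y(1), of x] anchor_minus[OF fY smooth_two_form[OF tf a b]]
    by (simp add: d_two_form_def)
qed

text \<open>The same computation with deformed anchor and bracket. The differential stays, since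
  closedness of \<omega> for the deformed structure is not among the hypotheses.\<close>

lemma bivector_bracket_deformed_flat:
  assumes \<omega>: "symplectic A \<omega>" and \<pi>: "inverse_bivector A \<omega> \<pi>" and N: "endomorphism A N"
    and a: "a \<in> sections A" and b: "b \<in> sections A" and Y: "Y \<in> sections A"
  shows "bivector_bracket (deformed A N) \<pi> (\<lambda>y. flat A \<omega> y (a y)) (\<lambda>y. flat A \<omega> y (b y)) x (Y x)
    = d_two_form (deformed A N) \<omega> a b Y x + \<omega> x (deformed_bracket A N a b x) (Y x)"
proof -
  note tf = symplectic_two_form[OF \<omega>]
  note fa = sectionD[OF a] and fb = sectionD[OF b] and fY = sectionD[OF Y]
  have db: "deformed_bracket A N X Z x \<in> fibre A x" if "X \<in> sections A" "Z \<in> sections A" for X Z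
    unfolding deformed_bracket_def
    by (intro fibre_intros endomorphism_fibre[OF N] sectionD[of "bracket A _ _"] bracket_section
        endomorphism_section[OF N] that)
  have "bivector_bracket (deformed A N) \<pi> (\<lambda>y. flat A \<omega> y (a y)) (\<lambda>y. flat A \<omega> y (b y)) x (Y x)
    = anchor A x (N x (a x)) (\<lambda>y. \<omega> y (b y) (Y y)) - \<omega> x (b x) (deformed_bracket A N a Y x)
    - (anchor A x (N x (b x)) (\<lambda>y. \<omega> y (a y) (Y y)) - \<omega> x (a x) (deformed_bracket A N b Y x))
    - anchor A x (N x (Y x)) (\<lambda>y. \<omega> y (b y) (a y))"
    using db[OF a Y] db[OF b Y]
    by (simp add: bivector_bracket_def deformed_simps sharp_flat[OF \<pi>] fa fb fY flat_apply d_fun_def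
        restr_def lie_deriv_deformed_pairing[OF N a flat_cosection[OF tf b] Y]
        lie_deriv_deformed_pairing[OF N b flat_cosection[OF tf a] Y] inverse_bivector_flat[OF tf \<pi>])
  moreover have "(\<lambda>y. \<omega> y (b y) (a y)) = (\<lambda>y. - \<omega> y (a y) (b y))"
    using two_form_skew[OF tf fb fa] by simp
  moreover have "\<omega> x (b x) (deformed_bracket A N a Y x) = - \<omega> x (deformed_bracket A N a Y x) (b x)"
    "\<omega> x (a x) (deformed_bracket A N b Y x) = - \<omega> x (deformed_bracket A N b Y x) (a x)"
    by (intro two_form_skew[OF tf] fa fb db a b Y)+
  ultimately show ?thesis
    using anchor_minus[OF endomorphism_fibre[OF N fY] smooth_two_form[OF tf a b]]
    by (simp add: d_two_form_def deformed_simps)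
qed

text \<open>By \<open>sym\<close> the transpose of \<open>N\<close> acts on flats as
  \<open>N\<close> acts on sections. All brackets of cosections then become flats of brackets of
  sections and cancel, leaving the differential of \<omega> for the deformed structure.\<close>

lemma concomitant_eq_0:
  assumes \<omega>: "symplectic A \<omega>" and \<pi>: "inverse_bivector A \<omega> \<pi>" and N: "endomorphism A N"
    and sym: "\<And>x u v. u \<in> fibre A x \<Longrightarrow> v \<in> fibre A x \<Longrightarrow> \<omega> x u (N x v) = \<omega> x (N x u) v"
    and closed: "\<And>X Y Z x. X \<in> sections A \<Longrightarrow> Y \<in> sections A \<Longrightarrow> Z \<in> sections A \<Longrightarrow>
      d_two_form A (\<lambda>x u. \<omega> x (N x u)) X Y Z x = 0"
    and \<alpha>: "\<alpha> \<in> cosections A" and \<beta>: "\<beta> \<in> cosections A" and v: "v \<in> fibre A x"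
  shows "concomitant A \<pi> N \<alpha> \<beta> x v = 0"
proof -
  note tf = symplectic_two_form[OF \<omega>]
  obtain a where a: "a \<in> sections A" and \<alpha>_eq: "\<alpha> = (\<lambda>x. flat A \<omega> x (a x))"
    by (rule cosection_eq_flat[OF tf \<pi> \<alpha>])
  obtain b where b: "b \<in> sections A" and \<beta>_eq: "\<beta> = (\<lambda>x. flat A \<omega> x (b x))"
    by (rule cosection_eq_flat[OF tf \<pi> \<beta>])
  obtain Y where Y: "Y \<in> sections A" "Y x = v" by (rule ex_section_through[OF v])
  note Na = endomorphism_section[OF N a] and Nb = endomorphism_section[OF N b]
    and NY = endomorphism_section[OF N Y(1)]
  have tr: "transpose_endo A N y (flat A \<omega> y (X y)) = flat A \<omega> y (N y (X y))" if "X \<in> sections A" for X y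
    using sym sectionD[OF that] endomorphism_fibre[OF N]
    by (auto simp: fun_eq_iff transpose_endo_def flat_def restr_def)
  \<comment> \<open>Every term of the formula is a value of d\<omega> or of the differential of
    \<omega>(Nu, v), and both forms are closed.\<close>
  have "d_two_form (deformed A N) \<omega> a b Y x = 0"
    using d_two_form_deformed[of \<omega> N, OF tf N sym a b Y(1)] closed[OF a b Y(1)] symplectic_closed[OF \<omega>]
      a b Y(1) Na Nb NY by simp
  moreover have f: "bracket A a b x \<in> fibre A x" "bracket A (\<lambda>y. N y (a y)) b x \<in> fibre A x"
    "bracket A a (\<lambda>y. N y (b y)) x \<in> fibre A x" "N x (bracket A a b x) \<in> fibre A x"
    "N x v \<in> fibre A x"
    by (intro sectionD[of "bracket A _ _"] bracket_section endomorphism_fibre[OF N] a b Na Nb v)+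
  ultimately show ?thesis
    using v
    by (simp add: concomitant_def \<alpha>_eq \<beta>_eq tr a b transpose_apply
        bivector_bracket_deformed_flat[OF \<omega> \<pi> N a b Y(1), of x, unfolded Y(2)]
        bivector_bracket_flat[OF \<omega> \<pi>] Na Nb deformed_bracket_def sym
        linear_on_diff[OF two_form_linear_left[OF tf]]
        linear_on_add[OF two_form_linear_left[OF tf]] fibre_add)
qed

section \<open>The Schouten bracket of an inverse bivector\<close>

lemma bracket_scaleR_scaleR:
  assumes X: "X \<in> sections A" and Y: "Y \<in> sections A" and f: "smooth f" and g: "smooth g"
  shows "bracket A (\<lambda>y. f y *\<^sub>R X y) (\<lambda>y. g y *\<^sub>R Y y) x = (f x * g x) *\<^sub>R bracket A X Y x
    + (f x * anchor A x (X x) g) *\<^sub>R Y x - (g x * anchor A x (Y x) f) *\<^sub>R X x"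
  using bracket_Leibniz[OF sections_scaleR[OF f X] Y g, of x] bracket_Leibniz_left[OF X Y f, of x]
    linear_on_scaleR[OF anchor_linear_on[OF g] sectionD[OF X], of x "f x"]
  by (simp add: scaleR_diff_right mult.commute)

text \<open>The anchor terms are regrouped so that the differentiating vectors are the values at
  \<open>x\<close> of the two whole sums, which makes them independent of how the sections were
  expanded.\<close>

lemma bracket_sum_scaleR:
  assumes X: "\<And>k. k \<in> I \<Longrightarrow> X k \<in> sections A" and Y: "\<And>l. l \<in> J \<Longrightarrow> Y l \<in> sections A"
    and f: "\<And>k. k \<in> I \<Longrightarrow> smooth (f k)" and g: "\<And>l. l \<in> J \<Longrightarrow> smooth (g l)"
    and \<alpha>: "\<alpha> \<in> dual_fibre A x"
  shows "\<alpha> (bracket A (\<lambda>y. \<Sum>k\<in>I. f k y *\<^sub>R X k y) (\<lambda>y. \<Sum>l\<in>J. g l y *\<^sub>R Y l y) x)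
    = (\<Sum>k\<in>I. \<Sum>l\<in>J. f k x * g l x * \<alpha> (bracket A (X k) (Y l) x))
    + (\<Sum>l\<in>J. anchor A x (\<Sum>k\<in>I. f k x *\<^sub>R X k x) (g l) * \<alpha> (Y l x))
    - (\<Sum>k\<in>I. anchor A x (\<Sum>l\<in>J. g l x *\<^sub>R Y l x) (f k) * \<alpha> (X k x))"
proof -
  note lin = dual_fibre_linear[OF \<alpha>]
  have 1: "bracket A (\<lambda>y. \<Sum>k\<in>I. f k y *\<^sub>R X k y) (\<lambda>y. \<Sum>l\<in>J. g l y *\<^sub>R Y l y) x
    = (\<Sum>k\<in>I. \<Sum>l\<in>J. bracket A (\<lambda>y. f k y *\<^sub>R X k y) (\<lambda>y. g l y *\<^sub>R Y l y) x)"
    using X Y f g by (simp add: bracket_sum_left bracket_sum_right sections_scaleR sections_sum)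
  have fib: "bracket A (\<lambda>y. f k y *\<^sub>R X k y) (\<lambda>y. g l y *\<^sub>R Y l y) x \<in> fibre A x"
    if "k \<in> I" "l \<in> J" for k l
    using that X Y f g by (intro sectionD[of "bracket A _ _"] bracket_section sections_scaleR) auto
  have "\<alpha> (bracket A (\<lambda>y. \<Sum>k\<in>I. f k y *\<^sub>R X k y) (\<lambda>y. \<Sum>l\<in>J. g l y *\<^sub>R Y l y) x)
    = (\<Sum>k\<in>I. \<Sum>l\<in>J. \<alpha> (bracket A (\<lambda>y. f k y *\<^sub>R X k y) (\<lambda>y. g l y *\<^sub>R Y l y) x))"
    unfolding 1 using fib by (simp add: linear_on_sum_vectors[OF fibre_subspace lin] fibre_sum)
  also have "\<dots> = (\<Sum>k\<in>I. \<Sum>l\<in>J. f k x * g l x * \<alpha> (bracket A (X k) (Y l) x)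
    + f k x * anchor A x (X k x) (g l) * \<alpha> (Y l x) - g l x * anchor A x (Y l x) (f k) * \<alpha> (X k x))"
  proof (intro sum.cong refl)
    fix k l assume "k \<in> I" "l \<in> J"
    then have kl: "X k \<in> sections A" "Y l \<in> sections A" "smooth (f k)" "smooth (g l)"
      using X Y f g by auto
    then have "bracket A (X k) (Y l) x \<in> fibre A x" "X k x \<in> fibre A x" "Y l x \<in> fibre A x"
      by (auto intro: sectionD[of "bracket A _ _"] bracket_section sectionD)
    then show "\<alpha> (bracket A (\<lambda>y. f k y *\<^sub>R X k y) (\<lambda>y. g l y *\<^sub>R Y l y) x)
      = f k x * g l x * \<alpha> (bracket A (X k) (Y l) x)
      + f k x * anchor A x (X k x) (g l) * \<alpha> (Y l x) - g l x * anchor A x (Y l x) (f k) * \<alpha> (X k x)"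
      by (simp add: bracket_scaleR_scaleR[OF kl] linear_on_diff[OF lin] linear_on_add[OF lin]
          linear_on_scaleR[OF lin] fibre_intros)
  qed
  also have "\<dots> = (\<Sum>k\<in>I. \<Sum>l\<in>J. f k x * g l x * \<alpha> (bracket A (X k) (Y l) x))
    + (\<Sum>l\<in>J. \<Sum>k\<in>I. f k x * anchor A x (X k x) (g l) * \<alpha> (Y l x))
    - (\<Sum>k\<in>I. \<Sum>l\<in>J. g l x * anchor A x (Y l x) (f k) * \<alpha> (X k x))"
    by (subst sum.swap[of _ I J]) (simp add: sum.distrib sum_subtractf)
  also have "(\<Sum>l\<in>J. \<Sum>k\<in>I. f k x * anchor A x (X k x) (g l) * \<alpha> (Y l x))
    = (\<Sum>l\<in>J. anchor A x (\<Sum>k\<in>I. f k x *\<^sub>R X k x) (g l) * \<alpha> (Y l x))"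
    using linear_on_sum[OF fibre_subspace anchor_linear_on[OF g], where I = I] X sectionD
    by (intro sum.cong refl) (simp add: sum_distrib_right)
  also have "(\<Sum>k\<in>I. \<Sum>l\<in>J. g l x * anchor A x (Y l x) (f k) * \<alpha> (X k x))
    = (\<Sum>k\<in>I. anchor A x (\<Sum>l\<in>J. g l x *\<^sub>R Y l x) (f k) * \<alpha> (X k x))"
    using linear_on_sum[OF fibre_subspace anchor_linear_on[OF f], where I = J] Y sectionD
    by (intro sum.cong refl) (simp add: sum_distrib_right)
  finally show ?thesis .
qed

text \<open>Writing a bivector \<open>\<Sum>\<^sub>i X\<^sub>i \<and> Y\<^sub>i\<close> as \<open>\<Sum>\<^sub>k P\<^sub>k \<otimes> Q\<^sub>k\<close> over twice as many indices, the pairs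
  being \<open>(X\<^sub>i, Y\<^sub>i)\<close> and \<open>(Y\<^sub>i, -X\<^sub>i)\<close>, turns the four terms of the Schouten bracket into one.\<close>

definition doubled_fst :: "(nat \<Rightarrow> 'm \<Rightarrow> 'v) \<Rightarrow> (nat \<Rightarrow> 'm \<Rightarrow> 'v) \<Rightarrow> nat \<times> bool \<Rightarrow> 'm \<Rightarrow> 'v" where
  "doubled_fst X Y k = (if snd k then X (fst k) else Y (fst k))"

definition doubled_snd :: "(nat \<Rightarrow> 'm \<Rightarrow> 'v) \<Rightarrow> (nat \<Rightarrow> 'm \<Rightarrow> 'v) \<Rightarrow> nat \<times> bool \<Rightarrow> 'm \<Rightarrow> 'v" where
  "doubled_snd X Y k = (if snd k then Y (fst k) else (\<lambda>y. - X (fst k) y))"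

lemma sum_doubled:
  fixes F :: "nat \<times> bool \<Rightarrow> real"
  shows "(\<Sum>k\<in>{..<m} \<times> UNIV. F k) = (\<Sum>i<m. F (i, True) + F (i, False))"
  by (simp add: sum.cartesian_product[symmetric, of "\<lambda>i b. F (i, b)", simplified] UNIV_bool add.commute)

lemma doubled_sections:
  assumes "\<And>i. i < m \<Longrightarrow> X i \<in> sections A" "\<And>i. i < m \<Longrightarrow> Y i \<in> sections A" "k \<in> {..<m} \<times> UNIV"
  shows "doubled_fst X Y k \<in> sections A" "doubled_snd X Y k \<in> sections A"
  using assms by (auto simp: doubled_fst_def doubled_snd_def intro: sections_minus)

text \<open>Two unrelated families decompose the same \<pi>, because the description in
  \<open>schouten\<close> ranges over all such pairs. Contracting a family with a flat recovers the
  underlying section up to sign, so the sum can be expressed through brackets of the three sections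
  behind the covectors.\<close>

lemma schouten_decomposition_eq_0:
  fixes X\<^sub>1 X\<^sub>2 Y\<^sub>1 Y\<^sub>2 :: "nat \<Rightarrow> 'm \<Rightarrow> 'v"
  assumes \<omega>: "symplectic A \<omega>" and \<pi>: "inverse_bivector A \<omega> \<pi>"
    and U: "open U" "x \<in> U"
    and X: "\<And>i. i < m \<Longrightarrow> X\<^sub>1 i \<in> sections A" "\<And>i. i < m \<Longrightarrow> X\<^sub>2 i \<in> sections A"
    and Y: "\<And>j. j < n \<Longrightarrow> Y\<^sub>1 j \<in> sections A" "\<And>j. j < n \<Longrightarrow> Y\<^sub>2 j \<in> sections A"
    and dX: "\<And>y \<mu> \<nu>. y \<in> U \<Longrightarrow> \<mu> \<in> dual_fibre A y \<Longrightarrow> \<nu> \<in> dual_fibre A y \<Longrightarrow>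
      \<pi> y \<mu> \<nu> = (\<Sum>i<m. wedge2 (X\<^sub>1 i y) (X\<^sub>2 i y) \<mu> \<nu>)"
    and dY: "\<And>y \<mu> \<nu>. y \<in> U \<Longrightarrow> \<mu> \<in> dual_fibre A y \<Longrightarrow> \<nu> \<in> dual_fibre A y \<Longrightarrow>
      \<pi> y \<mu> \<nu> = (\<Sum>j<n. wedge2 (Y\<^sub>1 j y) (Y\<^sub>2 j y) \<mu> \<nu>)"
    and \<alpha>: "\<alpha> \<in> dual_fibre A x" and \<beta>: "\<beta> \<in> dual_fibre A x" and \<gamma>: "\<gamma> \<in> dual_fibre A x"
  shows "(\<Sum>i<m. \<Sum>j<n.
            wedge3 (bracket A (X\<^sub>1 i) (Y\<^sub>1 j) x) (X\<^sub>2 i x) (Y\<^sub>2 j x) \<alpha> \<beta> \<gamma>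
          - wedge3 (bracket A (X\<^sub>1 i) (Y\<^sub>2 j) x) (X\<^sub>2 i x) (Y\<^sub>1 j x) \<alpha> \<beta> \<gamma>
          - wedge3 (bracket A (X\<^sub>2 i) (Y\<^sub>1 j) x) (X\<^sub>1 i x) (Y\<^sub>2 j x) \<alpha> \<beta> \<gamma>
          + wedge3 (bracket A (X\<^sub>2 i) (Y\<^sub>2 j) x) (X\<^sub>1 i x) (Y\<^sub>1 j x) \<alpha> \<beta> \<gamma>) = 0"
    (is "?t = 0")
proof -
  note tf = symplectic_two_form[OF \<omega>]
  define I J where "I = {..<m} \<times> (UNIV :: bool set)" and "J = {..<n} \<times> (UNIV :: bool set)"
  define P Q where "P = doubled_fst X\<^sub>1 X\<^sub>2" and "Q = doubled_snd X\<^sub>1 X\<^sub>2"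
  define R S where "R = doubled_fst Y\<^sub>1 Y\<^sub>2" and "S = doubled_snd Y\<^sub>1 Y\<^sub>2"
  have P: "P k \<in> sections A" and Q: "Q k \<in> sections A" if "k \<in> I" for k
    using doubled_sections[OF X that[unfolded I_def]] by (simp_all add: P_def Q_def)
  have R: "R l \<in> sections A" and S: "S l \<in> sections A" if "l \<in> J" for l
    using doubled_sections[OF Y that[unfolded J_def]] by (simp_all add: R_def S_def)
  have minus: "\<mu> (- v) = - \<mu> v" if "\<mu> \<in> dual_fibre A y" "v \<in> fibre A y" for \<mu> v y
    using linear_on_minus[OF dual_fibre_linear[OF that(1)] that(2)] .

  \<comment> \<open>Doubling absorbs the minus sign of the wedge into \<open>Q\<close>, so \<pi> is
    a plain sum of tensor products.\<close>
  have \<pi>PQ: "\<pi> y \<mu> \<nu> = (\<Sum>k\<in>I. \<mu> (P k y) * \<nu> (Q k y))"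
    if "y \<in> U" "\<mu> \<in> dual_fibre A y" "\<nu> \<in> dual_fibre A y" for y \<mu> \<nu>
    using X that unfolding dX[OF that] I_def J_def sum_doubled
    by (intro sum.cong) (auto simp: P_def Q_def doubled_fst_def doubled_snd_def wedge2_def
        minus sectionD)
  have \<pi>RS: "\<pi> y \<mu> \<nu> = (\<Sum>l\<in>J. \<mu> (R l y) * \<nu> (S l y))"
    if "y \<in> U" "\<mu> \<in> dual_fibre A y" "\<nu> \<in> dual_fibre A y" for y \<mu> \<nu>
    using Y that unfolding dY[OF that] I_def J_def sum_doubled
    by (intro sum.cong) (auto simp: R_def S_def doubled_fst_def doubled_snd_def wedge2_def
        minus sectionD)

  \<comment> \<open>\<open>wedge3\<close> is a determinant, so the Schouten sum is the alternation
    of \<open>T\<close> over the six orders of the covectors.\<close>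
  define T where "T \<mu> \<nu> \<kappa> = (\<Sum>k\<in>I. \<Sum>l\<in>J. \<mu> (bracket A (P k) (R l) x) * \<nu> (Q k x) * \<kappa> (S l x))"
    for \<mu> \<nu> \<kappa> :: "'v \<Rightarrow> real"
  have "?t = (\<Sum>k\<in>I. \<Sum>l\<in>J. wedge3 (bracket A (P k) (R l) x) (Q k x) (S l x) \<alpha> \<beta> \<gamma>)"
    unfolding I_def J_def sum_doubled
    using X Y
    by (intro sum.cong, simp, unfold sum.distrib[symmetric], intro sum.cong)
      (auto simp: P_def Q_def R_def S_def doubled_fst_def doubled_snd_def wedge3_def wedge2_def
        minus[OF \<alpha>] minus[OF \<beta>] minus[OF \<gamma>] sectionD algebra_simps)
  also have "\<dots> = T \<alpha> \<beta> \<gamma> - T \<alpha> \<gamma> \<beta> - T \<beta> \<alpha> \<gamma> + T \<gamma> \<alpha> \<beta> + T \<beta> \<gamma> \<alpha> - T \<gamma> \<beta> \<alpha>"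
    unfolding T_def sum.distrib[symmetric] sum_subtractf[symmetric]
    by (intro sum.cong refl) (simp add: wedge3_def wedge2_def algebra_simps)
  finally have t: "?t = \<dots>" .

  \<comment> \<open>\<open>G\<close> and \<open>H\<close> collect the derivative terms of the
    Leibniz rule. Each depends on its decomposition, but its skew part in \<mu> and \<nu> is the
    derivative of \<pi>(\<mu>, \<nu>).\<close>
  define G where "G Z \<mu> \<nu> = (\<Sum>k\<in>I. anchor A x Z (\<lambda>y. \<nu> y (Q k y)) * \<mu> x (P k x))"
    for Z and \<mu> \<nu> :: "'m \<Rightarrow> 'v \<Rightarrow> real"
  define H where "H Z \<mu> \<nu> = (\<Sum>l\<in>J. anchor A x Z (\<lambda>y. \<nu> y (S l y)) * \<mu> x (R l x))"
    for Z and \<mu> \<nu> :: "'m \<Rightarrow> 'v \<Rightarrow> real"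

  have anchor_minus': "anchor A x Z (\<lambda>y. \<mu> y (- V y)) = - anchor A x Z (\<lambda>y. \<mu> y (V y))"
    if "Z \<in> fibre A x" "\<mu> \<in> cosections A" "V \<in> sections A" for Z \<mu> V
    using anchor_minus[OF that(1) smooth_pairing[OF that(2,3)]]
      minus[OF cosectionD[OF that(2)] sectionD[OF that(3)]] by simp
  have G: "G Z \<mu> \<nu> - G Z \<nu> \<mu> = anchor A x Z (\<lambda>y. \<pi> y (\<mu> y) (\<nu> y))"
    if Z: "Z \<in> fibre A x" and \<mu>: "\<mu> \<in> cosections A" and \<nu>: "\<nu> \<in> cosections A" for Z \<mu> \<nu>
  proof -
    have sm: "smooth (\<lambda>y. \<mu> y (P k y) * \<nu> y (Q k y))" if "k \<in> I" for k
      by (rule smooth_map_on_mult[OF open_UNIV smooth_pairing[OF \<mu> P[OF that]]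
            smooth_pairing[OF \<nu> Q[OF that]]])
    have "anchor A x Z (\<lambda>y. \<pi> y (\<mu> y) (\<nu> y)) = anchor A x Z (\<lambda>y. \<Sum>k\<in>I. \<mu> y (P k y) * \<nu> y (Q k y))"
      by (rule anchor_cong_local[OF Z smooth_bivector[OF inverse_bivector_bivector[OF \<pi>] \<mu> \<nu>]
            smooth_map_on_sum[OF open_UNIV sm] U \<pi>PQ[OF _ cosectionD[OF \<mu>] cosectionD[OF \<nu>]]])
    also have "\<dots> = (\<Sum>k\<in>I. anchor A x Z (\<lambda>y. \<mu> y (P k y) * \<nu> y (Q k y)))"
      by (rule anchor_sum[OF Z sm])
    also have "\<dots> = (\<Sum>k\<in>I. anchor A x Z (\<lambda>y. \<nu> y (Q k y)) * \<mu> x (P k x)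
        + anchor A x Z (\<lambda>y. \<mu> y (P k y)) * \<nu> x (Q k x))"
      by (intro sum.cong refl)
        (simp add: anchor_mult[OF Z smooth_pairing[OF \<mu> P] smooth_pairing[OF \<nu> Q]] mult.commute)
    also have "\<dots> = G Z \<mu> \<nu> + (\<Sum>k\<in>I. anchor A x Z (\<lambda>y. \<mu> y (P k y)) * \<nu> x (Q k x))"
      by (simp add: G_def sum.distrib)
    \<comment> \<open>Exchanging \<open>P\<close> and \<open>Q\<close> reverses the sign of a
      doubled sum, since it swaps the indices (i, True) and (i, False) up to sign.\<close>
    also have "(\<Sum>k\<in>I. anchor A x Z (\<lambda>y. \<mu> y (P k y)) * \<nu> x (Q k x)) = - G Z \<nu> \<mu>"
      unfolding G_def I_def J_def sum_doubled sum_negf[symmetric]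
      using X by (intro sum.cong) (auto simp: P_def Q_def doubled_fst_def doubled_snd_def
        anchor_minus'[OF Z \<mu>] minus[OF cosectionD[OF \<nu>]] sectionD)
    finally show ?thesis by simp
  qed
  have H: "H Z \<mu> \<nu> - H Z \<nu> \<mu> = anchor A x Z (\<lambda>y. \<pi> y (\<mu> y) (\<nu> y))"
    if Z: "Z \<in> fibre A x" and \<mu>: "\<mu> \<in> cosections A" and \<nu>: "\<nu> \<in> cosections A" for Z \<mu> \<nu>
  proof -
    have sm: "smooth (\<lambda>y. \<mu> y (R l y) * \<nu> y (S l y))" if "l \<in> J" for l
      by (rule smooth_map_on_mult[OF open_UNIV smooth_pairing[OF \<mu> R[OF that]]
            smooth_pairing[OF \<nu> S[OF that]]])
    have "anchor A x Z (\<lambda>y. \<pi> y (\<mu> y) (\<nu> y)) = anchor A x Z (\<lambda>y. \<Sum>l\<in>J. \<mu> y (R l y) * \<nu> y (S l y))"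
      by (rule anchor_cong_local[OF Z smooth_bivector[OF inverse_bivector_bivector[OF \<pi>] \<mu> \<nu>]
            smooth_map_on_sum[OF open_UNIV sm] U \<pi>RS[OF _ cosectionD[OF \<mu>] cosectionD[OF \<nu>]]])
    also have "\<dots> = (\<Sum>l\<in>J. anchor A x Z (\<lambda>y. \<mu> y (R l y) * \<nu> y (S l y)))"
      by (rule anchor_sum[OF Z sm])
    also have "\<dots> = (\<Sum>l\<in>J. anchor A x Z (\<lambda>y. \<nu> y (S l y)) * \<mu> x (R l x)
        + anchor A x Z (\<lambda>y. \<mu> y (R l y)) * \<nu> x (S l x))"
      by (intro sum.cong refl)
        (simp add: anchor_mult[OF Z smooth_pairing[OF \<mu> R] smooth_pairing[OF \<nu> S]] mult.commute)
    also have "\<dots> = H Z \<mu> \<nu> + (\<Sum>l\<in>J. anchor A x Z (\<lambda>y. \<mu> y (R l y)) * \<nu> x (S l x))"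
      by (simp add: H_def sum.distrib)
    also have "(\<Sum>l\<in>J. anchor A x Z (\<lambda>y. \<mu> y (R l y)) * \<nu> x (S l x)) = - H Z \<nu> \<mu>"
      unfolding H_def I_def J_def sum_doubled sum_negf[symmetric]
      using Y by (intro sum.cong) (auto simp: R_def S_def doubled_fst_def doubled_snd_def
        anchor_minus'[OF Z \<mu>] minus[OF cosectionD[OF \<nu>]] sectionD)
    finally show ?thesis by simp
  qed

  have T: "T (\<mu> x) (\<nu> x) (\<kappa> x) = \<omega> x (c x) (bracket A a b x) + H (a x) \<mu> \<kappa> - G (b x) \<mu> \<nu>"
    if a: "a \<in> sections A" and b: "b \<in> sections A" and c: "c \<in> sections A"
      and eqs: "\<mu> = (\<lambda>y. flat A \<omega> y (c y))" "\<nu> = (\<lambda>y. flat A \<omega> y (a y))" "\<kappa> = (\<lambda>y. flat A \<omega> y (b y))"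
    for \<mu> \<nu> \<kappa> a b c
  proof -
    have cos: "\<mu> \<in> cosections A" "\<nu> \<in> cosections A" "\<kappa> \<in> cosections A"
      unfolding eqs by (intro flat_cosection[OF tf] a b c)+
    \<comment> \<open>The minus signs come from \<theta>(a) = \<pi>(\<nu>, \<theta>) = -
      \<pi>(\<theta>, \<nu>), where \<pi>(\<theta>, \<nu>) is the sum of the \<theta>(P) \<nu>(Q).
      Near \<open>x\<close> this expands a in the family \<open>P\<close>, and likewise b in
      \<open>R\<close>; their bracket then yields \<open>T\<close> and derivative terms.\<close>
    let ?f = "\<lambda>k y. - \<nu> y (Q k y)" and ?g = "\<lambda>l y. - \<kappa> y (S l y)"
    have sf: "smooth (?f k)" if "k \<in> I" for k
      using smooth_map_on_diff[OF open_UNIV smooth_map_on_const[of _ 0]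
          smooth_pairing[OF cos(2) Q[OF that]]] by simp
    have sg: "smooth (?g l)" if "l \<in> J" for l
      using smooth_map_on_diff[OF open_UNIV smooth_map_on_const[of _ 0]
          smooth_pairing[OF cos(3) S[OF that]]] by simp
    have a_eq: "a y = (\<Sum>k\<in>I. ?f k y *\<^sub>R P k y)" if y: "y \<in> U" for y
    proof (rule fibre_eqI)
      show "a y \<in> fibre A y" by (rule sectionD[OF a])
      show "(\<Sum>k\<in>I. ?f k y *\<^sub>R P k y) \<in> fibre A y" by (intro fibre_sum fibre_scaleR sectionD P)
      fix \<theta> assume \<theta>: "\<theta> \<in> dual_fibre A y"
      have "\<theta> (a y) = - \<pi> y \<theta> (\<nu> y)"
        using sharp_pairing[OF inverse_bivector_bivector[OF \<pi>] cosectionD[OF cos(2)] \<theta>]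
          sharp_flat[OF \<pi> sectionD[OF a]] bivector_skew[OF inverse_bivector_bivector[OF \<pi>] \<theta> cosectionD[OF cos(2)]]
        by (simp add: eqs)
      also have "\<dots> = \<theta> (\<Sum>k\<in>I. ?f k y *\<^sub>R P k y)"
      proof -
        have "\<theta> (\<Sum>k\<in>I. ?f k y *\<^sub>R P k y) = (\<Sum>k\<in>I. ?f k y *\<^sub>R \<theta> (P k y))"
          by (rule linear_on_sum[OF fibre_subspace dual_fibre_linear[OF \<theta>] sectionD[OF P]])
        then show ?thesis
          unfolding \<pi>PQ[OF y \<theta> cosectionD[OF cos(2)]] by (simp add: sum_negf mult.commute)
      qed
      finally show "\<theta> (a y) = \<theta> (\<Sum>k\<in>I. ?f k y *\<^sub>R P k y)" .
    qed
    have b_eq: "b y = (\<Sum>l\<in>J. ?g l y *\<^sub>R R l y)" if y: "y \<in> U" for y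
    proof (rule fibre_eqI)
      show "b y \<in> fibre A y" by (rule sectionD[OF b])
      show "(\<Sum>l\<in>J. ?g l y *\<^sub>R R l y) \<in> fibre A y" by (intro fibre_sum fibre_scaleR sectionD R)
      fix \<theta> assume \<theta>: "\<theta> \<in> dual_fibre A y"
      have "\<theta> (b y) = - \<pi> y \<theta> (\<kappa> y)"
        using sharp_pairing[OF inverse_bivector_bivector[OF \<pi>] cosectionD[OF cos(3)] \<theta>]
          sharp_flat[OF \<pi> sectionD[OF b]] bivector_skew[OF inverse_bivector_bivector[OF \<pi>] \<theta> cosectionD[OF cos(3)]]
        by (simp add: eqs)
      also have "\<dots> = \<theta> (\<Sum>l\<in>J. ?g l y *\<^sub>R R l y)"
      proof -
        have "\<theta> (\<Sum>l\<in>J. ?g l y *\<^sub>R R l y) = (\<Sum>l\<in>J. ?g l y *\<^sub>R \<theta> (R l y))"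
          by (rule linear_on_sum[OF fibre_subspace dual_fibre_linear[OF \<theta>] sectionD[OF R]])
        then show ?thesis
          unfolding \<pi>RS[OF y \<theta> cosectionD[OF cos(3)]] by (simp add: sum_negf mult.commute)
      qed
      finally show "\<theta> (b y) = \<theta> (\<Sum>l\<in>J. ?g l y *\<^sub>R R l y)" .
    qed
    have br: "bracket A a b x
        = bracket A (\<lambda>y. \<Sum>k\<in>I. ?f k y *\<^sub>R P k y) (\<lambda>y. \<Sum>l\<in>J. ?g l y *\<^sub>R R l y) x"
      by (intro bracket_cong[OF a _ b _ U a_eq b_eq] sections_sum sections_scaleR sf sg P R)
    have "\<omega> x (c x) (bracket A a b x) = \<mu> x (bracket A a b x)"
      using flat_apply[OF sectionD[OF bracket_section[OF a b]]] by (simp add: eqs)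
    also have "\<dots> = \<mu> x (bracket A (\<lambda>y. \<Sum>k\<in>I. ?f k y *\<^sub>R P k y) (\<lambda>y. \<Sum>l\<in>J. ?g l y *\<^sub>R R l y) x)"
      using br by (rule arg_cong)
    also have "\<dots> = (\<Sum>k\<in>I. \<Sum>l\<in>J. ?f k x * ?g l x * \<mu> x (bracket A (P k) (R l) x))
      + (\<Sum>l\<in>J. anchor A x (a x) (?g l) * \<mu> x (R l x))
      - (\<Sum>k\<in>I. anchor A x (b x) (?f k) * \<mu> x (P k x))"
      unfolding a_eq[OF U(2)] b_eq[OF U(2)]
      by (rule bracket_sum_scaleR[OF P R sf sg cosectionD[OF cos(1)]])
    also have "(\<Sum>k\<in>I. \<Sum>l\<in>J. ?f k x * ?g l x * \<mu> x (bracket A (P k) (R l) x)) = T (\<mu> x) (\<nu> x) (\<kappa> x)"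
      unfolding T_def by (intro sum.cong refl) simp
    also have "(\<Sum>l\<in>J. anchor A x (a x) (?g l) * \<mu> x (R l x)) = - H (a x) \<mu> \<kappa>"
      unfolding H_def sum_negf[symmetric]
      by (intro sum.cong refl)
        (simp add: anchor_minus[OF sectionD[OF a] smooth_pairing[OF cos(3) S]])
    also have "(\<Sum>k\<in>I. anchor A x (b x) (?f k) * \<mu> x (P k x)) = - G (b x) \<mu> \<nu>"
      unfolding G_def sum_negf[symmetric]
      by (intro sum.cong refl)
        (simp add: anchor_minus[OF sectionD[OF b] smooth_pairing[OF cos(2) Q]])
    finally show ?thesis by simp
  qed

  obtain \<alpha>' where \<alpha>': "\<alpha>' \<in> cosections A" "\<alpha>' x = \<alpha>" by (rule ex_cosection_through[OF \<alpha>])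
  obtain a where a: "a \<in> sections A" "\<alpha>' = (\<lambda>y. flat A \<omega> y (a y))"
    by (rule cosection_eq_flat[OF tf \<pi> \<alpha>'(1)])
  obtain \<beta>' where \<beta>': "\<beta>' \<in> cosections A" "\<beta>' x = \<beta>" by (rule ex_cosection_through[OF \<beta>])
  obtain b where b: "b \<in> sections A" "\<beta>' = (\<lambda>y. flat A \<omega> y (b y))"
    by (rule cosection_eq_flat[OF tf \<pi> \<beta>'(1)])
  obtain \<gamma>' where \<gamma>': "\<gamma>' \<in> cosections A" "\<gamma>' x = \<gamma>" by (rule ex_cosection_through[OF \<gamma>])
  obtain c where c: "c \<in> sections A" "\<gamma>' = (\<lambda>y. flat A \<omega> y (c y))"
    by (rule cosection_eq_flat[OF tf \<pi> \<gamma>'(1)])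
  note fa = sectionD[OF a(1)] and fb = sectionD[OF b(1)] and fc = sectionD[OF c(1)]

  have brk: "\<omega> x (w x) (bracket A u v x) = - \<omega> x (bracket A u v x) (w x)"
    "\<omega> x (w x) (bracket A v u x) = \<omega> x (bracket A u v x) (w x)"
    if "u \<in> sections A" "v \<in> sections A" "w \<in> sections A" for u v w
  proof -
    note s = sectionD[OF bracket_section[OF that(1,2)], of x]
    show 1: "\<omega> x (w x) (bracket A u v x) = - \<omega> x (bracket A u v x) (w x)"
      by (rule two_form_skew[OF tf sectionD[OF that(3)] s])
    show "\<omega> x (w x) (bracket A v u x) = \<omega> x (bracket A u v x) (w x)"
      using 1 bracket_antisym[OF that(2,1), of x]
        linear_on_minus[OF two_form_linear[OF tf sectionD[OF that(3)]] s] by simp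
  qed
  have \<pi>\<omega>: "(\<lambda>y. \<pi> y (flat A \<omega> y (u y)) (flat A \<omega> y (v y))) = (\<lambda>y. \<omega> y (v y) (u y))"
    if "u \<in> sections A" "v \<in> sections A" for u v
    using inverse_bivector_flat[OF tf \<pi> sectionD[OF that(1)] sectionD[OF that(2)]] by simp
  have sk: "anchor A x Z (\<lambda>y. \<omega> y (v y) (u y)) = - anchor A x Z (\<lambda>y. \<omega> y (u y) (v y))"
    if "Z \<in> fibre A x" "u \<in> sections A" "v \<in> sections A" for Z u v
    using anchor_minus[OF that(1) smooth_two_form[OF tf that(2,3)]]
      two_form_skew[OF tf sectionD[OF that(3)] sectionD[OF that(2)]] by simp
  \<comment> \<open>After alternation \<open>G\<close> and \<open>H\<close> occur only through their
    skew parts, which no longer see the decompositions.\<close>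
  have "T \<alpha> \<beta> \<gamma> - T \<alpha> \<gamma> \<beta> - T \<beta> \<alpha> \<gamma> + T \<gamma> \<alpha> \<beta> + T \<beta> \<gamma> \<alpha> - T \<gamma> \<beta> \<alpha>
    = - 2 * \<omega> x (bracket A b c x) (a x) + 2 * \<omega> x (bracket A a c x) (b x)
      - 2 * \<omega> x (bracket A a b x) (c x)
      + (H (b x) \<alpha>' \<gamma>' - H (b x) \<gamma>' \<alpha>') - (H (c x) \<alpha>' \<beta>' - H (c x) \<beta>' \<alpha>')
      - (H (a x) \<beta>' \<gamma>' - H (a x) \<gamma>' \<beta>')
      + (G (b x) \<alpha>' \<gamma>' - G (b x) \<gamma>' \<alpha>') - (G (c x) \<alpha>' \<beta>' - G (c x) \<beta>' \<alpha>')
      - (G (a x) \<beta>' \<gamma>' - G (a x) \<gamma>' \<beta>')"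
    using T[OF b(1) c(1) a(1) a(2) b(2) c(2)] T[OF c(1) b(1) a(1) a(2) c(2) b(2)]
      T[OF a(1) c(1) b(1) b(2) a(2) c(2)] T[OF c(1) a(1) b(1) b(2) c(2) a(2)]
      T[OF a(1) b(1) c(1) c(2) a(2) b(2)] T[OF b(1) a(1) c(1) c(2) b(2) a(2)]
      brk[OF b(1) c(1) a(1)] brk[OF a(1) c(1) b(1)] brk[OF a(1) b(1) c(1)]
    by (simp add: \<alpha>'(2) \<beta>'(2) \<gamma>'(2))
  \<comment> \<open>The skew parts of \<open>G\<close> and \<open>H\<close> are the same
    derivatives, which matches the factor 2 on the bracket terms.\<close>
  also have "\<dots> = 2 * d_two_form A \<omega> a b c x"
    using G[OF fb \<alpha>'(1) \<gamma>'(1)] G[OF fc \<alpha>'(1) \<beta>'(1)] G[OF fa \<beta>'(1) \<gamma>'(1)]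
      H[OF fb \<alpha>'(1) \<gamma>'(1)] H[OF fc \<alpha>'(1) \<beta>'(1)] H[OF fa \<beta>'(1) \<gamma>'(1)]
    by (simp add: a(2) b(2) c(2) \<pi>\<omega> a(1) b(1) c(1) d_two_form_def
        sk[OF fb a(1) c(1)] sk[OF fc a(1) b(1)] sk[OF fa b(1) c(1)])
  also have "\<dots> = 0" using symplectic_closed[OF \<omega> a(1) b(1) c(1)] by simp
  finally show ?thesis using t by simp
qed

text \<open>A frame provides one decomposition, so 0 meets the description;
  \<open>schouten_decomposition_eq_0\<close> excludes every other value.\<close>

lemma schouten_eq_0:
  assumes \<omega>: "symplectic A \<omega>" and \<pi>: "inverse_bivector A \<omega> \<pi>"
    and \<alpha>: "\<alpha> \<in> dual_fibre A x" and \<beta>: "\<beta> \<in> dual_fibre A x" and \<gamma>: "\<gamma> \<in> dual_fibre A x"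
  shows "schouten A \<pi> \<pi> x \<alpha> \<beta> \<gamma> = 0"
proof -
  note b = inverse_bivector_bivector[OF \<pi>]
  obtain V n E \<Xi> where V: "open V" "x \<in> V" and E: "\<And>j. E j \<in> sections A"
    and \<Xi>: "\<And>j. \<Xi> j \<in> cosections A"
    and fr: "\<And>y v. y \<in> V \<Longrightarrow> v \<in> fibre A y \<Longrightarrow> v = (\<Sum>j<n::nat. \<Xi> j y v *\<^sub>R E j y)"
    by (rule local_frame[of x]) (rule that)
  \<comment> \<open>The wedges of \<open>E j\<close> with the sharp of \<open>\<Xi> j\<close> add up
    to twice \<pi>, hence the factor 1/2.\<close>
  define F where "F j y = (1 / 2) *\<^sub>R sharp A \<pi> y (\<Xi> j y)" for j y
  have F: "F j \<in> sections A" for j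
    unfolding F_def by (intro sections_const_scaleR sharp_section b \<Xi>)
  have dec: "\<pi> y \<mu> \<nu> = (\<Sum>j<n. wedge2 (E j y) (F j y) \<mu> \<nu>)"
    if y: "y \<in> V" and \<mu>: "\<mu> \<in> dual_fibre A y" and \<nu>: "\<nu> \<in> dual_fibre A y" for y \<mu> \<nu>
  proof -
    have *: "\<pi> y \<mu> \<nu> = 2 * (\<Sum>j<n. \<mu> (E j y) * \<nu> (F j y))"
      if \<mu>: "\<mu> \<in> dual_fibre A y" and \<nu>: "\<nu> \<in> dual_fibre A y" for \<mu> \<nu>
    proof -
      have "\<mu> = (\<lambda>v. \<Sum>j<n. \<mu> (E j y) * \<Xi> j y v)"
        by (rule dual_fibre_eqI[OF \<mu> dual_fibre_sum[OF cosectionD[OF \<Xi>]]])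
          (use dual_frame_expansion[of E y \<Xi> n \<mu>, OF E fr[OF y] \<mu>] in \<open>simp add: mult.commute\<close>)
      then have "\<pi> y \<mu> \<nu> = \<pi> y (\<lambda>v. \<Sum>j<n. \<mu> (E j y) * \<Xi> j y v) \<nu>" by simp
      also have "\<dots> = (\<Sum>j<n. \<mu> (E j y) * \<pi> y (\<Xi> j y) \<nu>)"
        by (rule bivector_sum[OF b cosectionD[OF \<Xi>] \<nu>])
      also have "\<dots> = (\<Sum>j<n. 2 * (\<mu> (E j y) * \<nu> (F j y)))"
        using linear_on_scaleR[OF dual_fibre_linear[OF \<nu>] sharp_fibre[OF b cosectionD[OF \<Xi>]]]
        by (simp add: F_def sharp_pairing[OF b cosectionD[OF \<Xi>] \<nu>])
      finally show ?thesis by (simp add: sum_distrib_left)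
    qed
    show ?thesis
      using *[OF \<mu> \<nu>] *[OF \<nu> \<mu>] bivector_skew[OF b \<mu> \<nu>]
      by (simp add: wedge2_def sum_subtractf mult.commute)
  qed
  show ?thesis
    unfolding schouten_def
  proof (rule the_equality, goal_cases)
    case 1
    have "0 = (\<Sum>i<n. \<Sum>j<n.
            wedge3 (bracket A (E i) (E j) x) (F i x) (F j x) \<alpha> \<beta> \<gamma>
          - wedge3 (bracket A (E i) (F j) x) (F i x) (E j x) \<alpha> \<beta> \<gamma>
          - wedge3 (bracket A (F i) (E j) x) (E i x) (F j x) \<alpha> \<beta> \<gamma>
          + wedge3 (bracket A (F i) (F j) x) (E i x) (E j x) \<alpha> \<beta> \<gamma>)"
      by (rule schouten_decomposition_eq_0[OF \<omega> \<pi> V E F E F dec dec \<alpha> \<beta> \<gamma>, symmetric])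
    then show ?case using V E F dec by (intro exI[of _ V] exI[of _ n] exI[of _ E] exI[of _ F]) blast
  next
    case (2 t)
    then obtain U m n X\<^sub>1 X\<^sub>2 Y\<^sub>1 Y\<^sub>2 where U: "open U" "x \<in> U"
      and X: "\<forall>i<m::nat. X\<^sub>1 i \<in> sections A \<and> X\<^sub>2 i \<in> sections A"
      and Y: "\<forall>j<n::nat. Y\<^sub>1 j \<in> sections A \<and> Y\<^sub>2 j \<in> sections A"
      and d: "\<forall>y\<in>U. \<forall>\<mu>\<in>dual_fibre A y. \<forall>\<nu>\<in>dual_fibre A y.
        \<pi> y \<mu> \<nu> = (\<Sum>i<m. wedge2 (X\<^sub>1 i y) (X\<^sub>2 i y) \<mu> \<nu>) \<and>
        \<pi> y \<mu> \<nu> = (\<Sum>j<n. wedge2 (Y\<^sub>1 j y) (Y\<^sub>2 j y) \<mu> \<nu>)"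
      and t: "t = (\<Sum>i<m. \<Sum>j<n.
            wedge3 (bracket A (X\<^sub>1 i) (Y\<^sub>1 j) x) (X\<^sub>2 i x) (Y\<^sub>2 j x) \<alpha> \<beta> \<gamma>
          - wedge3 (bracket A (X\<^sub>1 i) (Y\<^sub>2 j) x) (X\<^sub>2 i x) (Y\<^sub>1 j x) \<alpha> \<beta> \<gamma>
          - wedge3 (bracket A (X\<^sub>2 i) (Y\<^sub>1 j) x) (X\<^sub>1 i x) (Y\<^sub>2 j x) \<alpha> \<beta> \<gamma>
          + wedge3 (bracket A (X\<^sub>2 i) (Y\<^sub>2 j) x) (X\<^sub>1 i x) (Y\<^sub>1 j x) \<alpha> \<beta> \<gamma>)"
      by (elim exE conjE) (rule that)
    show ?case
      unfolding t
      by (rule schouten_decomposition_eq_0[OF \<omega> \<pi> U _ _ _ _ _ _ \<alpha> \<beta> \<gamma>]) (use X Y d in blast)+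
  qed
qed

end
section \<open>Hypersymplectic structures\<close>

locale Hypersymplectic = Lie_algebroid A
  for A :: "('m::{t2_space, second_countable_topology}, 'e::real_normed_vector,
                'v::real_vector, 'f::real_normed_vector) algebroid" +
  fixes \<epsilon> :: "3 \<Rightarrow> real"
    and \<omega> :: "3 \<Rightarrow> 'm \<Rightarrow> 'v \<Rightarrow> 'v \<Rightarrow> real"
    and \<pi> :: "3 \<Rightarrow> 'm \<Rightarrow> ('v \<Rightarrow> real) \<Rightarrow> ('v \<Rightarrow> real) \<Rightarrow> real"
  assumes hypersymplectic: "hypersymplectic A \<epsilon> \<omega> \<pi>"
    and prod_eps: "\<epsilon> 1 * \<epsilon> 2 * \<epsilon> 3 = 1"
begin

abbreviation N :: "3 \<Rightarrow> 'm \<Rightarrow> 'v \<Rightarrow> 'v" where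
  "N \<equiv> transition A \<omega> \<pi>"

lemma three_arith:
  "(3::3) - 1 = 2" "(3::3) + 1 = 1" "(2::3) - 1 = 1" "(1::3) - 1 = 3" "(1::3) + 1 = 2" "(2::3) + 1 = 3"
  by simp_all

lemma index_simps: "i + 1 + 1 = i - 1" "i - 1 - 1 = i + 1" for i :: 3
proof -
  have "(3::3) = 0" by simp
  then show "i + 1 + 1 = i - 1" "i - 1 - 1 = i + 1"
    by (simp_all add: algebra_simps eq_diff_eq diff_eq_eq)
qed

lemma symplectic: "symplectic A (\<omega> i)"
  and inverse: "inverse_bivector A (\<omega> i) (\<pi> i)"
  and N_N: "v \<in> fibre A x \<Longrightarrow> N i x (N i x v) = \<epsilon> i *\<^sub>R v"
  and eps: "\<epsilon> i = 1 \<or> \<epsilon> i = -1"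
  using hypersymplectic unfolding hypersymplectic_def by auto

lemma eps_square: "\<epsilon> i * \<epsilon> i = 1" and eps_nonzero: "\<epsilon> i \<noteq> 0"
  using eps[of i] by auto

text \<open>Cyclic form of the product hypothesis, each sign being its own inverse; every use of
  that hypothesis passes through this relation.\<close>

lemma eps_mult: "\<epsilon> i * \<epsilon> (i + 1) = \<epsilon> (i - 1)"
proof -
  have "\<epsilon> i * \<epsilon> (i + 1) * \<epsilon> (i - 1) = 1"
    using exhaust_3[of i] prod_eps
    by (elim disjE) (simp_all only: three_arith mult.commute mult.left_commute)
  then show ?thesis using eps[of "i - 1"] by auto
qed

lemmas two_form = symplectic_two_form[OF symplectic]
lemmas bivector = inverse_bivector_bivector[OF inverse]

section \<open>Algebra of the transition tensors\<close>

lemma N_fibre: "v \<in> fibre A x \<Longrightarrow> N i x v \<in> fibre A x"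
  unfolding transition_def by (intro sharp_fibre bivector flat_dual_fibre two_form)

lemma omega_N:
  assumes "u \<in> fibre A x" "v \<in> fibre A x"
  shows "\<omega> (i - 1) x (N i x u) v = \<omega> (i + 1) x u v"
  using arg_cong[OF flat_sharp[OF inverse flat_dual_fibre[OF two_form assms(1)]], of "\<lambda>\<xi>. \<xi> v" "i - 1" "i + 1"]
  by (simp add: transition_def flat_apply[OF assms(2)])

text \<open>By \<open>omega_N\<close> and nondegeneracy of \<open>\<omega> (i - 1)\<close>,
  linearity is inherited from \<open>\<omega> (i + 1)\<close>.\<close>

lemma linear_N: "linear_on (fibre A x) (N i x)"
  unfolding linear_on_def
proof (intro ballI allI symplectic_nondegenerate[OF symplectic[of "i - 1"]])
  fix u v w a b assume uvw: "u \<in> fibre A x" "v \<in> fibre A x" "w \<in> fibre A x"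
  then show "\<omega> (i - 1) x (N i x (a *\<^sub>R u + b *\<^sub>R v)) w = \<omega> (i - 1) x (a *\<^sub>R N i x u + b *\<^sub>R N i x v) w"
    using linear_onD[OF two_form_linear_left[OF two_form uvw(3)]]
    by (simp add: omega_N fibre_intros N_fibre)
qed (auto intro!: N_fibre fibre_intros)

lemma endomorphism_N: "endomorphism A (N i)"
proof (rule endomorphismI)
  show "(\<lambda>x. N i x (X x)) \<in> sections A" if "X \<in> sections A" for X
    unfolding transition_def by (intro sharp_section[OF bivector] flat_cosection[OF two_form] that)
qed (auto intro: N_fibre linear_N)

lemma N_section: "X \<in> sections A \<Longrightarrow> (\<lambda>y. N i y (X y)) \<in> sections A"
  by (rule endomorphism_section[OF endomorphism_N])

lemma omega_N_symmetric:
  assumes "u \<in> fibre A x" "v \<in> fibre A x"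
  shows "\<omega> (i - 1) x u (N i x v) = \<omega> (i - 1) x (N i x u) v"
  using omega_N[OF assms, of i] omega_N[OF assms(2,1), of i] two_form_skew[OF two_form assms, of "i + 1"]
    two_form_skew[OF two_form assms(1) N_fibre[OF assms(2)], of "i - 1" i] by simp

lemma omega_N':
  assumes "u \<in> fibre A x" "v \<in> fibre A x"
  shows "\<omega> (i + 1) x (N i x u) v = \<epsilon> i * \<omega> (i - 1) x u v"
  using omega_N[OF N_fibre[OF assms(1)] assms(2), of i i] N_N[OF assms(1)]
    linear_on_scaleR[OF two_form_linear_left[OF two_form assms(2)] assms(1)] by simp

lemma omega_N'_symmetric:
  assumes "u \<in> fibre A x" "v \<in> fibre A x"
  shows "\<omega> (i + 1) x u (N i x v) = \<omega> (i + 1) x (N i x u) v"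
  using omega_N'[OF assms, of i] omega_N'[OF assms(2,1), of i] two_form_skew[OF two_form assms, of "i - 1"]
    two_form_skew[OF two_form assms(1) N_fibre[OF assms(2)], of "i + 1" i] by simp

text \<open>Telescoping: modulo 3 the three factors are \<open>\<pi> (i + 1)\<close> after
  \<open>\<omega> i\<close>, \<open>\<pi> i\<close> after \<open>\<omega> (i - 1)\<close>, and
  \<open>\<pi> (i - 1)\<close> after \<open>\<omega> (i + 1)\<close>, so neighbouring sharps and
  flats cancel without any sign.\<close>

lemma N_cycle:
  assumes "v \<in> fibre A x"
  shows "N (i - 1) x (N (i + 1) x (N i x v)) = v"
  using assms flat_sharp[OF inverse flat_dual_fibre[OF two_form assms]] sharp_flat[OF inverse assms]
  by (simp add: transition_def index_simps)

lemma N_comp: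
  assumes "v \<in> fibre A x"
  shows "N (i + 1) x (N i x v) = \<epsilon> (i - 1) *\<^sub>R N (i - 1) x v"
proof -
  have "N (i - 1) x v = \<epsilon> (i - 1) *\<^sub>R N (i + 1) x (N i x v)"
    using N_N[OF N_fibre[OF N_fibre[OF assms]], of "i - 1" "i + 1" i] N_cycle[OF assms, of i] by simp
  then show ?thesis using eps_square[of "i - 1"] by simp
qed

text \<open>The right side is that of \<open>N_comp\<close>, so the two tensors commute. Squares and
  the cycle alone give the sign \<epsilon>_i \<epsilon>_(i+1) for this order;
  \<open>eps_mult\<close> identifies it with \<epsilon>_(i-1).\<close>

lemma N_comp':
  assumes v: "v \<in> fibre A x"
  shows "N i x (N (i + 1) x v) = \<epsilon> (i - 1) *\<^sub>R N (i - 1) x v"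
proof -
  let ?w = "N i x (N (i + 1) x v)"
  note lin = linear_on_scaleR[OF linear_N]
  have "N (i + 1) x ?w = \<epsilon> (i - 1) *\<^sub>R N (i - 1) x (N (i + 1) x v)"
    by (rule N_comp[OF N_fibre[OF v]])
  also have "N (i - 1) x (N (i + 1) x v) = \<epsilon> i *\<^sub>R N i x v"
    using N_comp[OF v, of "i + 1"] by (simp add: index_simps)
  finally have "N (i + 1) x (N (i + 1) x ?w) = (\<epsilon> (i - 1) * \<epsilon> i) *\<^sub>R N (i + 1) x (N i x v)"
    by (simp add: lin N_fibre fibre_scaleR v)
  then have "\<epsilon> (i + 1) *\<^sub>R ?w = \<epsilon> i *\<^sub>R N (i - 1) x v"
    using eps_square[of "i - 1"] by (simp add: N_N N_fibre v N_comp[OF v] mult.commute mult.left_commute)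
  then have "\<epsilon> (i + 1) *\<^sub>R (\<epsilon> (i + 1) *\<^sub>R ?w) = (\<epsilon> i * \<epsilon> (i + 1)) *\<^sub>R N (i - 1) x v"
    by (simp add: mult.commute)
  then show ?thesis using eps_square[of "i + 1"] by (simp add: eps_mult)
qed

text \<open>Up to sign, the induced tensor: see \<open>induced_tensor_eq\<close>.\<close>

definition sigma :: "3 \<Rightarrow> 'm \<Rightarrow> 'v \<Rightarrow> 'v \<Rightarrow> real" where
  "sigma i x u = \<omega> i x (N i x u)"

text \<open>Self-adjointness of \<open>N i\<close> is immediate for the two forms that it links, but
  not for \<open>\<omega> i\<close>. Up to sign \<open>N i\<close> is the product of the other two
  tensors; each of these is self-adjoint for \<open>\<omega> i\<close>, and commutation restores the
  order after both have been moved across.\<close>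

lemma sigma_symmetric:
  assumes u: "u \<in> fibre A x" and v: "v \<in> fibre A x"
  shows "\<omega> i x u (N i x v) = \<omega> i x (N i x u) v"
proof -
  have 1: "N (i - 1) x (N (i + 1) x w) = \<epsilon> i *\<^sub>R N i x w"
    "N (i + 1) x (N (i - 1) x w) = \<epsilon> i *\<^sub>R N i x w" if "w \<in> fibre A x" for w
    using N_comp[OF that, of "i + 1"] N_comp'[OF that, of "i + 1"] by (simp_all add: index_simps)
  have "\<epsilon> i * \<omega> i x u (N i x v) = \<omega> i x u (N (i - 1) x (N (i + 1) x v))"
    using linear_on_scaleR[OF two_form_linear[OF two_form u] N_fibre[OF v]] by (simp add: 1[OF v])
  also have "\<dots> = \<omega> i x (N (i - 1) x u) (N (i + 1) x v)"
    using omega_N'_symmetric[OF u N_fibre[OF v], of "i - 1"] by simp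
  also have "\<dots> = \<omega> i x (N (i + 1) x (N (i - 1) x u)) v"
    using omega_N_symmetric[OF N_fibre[OF u] v, of "i + 1"] by simp
  also have "\<dots> = \<epsilon> i * \<omega> i x (N i x u) v"
    using linear_on_scaleR[OF two_form_linear_left[OF two_form v] N_fibre[OF u]] by (simp add: 1[OF u])
  finally show ?thesis using eps_nonzero[of i] by simp
qed

lemma sigma_skew:
  assumes "u \<in> fibre A x" "v \<in> fibre A x"
  shows "sigma i x u v = - sigma i x v u"
  using sigma_symmetric[OF assms, of i] two_form_skew[OF two_form assms(1) N_fibre[OF assms(2)], of i i]
  by (simp add: sigma_def)

lemma sigma_linear_left: "v \<in> fibre A x \<Longrightarrow> linear_on (fibre A x) (\<lambda>u. sigma i x u v)"
  using two_form_linear_left[OF two_form, of v x i] linear_N[of x i] N_fibre[of _ x i]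
  by (auto simp: sigma_def linear_on_def)

lemma smooth_sigma: "X \<in> sections A \<Longrightarrow> Y \<in> sections A \<Longrightarrow> smooth (\<lambda>x. sigma i x (X x) (Y x))"
  unfolding sigma_def using smooth_two_form[OF two_form N_section] by blast

lemma sigma_N:
  assumes u: "u \<in> fibre A x" and v: "v \<in> fibre A x"
  shows "sigma i x (N i x u) v = \<epsilon> i * \<omega> i x u v"
    and "sigma i x (N (i + 1) x u) v = \<omega> (i + 1) x u v"
    and "sigma i x (N (i - 1) x u) v = \<epsilon> (i + 1) * \<omega> (i - 1) x u v"
proof -
  note lin = linear_on_scaleR[OF two_form_linear_left[OF two_form v]]
  show "sigma i x (N i x u) v = \<epsilon> i * \<omega> i x u v"
    by (simp add: sigma_def N_N u lin)
  show "sigma i x (N (i + 1) x u) v = \<omega> (i + 1) x u v"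
    using omega_N'[OF u v, of "i - 1"] eps_square[of "i - 1"]
    by (simp add: sigma_def N_comp' u lin N_fibre index_simps)
  show "sigma i x (N (i - 1) x u) v = \<epsilon> (i + 1) * \<omega> (i - 1) x u v"
    using omega_N[OF u v, of "i + 1"] N_comp[OF u, of "i - 1"]
    by (simp add: sigma_def u lin N_fibre index_simps)
qed

text \<open>The factor \<open>c\<close> is one constant over the whole base, which is what pulling
  it out of the differential requires.\<close>

lemma sigma_N_eq_omega:
  obtains c k where "\<And>x u v. u \<in> fibre A x \<Longrightarrow> v \<in> fibre A x \<Longrightarrow>
    sigma i x (N j x u) v = c * \<omega> k x u v"
proof -
  have "j = i \<or> j = i + 1 \<or> j = i - 1"
  proof -
    have "(3::3) = 0" "(2::3) + 1 = 0" by simp_all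
    then show ?thesis using exhaust_3[of i] exhaust_3[of j] by auto
  qed
  then show ?thesis using that sigma_N by (metis mult_1)
qed

lemma sigma_succ:
  assumes "u \<in> fibre A x" "v \<in> fibre A x"
  shows "sigma (i + 1) x u v = \<epsilon> (i + 1) * sigma i x u v"
  using sigma_N(2)[OF N_fibre[OF assms(1)] assms(2), of i "i + 1"] assms
    linear_on_scaleR[OF sigma_linear_left[OF assms(2)] assms(1)]
  by (simp add: sigma_def N_N)

section \<open>Vanishing torsion and closedness of sigma\<close>

lemma torsion_N_eq_0:
  assumes X: "X \<in> sections A" and Y: "Y \<in> sections A"
  shows "torsion A (N i) X Y x = 0"
proof (rule symplectic_nondegenerate[OF symplectic[of "i - 1"]])
  note NX = N_section[OF X, of i] and NY = N_section[OF Y, of i]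
  show "torsion A (N i) X Y x \<in> fibre A x"
    unfolding torsion_def deformed_bracket_def
    by (intro fibre_intros N_fibre sectionD[of "bracket A _ _"] bracket_section X Y NX NY)
  show "0 \<in> fibre A x" by (rule fibre_zero)
  fix w assume w: "w \<in> fibre A x"
  obtain Z where Z: "Z \<in> sections A" "Z x = w" by (rule ex_section_through[OF w])
  have 1: "d_two_form A (\<lambda>x u. \<omega> (i - 1) x (N i x u)) X Y Z x = 0"
    if "X \<in> sections A" "Y \<in> sections A" for X Y
  proof -
    have "d_two_form A (\<lambda>x u. \<omega> (i - 1) x (N i x u)) X Y Z x = 1 * d_two_form A (\<omega> (i + 1)) X Y Z x"
      by (rule d_two_form_scale[OF smooth_two_form[OF two_form] _ that Z(1)]) (simp_all add: omega_N)
    then show ?thesis using symplectic_closed[OF symplectic that Z(1)] by simp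
  qed
  have 2: "d_two_form A (\<lambda>x u. \<omega> (i - 1) x (N i x (N i x u))) X Y Z x = 0"
  proof -
    have "d_two_form A (\<lambda>x u. \<omega> (i - 1) x (N i x (N i x u))) X Y Z x
        = \<epsilon> i * d_two_form A (\<omega> (i - 1)) X Y Z x"
      by (rule d_two_form_scale[OF smooth_two_form[OF two_form] _ X Y Z(1)])
        (simp_all add: N_N linear_on_scaleR[OF two_form_linear_left[OF two_form]])
    then show ?thesis using symplectic_closed[OF symplectic X Y Z(1)] by simp
  qed
  have "\<omega> (i - 1) x (torsion A (N i) X Y x) (Z x) = 0"
    using torsion_pairing[of "\<omega> (i - 1)" "N i", OF two_form_linear_left[OF two_form] endomorphism_N
        omega_N_symmetric X Y Z(1)] 1[OF NX Y] 1[OF X NY] 2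
      symplectic_closed[OF symplectic NX NY Z(1)] by simp
  moreover have "\<omega> (i - 1) x 0 w = 0"
    using linear_on_scaleR[OF two_form_linear_left[OF two_form w] fibre_zero, of "i - 1" 0] by simp
  ultimately show "\<omega> (i - 1) x (torsion A (N i) X Y x) w = \<omega> (i - 1) x 0 w"
    using Z(2) by simp
qed

lemma d_sigma_N:
  assumes X: "X \<in> sections A" and Y: "Y \<in> sections A" and Z: "Z \<in> sections A"
  shows "d_two_form A (sigma i) (\<lambda>y. N j y (X y)) (\<lambda>y. N j y (Y y)) Z x
    = - \<epsilon> j * d_two_form A (sigma i) X Y Z x"
proof -
  note NX = N_section[OF X, of j] and NY = N_section[OF Y, of j]
  obtain c k where ck: "\<And>x u v. u \<in> fibre A x \<Longrightarrow> v \<in> fibre A x \<Longrightarrow>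
    sigma i x (N j x u) v = c * \<omega> k x u v"
    by (rule sigma_N_eq_omega[of i j]) (rule that)
  \<comment> \<open>Self-adjointness of \<open>N j\<close> for \<open>sigma i\<close> follows
    because \<open>sigma i\<close> and its composite with \<open>N j\<close> are both skew, the
    latter as a multiple of a 2-form.\<close>
  have sym: "sigma i x u (N j x v) = sigma i x (N j x u) v"
    if "u \<in> fibre A x" "v \<in> fibre A x" for x u v
    using sigma_skew[OF that(1) N_fibre[OF that(2)], of i j] ck[OF that] ck[OF that(2,1)]
      two_form_skew[OF two_form that, of k] by simp
  have 1: "d_two_form A (\<lambda>x u. sigma i x (N j x u)) X Y Z x = 0"
    if "X \<in> sections A" "Y \<in> sections A" for X Y
  proof -
    have "d_two_form A (\<lambda>x u. sigma i x (N j x u)) X Y Z x = c * d_two_form A (\<omega> k) X Y Z x"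
      by (rule d_two_form_scale[OF smooth_two_form[OF two_form] _ that Z]) (simp_all add: ck)
    then show ?thesis using symplectic_closed[OF symplectic that Z] by simp
  qed
  have "d_two_form A (\<lambda>x u. sigma i x (N j x (N j x u))) X Y Z x = \<epsilon> j * d_two_form A (sigma i) X Y Z x"
    by (rule d_two_form_scale[OF smooth_sigma _ X Y Z])
      (auto simp: N_N linear_on_scaleR[OF sigma_linear_left])
  moreover have "sigma i x (torsion A (N j) X Y x) (Z x) = 0"
    using linear_on_scaleR[OF sigma_linear_left[OF sectionD[OF Z]] fibre_zero, of i x 0]
    by (simp add: torsion_N_eq_0 X Y)
  ultimately show ?thesis
    using torsion_pairing[of "sigma i" "N j", OF sigma_linear_left endomorphism_N sym X Y Z]
      1[OF NX Y] 1[OF X NY] by simp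
qed

text \<open>By \<open>d_sigma_N\<close>, applying the cycle \<open>N\<^sub>i\<^sub>-\<^sub>1 N\<^sub>i\<^sub>+\<^sub>1 N\<^sub>i = Id\<close> to both arguments changes the
  sign of \<open>d \<sigma>\<close>.\<close>

lemma d_sigma_eq_0:
  assumes X: "X \<in> sections A" and Y: "Y \<in> sections A" and Z: "Z \<in> sections A"
  shows "d_two_form A (sigma i) X Y Z x = 0"
proof -
  let ?N = "\<lambda>X y. N (i - 1) y (N (i + 1) y (N i y (X y)))"
  have "d_two_form A (sigma i) (?N X) (?N Y) Z x
    = - \<epsilon> (i - 1) * (- \<epsilon> (i + 1) * (- \<epsilon> i * d_two_form A (sigma i) X Y Z x))"
    by (simp only: d_sigma_N N_section X Y Z)
  also have "\<dots> = - (\<epsilon> (i - 1) * (\<epsilon> i * \<epsilon> (i + 1))) * d_two_form A (sigma i) X Y Z x" by simp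
  also have "\<dots> = - d_two_form A (sigma i) X Y Z x"
    by (simp only: eps_mult eps_square)
  finally show ?thesis using N_cycle[OF sectionD[OF X]] N_cycle[OF sectionD[OF Y]] by simp
qed

section \<open>The Poisson-Nijenhuis conditions\<close>

lemma transpose_flat:
  assumes "u \<in> fibre A x"
  shows "transpose_endo A (N i) x (flat A (\<omega> i) x u) = flat A (\<omega> i) x (N i x u)"
  using sigma_symmetric[OF assms, of _ i] N_fibre[of _ x i]
  by (auto simp: fun_eq_iff transpose_endo_def flat_def restr_def)

lemma N_sharp:
  assumes "\<alpha> \<in> dual_fibre A x"
  shows "N i x (sharp A (\<pi> i) x \<alpha>) = sharp A (\<pi> i) x (transpose_endo A (N i) x \<alpha>)"
  using transpose_flat[OF sharp_fibre[OF bivector assms], of i i] flat_sharp[OF inverse assms]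
    sharp_flat[OF inverse N_fibre[OF sharp_fibre[OF bivector assms]]] by metis

lemma PN_structure_N: "PN_structure A (\<pi> i) (N i)"
  unfolding PN_structure_def
proof (intro conjI ballI allI)
  have closed: "d_two_form A (\<lambda>x u. \<omega> i x (N i x u)) X Y Z x = 0"
    if "X \<in> sections A" "Y \<in> sections A" "Z \<in> sections A" for X Y Z x
    using d_sigma_eq_0[OF that, of i x] by (simp add: sigma_def[abs_def])
  show "concomitant A (\<pi> i) (N i) \<alpha> \<beta> x v = 0"
    if "\<alpha> \<in> cosections A" "\<beta> \<in> cosections A" "v \<in> fibre A x" for \<alpha> \<beta> x v
    by (rule concomitant_eq_0[of "\<omega> i" "\<pi> i" "N i",
          OF symplectic inverse endomorphism_N sigma_symmetric closed that])
qed (rule bivector endomorphism_N schouten_eq_0[OF symplectic inverse] torsion_N_eq_0 N_sharp; assumption)+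

section \<open>The induced tensor and its inverse\<close>

lemma induced_tensor_eq:
  assumes u: "u \<in> fibre A x" and v: "v \<in> fibre A x"
  shows "induced_tensor A \<epsilon> \<omega> \<pi> x u v = \<epsilon> (i - 1) * sigma i x u v"
proof -
  let ?s = "sharp A (\<pi> 1) x (flat A (\<omega> 2) x u)"
  have s: "?s \<in> fibre A x" by (intro sharp_fibre bivector flat_dual_fibre two_form u)
  \<comment> \<open>\<open>N 3\<close> is the sharp of \<open>\<pi> 2\<close> after the flat of
    \<open>\<omega> 1\<close>, hence inverse to the map in the definition of g; since its square is
    \<epsilon>_3, that map is \<open>\<epsilon> 3\<close> times \<open>N 3\<close>.\<close>
  have "N 3 x ?s = u"
    using flat_sharp[OF inverse flat_dual_fibre[OF two_form u]] sharp_flat[OF inverse u]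
    unfolding transition_def three_arith by simp
  then have "?s = \<epsilon> 3 *\<^sub>R N 3 x u"
    using N_N[OF s, of 3] eps_square[of 3] by simp
  then have "induced_tensor A \<epsilon> \<omega> \<pi> x u v = (\<epsilon> 3 * \<epsilon> 3) * \<epsilon> 2 * sigma 3 x u v"
    using linear_on_scaleR[OF two_form_linear_left[OF two_form v] N_fibre[OF u], of 3 "\<epsilon> 3" 3]
    by (simp add: induced_tensor_def sigma_def flat_apply[OF v])
  then have 3: "induced_tensor A \<epsilon> \<omega> \<pi> x u v = \<epsilon> 2 * sigma 3 x u v"
    by (simp only: eps_square mult_1)
  have s1: "sigma 1 x u v = \<epsilon> 1 * sigma 3 x u v" using sigma_succ[OF u v, of 3] by (simp only: three_arith)
  have s3: "sigma 3 x u v = \<epsilon> 3 * sigma 2 x u v" using sigma_succ[OF u v, of 2] by (simp only: three_arith)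
  have e: "\<epsilon> 2 * \<epsilon> 3 = \<epsilon> 1" "\<epsilon> 3 * \<epsilon> 1 = \<epsilon> 2"
    using eps_mult[of 2] eps_mult[of 3] by (simp_all only: three_arith)
  \<comment> \<open>The definition of g singles out the index 3; \<open>sigma_succ\<close> carries
    the formula to the other two indices, and the sign relations turn the prefactor into
    \<epsilon>_(i-1).\<close>
  consider "i = 1" | "i = 2" | "i = 3" using exhaust_3[of i] by blast
  then show ?thesis
  proof cases
    case 1
    then show ?thesis unfolding 1 three_arith using 3 e(2) by (simp add: s1 flip: mult.assoc)
  next
    case 2
    then show ?thesis unfolding 2 three_arith 3 s3 using e(1) by (simp flip: mult.assoc)
  next
    case 3
    then show ?thesis unfolding 3 three_arith using \<open>induced_tensor A \<epsilon> \<omega> \<pi> x u v = \<epsilon> 2 * sigma 3 x u v\<close> by simp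
  qed
qed

text \<open>Inverting \<epsilon>_(i-1) times the flat of \<open>\<omega> i\<close> after
  \<open>N i\<close> gives \<epsilon>_(i-1) \<epsilon>_i times \<open>N i\<close> after the sharp of
  \<open>\<pi> i\<close>, and the two signs multiply to \<epsilon>_(i+1). The index is free, so each
  pair has its own expression for the same inverse.\<close>

lemma inverse_induced_tensor:
  assumes \<alpha>: "\<alpha> \<in> dual_fibre A x"
  shows "inv_into (fibre A x) (flat A (induced_tensor A \<epsilon> \<omega> \<pi>) x) \<alpha>
    = \<epsilon> (i + 1) *\<^sub>R N i x (sharp A (\<pi> i) x \<alpha>)"
proof (rule inv_into_f_eq)
  let ?g = "induced_tensor A \<epsilon> \<omega> \<pi>"
  have s: "sharp A (\<pi> i) x \<alpha> \<in> fibre A x" by (rule sharp_fibre[OF bivector \<alpha>])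
  show z: "\<epsilon> (i + 1) *\<^sub>R N i x (sharp A (\<pi> i) x \<alpha>) \<in> fibre A x"
    by (intro fibre_scaleR N_fibre s)
  show "inj_on (flat A ?g x) (fibre A x)"
  proof (rule inj_onI)
    fix u v assume uv: "u \<in> fibre A x" "v \<in> fibre A x" and eq: "flat A ?g x u = flat A ?g x v"
    have "\<omega> i x (N i x u) w = \<omega> i x (N i x v) w" if w: "w \<in> fibre A x" for w
      using fun_cong[OF eq, of w] eps_nonzero[of "i - 1"]
      by (simp add: flat_apply[OF w] induced_tensor_eq[OF _ w, of _ i] uv sigma_def)
    then have "N i x u = N i x v"
      by (rule symplectic_nondegenerate[OF symplectic N_fibre[OF uv(1)] N_fibre[OF uv(2)]])
    then have "\<epsilon> i *\<^sub>R u = \<epsilon> i *\<^sub>R v" using N_N uv by metis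
    then show "u = v" using eps_nonzero[of i] by simp
  qed
  show "flat A ?g x (\<epsilon> (i + 1) *\<^sub>R N i x (sharp A (\<pi> i) x \<alpha>)) = \<alpha>"
  proof (rule ext)
    fix v
    show "flat A ?g x (\<epsilon> (i + 1) *\<^sub>R N i x (sharp A (\<pi> i) x \<alpha>)) v = \<alpha> v"
    proof (cases "v \<in> fibre A x")
      case True
      have "\<omega> i x (sharp A (\<pi> i) x \<alpha>) v = \<alpha> v"
        using flat_sharp[OF inverse \<alpha>] flat_apply[OF True] by metis
      moreover have "\<epsilon> (i - 1) * (\<epsilon> (i + 1) * (\<epsilon> i * c)) = c" for c
        using eps_mult[of i] eps_square[of "i - 1"] by (metis mult.assoc mult.commute mult_1)
      ultimately show ?thesis
        by (simp add: flat_apply[OF True] induced_tensor_eq[OF z True, of i]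
            linear_on_scaleR[OF sigma_linear_left[OF True]] N_fibre s sigma_N(1)[OF s True])
    next
      case False
      then show ?thesis using dual_fibre_outside[OF \<alpha>] by (simp add: flat_def restr_def)
    qed
  qed
qed

text \<open>Self-adjointness of \<open>N i\<close> makes the two terms of \<open>insert_endo\<close>
  equal after the subtraction, whence the factor 2; one of them is the inverse of g up to the sign
  in \<open>inverse_induced_tensor\<close>.\<close>

lemma insert_transpose_N:
  assumes \<alpha>: "\<alpha> \<in> dual_fibre A x" and \<beta>: "\<beta> \<in> dual_fibre A x"
  shows "insert_endo (transpose_endo A (N i)) (\<pi> i) x \<alpha> \<beta>
    = 2 * \<epsilon> (i + 1) * inverse_tensor A (induced_tensor A \<epsilon> \<omega> \<pi>) x \<alpha> \<beta>"
proof -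
  let ?u = "sharp A (\<pi> i) x \<alpha>" and ?v = "sharp A (\<pi> i) x \<beta>"
  have u: "?u \<in> fibre A x" and v: "?v \<in> fibre A x" by (intro sharp_fibre bivector \<alpha> \<beta>)+
  have fu: "flat A (\<omega> i) x ?u = \<alpha>" and fv: "flat A (\<omega> i) x ?v = \<beta>"
    by (intro flat_sharp[OF inverse] \<alpha> \<beta>)+
  have "insert_endo (transpose_endo A (N i)) (\<pi> i) x \<alpha> \<beta>
    = \<omega> i x ?v (N i x ?u) - \<omega> i x ?u (N i x ?v)"
    using inverse_bivector_flat[OF two_form inverse N_fibre[OF u] v, of i i]
      inverse_bivector_flat[OF two_form inverse N_fibre[OF v] u, of i i]
      transpose_flat[OF u, of i] transpose_flat[OF v, of i]
    by (simp add: insert_endo_def fu fv)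
  also have "\<dots> = 2 * \<omega> i x ?v (N i x ?u)"
    using sigma_symmetric[OF v u, of i] two_form_skew[OF two_form u N_fibre[OF v], of i i] by simp
  also have "\<omega> i x ?v (N i x ?u) = \<beta> (N i x ?u)"
    using flat_apply[OF N_fibre[OF u], of "\<omega> i" ?v i] by (simp add: fv)
  \<comment> \<open>The sign inside the inverse of g and the explicit factor are the same, so they
    cancel by \<open>eps_square\<close>.\<close>
  also have "\<dots> = \<epsilon> (i + 1) * inverse_tensor A (induced_tensor A \<epsilon> \<omega> \<pi>) x \<alpha> \<beta>"
    using eps_square[of "i + 1"] linear_on_scaleR[OF dual_fibre_linear[OF \<beta>] N_fibre[OF u]]
    by (simp add: inverse_tensor_def inverse_induced_tensor[OF \<alpha>, of i] flip: mult.assoc)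
  finally show ?thesis by simp
qed

end

theorem theorem5p1:
  fixes A :: "('m::{t2_space, second_countable_topology}, 'e::real_normed_vector,
                'v::real_vector, 'f::real_normed_vector) algebroid"
    and \<epsilon> :: "3 \<Rightarrow> real"
    and \<omega> :: "3 \<Rightarrow> 'm \<Rightarrow> 'v \<Rightarrow> 'v \<Rightarrow> real"
    and \<pi> :: "3 \<Rightarrow> 'm \<Rightarrow> ('v \<Rightarrow> real) \<Rightarrow> ('v \<Rightarrow> real) \<Rightarrow> real"
  assumes "lie_algebroid A"
    and "hypersymplectic A \<epsilon> \<omega> \<pi>"
    and "\<epsilon> 1 * \<epsilon> 2 * \<epsilon> 3 = 1"
  shows "\<forall>i. PN_structure A (\<pi> i) (transition A \<omega> \<pi> i) \<and>
           (\<forall>x. \<forall>\<alpha>\<in>dual_fibre A x. \<forall>\<beta>\<in>dual_fibre A x.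
              insert_endo (transpose_endo A (transition A \<omega> \<pi> i)) (\<pi> i) x \<alpha> \<beta>
                = 2 * \<epsilon> (i + 1) * inverse_tensor A (induced_tensor A \<epsilon> \<omega> \<pi>) x \<alpha> \<beta>)"
proof -
  interpret Hypersymplectic A \<epsilon> \<omega> \<pi>
    using assms by unfold_locales
  show ?thesis using PN_structure_N insert_transpose_N by blast
qed

end
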